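(* Let $R$ be a Dedekind domain, $G$ an affine flat $R$-group scheme, and $B$ a flat $R$-algebra on which $G$ acts. Let $A$ be a Noetherian $R$-algebra, and $\varphi\colon A\rightarrow B^G$ an $R$-algebra map. If the induced map $\varphi_K\colon K\otimes_R A\rightarrow (K\otimes_R B)^{K\otimes_R G}$ is an isomorphism for every algebraically closed field $K$ which is an $R$-algebra, then the canonical map $\varphi_S\colon S\otimes_R A\rightarrow(S\otimes_R B)^{S\otimes_R G}$ is an isomorphism for every $R$-algebra $S$.
   Context: Let $C=R[G]$ be the coordinate ring of $G$; it is an $R$-flat commutative Hopf algebra over $R$. A $G$-module is a right $C$-comodule $M$, with coaction $\omega\colon M\to M\otimes_R C$, and its invariants are $M^G=\{m\in M\mid \omega(m)=m\otimes 1\}$. That $G$ acts on the $R$-algebra $B$ means that $B$ is a $G$-module whose coaction $\omega\colon B\to B\otimes_R C$ is an $R$-algebra map; then $B^G$ is an $R$-subalgebra of $B$. In the claim $S$ ranges over commutative $R$-algebras. For an $R$-algebra $S$, $S\otimes_R G$ denotes the base change of $G$ to $S$, with coordinate ring $S\otimes_R C$, and it acts on $S\otimes_R B$ via the composite $$S\otimes_R B\xrightarrow{1_S\otimes\omega}S\otimes_R B\otimes_R C\xrightarrow{\ \alpha\ }(S\otimes_R B)\otimes_S(S\otimes_R C),$$ where $\alpha(s\otimes b\otimes c)=(s\otimes b)\otimes(1\otimes c)$. Thus $(S\otimes_R B)^{S\otimes_R G}=\{x\in S\otimes_R B\mid (1_S\otimes\omega)(x)=x\otimes 1\}$. The map $\varphi_S\colon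 S\otimes_R A\to (S\otimes_R B)^{S\otimes_R G}$ is defined by $\varphi_S(s\otimes a)=s\otimes\varphi(a)$; $\varphi_K$ is the case $S=K$. *)

theory Defs
  imports "HOL-Algebra.Algebra"
begin

section \<open>Dedekind domains\<close>

definition fraction_field ::
    "('r, 'x) ring_scheme \<Rightarrow> ('f, 'y) ring_scheme \<Rightarrow> ('r \<Rightarrow> 'f) \<Rightarrow> bool" where
  "fraction_field R F h \<longleftrightarrow>
     field F \<and> h \<in> ring_hom R F \<and> inj_on h (carrier R) \<and>
     (\<forall>x\<in>carrier F. \<exists>a\<in>carrier R. \<exists>b\<in>carrier R - {\<zero>\<^bsub>R\<^esub>}. x = h a \<otimes>\<^bsub>F\<^esub> inv\<^bsub>F\<^esub> h b)"

text \<open>Polynomials of HOL-Algebra are coefficient lists, leading coefficient first.\<close>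

definition integral_over ::
    "('r, 'x) ring_scheme \<Rightarrow> ('f, 'y) ring_scheme \<Rightarrow> ('r \<Rightarrow> 'f) \<Rightarrow> 'f \<Rightarrow> bool" where
  "integral_over R F h x \<longleftrightarrow>
     (\<exists>p\<in>carrier (poly_ring R). p \<noteq> [] \<and> lead_coeff p = \<one>\<^bsub>R\<^esub> \<and>
        ring.eval F (map h p) x = \<zero>\<^bsub>F\<^esub>)"

text \<open>
  The fraction field is unique up to isomorphism, so it does not matter which one is used for
  integral closedness; the type \<open>('r \<times> 'r) set\<close> hosts the usual one, made of classes of pairs.
  Fields count as Dedekind domains.
\<close>

definition dedekind_domain :: "('r, 'x) ring_scheme \<Rightarrow> bool" where
  "dedekind_domain R \<longleftrightarrow>
     noetherian_domain R \<and>
     (\<forall>P. primeideal P R \<longrightarrow> P \<noteq> {\<zero>\<^bsub>R\<^esub>} \<longrightarrow> maximalideal P R) \<and>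
     (\<exists>(F :: ('r \<times> 'r) set ring) h. fraction_field R F h \<and>
        (\<forall>x\<in>carrier F. integral_over R F h x \<longrightarrow> x \<in> h ` carrier R))"


section \<open>Modules and algebras\<close>

text \<open>
  The library locale \<open>algebra\<close> describes commutative algebras; here the multiplication need not
  be commutative.
\<close>

locale assoc_algebra = module R M + ring M for R (structure) and M (structure) +
  assumes smult_mult_left:
      "\<lbrakk>r \<in> carrier R; x \<in> carrier M; y \<in> carrier M\<rbrakk>
        \<Longrightarrow> (r \<odot>\<^bsub>M\<^esub> x) \<otimes>\<^bsub>M\<^esub> y = r \<odot>\<^bsub>M\<^esub> (x \<otimes>\<^bsub>M\<^esub> y)"
    and smult_mult_right:
      "\<lbrakk>r \<in> carrier R; x \<in> carrier M; y \<in> carrier M\<rbrakk>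
        \<Longrightarrow> x \<otimes>\<^bsub>M\<^esub> (r \<odot>\<^bsub>M\<^esub> y) = r \<odot>\<^bsub>M\<^esub> (x \<otimes>\<^bsub>M\<^esub> y)"

definition linear_maps ::
    "('r, 'x) ring_scheme \<Rightarrow> ('r, 'm, 'y) module_scheme \<Rightarrow> ('r, 'n, 'z) module_scheme
      \<Rightarrow> ('m \<Rightarrow> 'n) set" where
  "linear_maps R M N =
     {f \<in> carrier M \<rightarrow> carrier N.
        (\<forall>x\<in>carrier M. \<forall>y\<in>carrier M. f (x \<oplus>\<^bsub>M\<^esub> y) = f x \<oplus>\<^bsub>N\<^esub> f y) \<and>
        (\<forall>r\<in>carrier R. \<forall>x\<in>carrier M. f (r \<odot>\<^bsub>M\<^esub> x) = r \<odot>\<^bsub>N\<^esub> f x)}"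

definition algebra_hom ::
    "('r, 'x) ring_scheme \<Rightarrow> ('r, 'm, 'y) module_scheme \<Rightarrow> ('r, 'n, 'z) module_scheme
      \<Rightarrow> ('m \<Rightarrow> 'n) set" where
  "algebra_hom R A B = ring_hom A B \<inter> linear_maps R A B"

definition algebra_iso ::
    "('r, 'x) ring_scheme \<Rightarrow> ('r, 'm, 'y) module_scheme \<Rightarrow> ('r, 'n, 'z) module_scheme
      \<Rightarrow> ('m \<Rightarrow> 'n) set" where
  "algebra_iso R A B = {f \<in> algebra_hom R A B. bij_betw f (carrier A) (carrier B)}"

text \<open>The base ring as an algebra over itself.\<close>

definition base_algebra :: "('r, 'x) ring_scheme \<Rightarrow> ('r, 'r) module" where
  "base_algebra R =
     \<lparr>carrier = carrier R, monoid.mult = monoid.mult R, one = one R,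
      ring.zero = ring.zero R, ring.add = ring.add R,
      smult = monoid.mult R\<rparr>"


section \<open>Tensor products\<close>

text \<open>
  A list \<open>[(m1, n1), \<dots>, (mk, nk)]\<close> stands for the formal sum of the \<open>mi \<otimes> ni\<close>, and the tensor
  product consists of the classes of such lists under the congruence generated by commutativity
  of the sum and by the bilinearity relations. Formal differences are not needed, because
  \<open>(- m) \<otimes> n\<close> is inverse to \<open>m \<otimes> n\<close>.
\<close>

inductive tensor_eq ::
    "('r, 'x) ring_scheme \<Rightarrow> ('r, 'm, 'y) module_scheme \<Rightarrow> ('r, 'n, 'z) module_scheme
      \<Rightarrow> ('m \<times> 'n) list \<Rightarrow> ('m \<times> 'n) list \<Rightarrow> bool"
  for R (structure) and M (structure) and N (structure) where
  refl: "set xs \<subseteq> carrier M \<times> carrier N \<Longrightarrow> tensor_eq R M N xs xs"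
| sym: "tensor_eq R M N xs ys \<Longrightarrow> tensor_eq R M N ys xs"
| trans: "tensor_eq R M N xs ys \<Longrightarrow> tensor_eq R M N ys zs \<Longrightarrow> tensor_eq R M N xs zs"
| append: "tensor_eq R M N xs xs' \<Longrightarrow> tensor_eq R M N ys ys'
    \<Longrightarrow> tensor_eq R M N (xs @ ys) (xs' @ ys')"
| comm: "set xs \<subseteq> carrier M \<times> carrier N \<Longrightarrow> set ys \<subseteq> carrier M \<times> carrier N
    \<Longrightarrow> tensor_eq R M N (xs @ ys) (ys @ xs)"
| zero_left: "n \<in> carrier N \<Longrightarrow> tensor_eq R M N [(\<zero>\<^bsub>M\<^esub>, n)] []"
| zero_right: "m \<in> carrier M \<Longrightarrow> tensor_eq R M N [(m, \<zero>\<^bsub>N\<^esub>)] []"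
| add_left: "m \<in> carrier M \<Longrightarrow> m' \<in> carrier M \<Longrightarrow> n \<in> carrier N
    \<Longrightarrow> tensor_eq R M N [(m \<oplus>\<^bsub>M\<^esub> m', n)] [(m, n), (m', n)]"
| add_right: "m \<in> carrier M \<Longrightarrow> n \<in> carrier N \<Longrightarrow> n' \<in> carrier N
    \<Longrightarrow> tensor_eq R M N [(m, n \<oplus>\<^bsub>N\<^esub> n')] [(m, n), (m, n')]"
| balanced: "r \<in> carrier R \<Longrightarrow> m \<in> carrier M \<Longrightarrow> n \<in> carrier N
    \<Longrightarrow> tensor_eq R M N [(r \<odot>\<^bsub>M\<^esub> m, n)] [(m, r \<odot>\<^bsub>N\<^esub> n)]"

definition tensor_class ::
    "('r, 'x) ring_scheme \<Rightarrow> ('r, 'm, 'y) module_scheme \<Rightarrow> ('r, 'n, 'z) module_scheme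
      \<Rightarrow> ('m \<times> 'n) list \<Rightarrow> ('m \<times> 'n) list set" where
  "tensor_class R M N xs = {ys. tensor_eq R M N xs ys}"

text \<open>
  Operations on classes are defined on arbitrarily chosen representatives; for bilinear data the
  resulting class does not depend on the choice.
\<close>

definition tensor_rep :: "('m \<times> 'n) list set \<Rightarrow> ('m \<times> 'n) list" where
  "tensor_rep u = (SOME xs. xs \<in> u)"

definition pure_tensor ::
    "('r, 'x) ring_scheme \<Rightarrow> ('r, 'm, 'y) module_scheme \<Rightarrow> ('r, 'n, 'z) module_scheme
      \<Rightarrow> 'm \<Rightarrow> 'n \<Rightarrow> ('m \<times> 'n) list set" where
  "pure_tensor R M N m n = tensor_class R M N [(m, n)]"

text \<open>
  If \<open>M\<close> and \<open>N\<close> are algebras, the result is the tensor product algebra; if they are only modules,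
  its \<open>mult\<close> and \<open>one\<close> fields carry no information.
\<close>

definition tensor ::
    "('r, 'x) ring_scheme \<Rightarrow> ('r, 'm, 'y) module_scheme \<Rightarrow> ('r, 'n, 'z) module_scheme
      \<Rightarrow> ('r, ('m \<times> 'n) list set) module" where
  "tensor R M N =
     \<lparr>carrier = {tensor_class R M N xs | xs. set xs \<subseteq> carrier M \<times> carrier N},
      monoid.mult = (\<lambda>u v. tensor_class R M N
        [(m \<otimes>\<^bsub>M\<^esub> m', n \<otimes>\<^bsub>N\<^esub> n'). (m, n) \<leftarrow> tensor_rep u, (m', n') \<leftarrow> tensor_rep v]),
      one = pure_tensor R M N \<one>\<^bsub>M\<^esub> \<one>\<^bsub>N\<^esub>,
      ring.zero = tensor_class R M N [],
      ring.add = (\<lambda>u v. tensor_class R M N (tensor_rep u @ tensor_rep v)),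
      smult = (\<lambda>r u. tensor_class R M N [(r \<odot>\<^bsub>M\<^esub> m, n). (m, n) \<leftarrow> tensor_rep u])\<rparr>"

text \<open>The map \<open>m \<otimes> n \<mapsto> f m n\<close> into the additive group of \<open>P\<close>, for balanced biadditive \<open>f\<close>.\<close>

definition tensor_lift ::
    "('p, 'x) ring_scheme \<Rightarrow> ('m \<Rightarrow> 'n \<Rightarrow> 'p) \<Rightarrow> ('m \<times> 'n) list set \<Rightarrow> 'p" where
  "tensor_lift P f u = foldr (\<lambda>(m, n) s. f m n \<oplus>\<^bsub>P\<^esub> s) (tensor_rep u) \<zero>\<^bsub>P\<^esub>"

text \<open>The map \<open>f \<otimes> g\<close>; the two modules given are the targets of \<open>f\<close> and \<open>g\<close>.\<close>

definition tensor_map ::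
    "('r, 'x) ring_scheme \<Rightarrow> ('r, 'm', 'y) module_scheme \<Rightarrow> ('r, 'n', 'z) module_scheme
      \<Rightarrow> ('m \<Rightarrow> 'm') \<Rightarrow> ('n \<Rightarrow> 'n') \<Rightarrow> ('m \<times> 'n) list set \<Rightarrow> ('m' \<times> 'n') list set" where
  "tensor_map R M' N' f g =
     tensor_lift (tensor R M' N') (\<lambda>m n. pure_tensor R M' N' (f m) (g n))"

text \<open>The canonical map \<open>(L \<otimes> M) \<otimes> N \<rightarrow> L \<otimes> (M \<otimes> N)\<close>.\<close>

definition tensor_assoc ::
    "('r, 'x) ring_scheme \<Rightarrow> ('r, 'l, 'w) module_scheme \<Rightarrow> ('r, 'm, 'y) module_scheme
      \<Rightarrow> ('r, 'n, 'z) module_scheme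
      \<Rightarrow> (('l \<times> 'm) list set \<times> 'n) list set \<Rightarrow> ('l \<times> ('m \<times> 'n) list set) list set" where
  "tensor_assoc R L M N =
     tensor_lift (tensor R L (tensor R M N)) (\<lambda>y n.
       tensor_lift (tensor R L (tensor R M N)) (\<lambda>l m.
         pure_tensor R L (tensor R M N) l (pure_tensor R M N m n)) y)"

text \<open>
  Flatness: tensoring with \<open>M\<close> preserves injectivity of linear maps. A definition cannot quantify
  over all types, so the test modules are those on the type \<open>'r list set\<close>. Up to isomorphism these
  include all finitely generated modules (quotients of the modules of \<open>n\<close>-tuples), and as tensor
  products commute with filtered unions, the property for all modules follows.
\<close>

definition flat :: "('r, 'x) ring_scheme \<Rightarrow> ('r, 'm, 'y) module_scheme \<Rightarrow> bool" where
  "flat R M \<longleftrightarrow>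
     module R M \<and>
     (\<forall>(N :: ('r, 'r list set) module) (N' :: ('r, 'r list set) module) f.
        module R N \<longrightarrow> module R N' \<longrightarrow> f \<in> linear_maps R N N' \<longrightarrow> inj_on f (carrier N) \<longrightarrow>
        inj_on (tensor_map R N' M f id) (carrier (tensor R N M)))"


section \<open>Affine group schemes and their modules\<close>

text \<open>An affine group scheme is given by its coordinate ring, a commutative Hopf algebra.\<close>

locale commutative_hopf_algebra = algebra R C
  for R :: "('r, 'x) ring_scheme" (structure) and C :: "('r, 'c, 'y) module_scheme" (structure) +
  fixes comult :: "'c \<Rightarrow> ('c \<times> 'c) list set"
    and counit :: "'c \<Rightarrow> 'r"
    and antipode :: "'c \<Rightarrow> 'c"
  assumes comult_hom: "comult \<in> algebra_hom R C (tensor R C C)"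
    and counit_hom: "counit \<in> algebra_hom R C (base_algebra R)"
    and antipode_linear: "antipode \<in> linear_maps R C C"
    and coassoc: "c \<in> carrier C \<Longrightarrow>
      tensor_assoc R C C C (tensor_map R (tensor R C C) C comult id (comult c))
        = tensor_map R C (tensor R C C) id comult (comult c)"
    and counit_left: "c \<in> carrier C \<Longrightarrow>
      tensor_lift C (\<lambda>x y. counit x \<odot>\<^bsub>C\<^esub> y) (comult c) = c"
    and counit_right: "c \<in> carrier C \<Longrightarrow>
      tensor_lift C (\<lambda>x y. counit y \<odot>\<^bsub>C\<^esub> x) (comult c) = c"
    and antipode_left: "c \<in> carrier C \<Longrightarrow>
      tensor_lift C (\<lambda>x y. antipode x \<otimes>\<^bsub>C\<^esub> y) (comult c) = counit c \<odot>\<^bsub>C\<^esub> \<one>\<^bsub>C\<^esub>"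
    and antipode_right: "c \<in> carrier C \<Longrightarrow>
      tensor_lift C (\<lambda>x y. x \<otimes>\<^bsub>C\<^esub> antipode y) (comult c) = counit c \<odot>\<^bsub>C\<^esub> \<one>\<^bsub>C\<^esub>"

definition right_comodule ::
    "('r, 'x) ring_scheme \<Rightarrow> ('r, 'c, 'y) module_scheme \<Rightarrow> ('c \<Rightarrow> ('c \<times> 'c) list set)
      \<Rightarrow> ('c \<Rightarrow> 'r) \<Rightarrow> ('r, 'm, 'z) module_scheme \<Rightarrow> ('m \<Rightarrow> ('m \<times> 'c) list set) \<Rightarrow> bool" where
  "right_comodule R C comult counit M \<omega> \<longleftrightarrow>
     module R M \<and>
     \<omega> \<in> linear_maps R M (tensor R M C) \<and>
     (\<forall>m\<in>carrier M.
        tensor_assoc R M C C (tensor_map R (tensor R M C) C \<omega> id (\<omega> m))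
          = tensor_map R M (tensor R C C) id comult (\<omega> m)) \<and>
     (\<forall>m\<in>carrier M. tensor_lift M (\<lambda>x c. counit c \<odot>\<^bsub>M\<^esub> x) (\<omega> m) = m)"

definition acts_on_algebra ::
    "('r, 'x) ring_scheme \<Rightarrow> ('r, 'c, 'y) module_scheme \<Rightarrow> ('c \<Rightarrow> ('c \<times> 'c) list set)
      \<Rightarrow> ('c \<Rightarrow> 'r) \<Rightarrow> ('r, 'b, 'z) module_scheme \<Rightarrow> ('b \<Rightarrow> ('b \<times> 'c) list set) \<Rightarrow> bool" where
  "acts_on_algebra R C comult counit B \<omega> \<longleftrightarrow>
     assoc_algebra R B \<and>
     right_comodule R C comult counit B \<omega> \<and>
     \<omega> \<in> algebra_hom R B (tensor R B C)"

text \<open>The invariants, as a substructure of \<open>M\<close>.\<close>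

definition comodule_invariants ::
    "('r, 'x) ring_scheme \<Rightarrow> ('r, 'c, 'y) module_scheme \<Rightarrow> ('r, 'm, 'z) module_scheme
      \<Rightarrow> ('m \<Rightarrow> ('m \<times> 'c) list set) \<Rightarrow> ('r, 'm, 'z) module_scheme" where
  "comodule_invariants R C M \<omega> =
     M\<lparr>carrier := {m \<in> carrier M. \<omega> m = pure_tensor R M C m \<one>\<^bsub>C\<^esub>}\<rparr>"


section \<open>Base change\<close>

text \<open>The tensor product over \<open>R\<close>, with scalars from \<open>S\<close> acting on the left factor.\<close>

definition base_change ::
    "('r, 'x) ring_scheme \<Rightarrow> ('r, 's, 'y) module_scheme \<Rightarrow> ('r, 'm, 'z) module_scheme
      \<Rightarrow> ('s, ('s \<times> 'm) list set) module" where
  "base_change R S M =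
     \<lparr>carrier = carrier (tensor R S M), monoid.mult = monoid.mult (tensor R S M),
      one = one (tensor R S M),
      ring.zero = ring.zero (tensor R S M), ring.add = ring.add (tensor R S M),
      smult = (\<lambda>s u. tensor_class R S M [(s \<otimes>\<^bsub>S\<^esub> t, m). (t, m) \<leftarrow> tensor_rep u])\<rparr>"

text \<open>The map \<open>s \<otimes> (b \<otimes> c) \<mapsto> (s \<otimes> b) \<otimes> (1 \<otimes> c)\<close> into the tensor product over \<open>S\<close>.\<close>

definition base_change_split ::
    "('r, 'x) ring_scheme \<Rightarrow> ('r, 's, 'w) module_scheme \<Rightarrow> ('r, 'c, 'y) module_scheme
      \<Rightarrow> ('r, 'b, 'z) module_scheme \<Rightarrow> ('s \<times> ('b \<times> 'c) list set) list set
      \<Rightarrow> (('s \<times> 'b) list set \<times> ('s \<times> 'c) list set) list set" where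
  "base_change_split R S C B =
     (let BS = base_change R S B; CS = base_change R S C in
      tensor_lift (tensor S BS CS) (\<lambda>s y.
        tensor_lift (tensor S BS CS) (\<lambda>b c.
          pure_tensor S BS CS (pure_tensor R S B s b) (pure_tensor R S C \<one>\<^bsub>S\<^esub> c)) y))"

definition base_change_coaction ::
    "('r, 'x) ring_scheme \<Rightarrow> ('r, 's, 'w) module_scheme \<Rightarrow> ('r, 'c, 'y) module_scheme
      \<Rightarrow> ('r, 'b, 'z) module_scheme \<Rightarrow> ('b \<Rightarrow> ('b \<times> 'c) list set) \<Rightarrow> ('s \<times> 'b) list set
      \<Rightarrow> (('s \<times> 'b) list set \<times> ('s \<times> 'c) list set) list set" where
  "base_change_coaction R S C B \<omega> =
     base_change_split R S C B \<circ> tensor_map R S (tensor R B C) id \<omega>"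

definition base_change_invariants ::
    "('r, 'x) ring_scheme \<Rightarrow> ('r, 's, 'w) module_scheme \<Rightarrow> ('r, 'c, 'y) module_scheme
      \<Rightarrow> ('r, 'b, 'z) module_scheme \<Rightarrow> ('b \<Rightarrow> ('b \<times> 'c) list set)
      \<Rightarrow> ('s, ('s \<times> 'b) list set) module" where
  "base_change_invariants R S C B \<omega> =
     comodule_invariants S (base_change R S C) (base_change R S B) (base_change_coaction R S C B \<omega>)"

text \<open>The map \<open>s \<otimes> a \<mapsto> s \<otimes> \<phi> a\<close> from \<open>S \<otimes> A\<close> to \<open>S \<otimes> B\<close>.\<close>

definition induced_map ::
    "('r, 'x) ring_scheme \<Rightarrow> ('r, 's, 'w) module_scheme \<Rightarrow> ('r, 'b, 'z) module_scheme
      \<Rightarrow> ('a \<Rightarrow> 'b) \<Rightarrow> ('s \<times> 'a) list set \<Rightarrow> ('s \<times> 'b) list set" where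
  "induced_map R S B \<phi> = tensor_map R S B id \<phi>"

end

theory Submission
  imports Defs
begin

text \<open>
  Put \<open>d b = \<omega> b - b \<otimes> 1\<close>. Since \<open>S \<otimes> (B \<otimes> C)\<close> embeds into \<open>(S \<otimes> B) \<otimes>\<^sub>S (S \<otimes> C)\<close>, the invariants of
  \<open>S \<otimes> B\<close> are the kernel of \<open>S \<otimes> d\<close>, and the claim is the exactness of
  \<open>0 \<rightarrow> S \<otimes> A \<rightarrow> S \<otimes> B \<rightarrow> S \<otimes> (B \<otimes> C)\<close>, a property of the module \<open>S\<close>. As \<open>B\<close> and \<open>B \<otimes> C\<close> are flat, it
  passes to extensions and to filtered unions, so that it suffices to treat cyclic modules \<open>R/J\<close>, by
  noetherian induction on \<open>J\<close>. If \<open>J\<close> is not prime, \<open>R/J\<close> is an extension of smaller cyclic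
    modules. If
  \<open>J\<close> is prime, exactness for an algebraic closure of the fraction field of \<open>R/J\<close> shows that the
  homology for \<open>R/J\<close> consists of elements killed by some \<open>r \<notin> J\<close>; as \<open>A\<close> is noetherian, one \<open>r\<close>
    kills
  the whole kernel, and comparison with \<open>R/(J + r R)\<close> along multiplication by \<open>r\<close> shows that the
  homology vanishes.
\<close>

section \<open>Additive maps and tensor products\<close>

text \<open>Two obstacles shape the proof. The hypothesis concerns fields on the type
  \<open>'r list set\<close> only, and an induction hypothesis cannot range over types. So residue
  fields are encoded by coefficient lists, and every quotient in the induction stays on the type of
  the module it comes from. The second obstacle is the descent from the algebraically closed
  \<open>K\<close> to \<open>R/J\<close>. Nothing is localised: \<open>R/J\<close> is embedded in
  \<open>K\<close>, and around any finite part of \<open>K\<close> there is a map back to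
  \<open>R/J\<close> whose composite with the embedding is multiplication by some \<open>r\<close>
  outside \<open>J\<close>. A relation or a preimage over \<open>K\<close> involves finitely many
  elements, so this map brings it to \<open>R/J\<close> at the price of the factor \<open>r\<close>.
  For the kernel one common \<open>r\<close> is essential. Comparison with
  \<open>R/(J + r R)\<close> shows only that the kernel is divisible by \<open>r\<close>, which
  torsion modules may well be; divisible by \<open>r\<close> and killed by the same
  \<open>r\<close>, it vanishes. In the middle each element may have its own \<open>s\<close>: if
  \<open>s x\<close> is the image of some \<open>y\<close>, comparison yields
  \<open>y = s y'\<close>, and \<open>s\<close> can be cancelled because it is injective on
  \<open>R/J\<close> and \<open>B\<close> is flat.\<close>

definition additive_map ::
    "('p, 'x) ring_scheme \<Rightarrow> ('q, 'y) ring_scheme \<Rightarrow> ('p \<Rightarrow> 'q) \<Rightarrow> bool" where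
  "additive_map P Q f \<longleftrightarrow> f \<in> carrier P \<rightarrow> carrier Q \<and>
     (\<forall>x\<in>carrier P. \<forall>y\<in>carrier P. f (x \<oplus>\<^bsub>P\<^esub> y) = f x \<oplus>\<^bsub>Q\<^esub> f y)"

lemma additive_mapD:
  assumes "additive_map P Q f"
  shows "x \<in> carrier P \<Longrightarrow> f x \<in> carrier Q"
    and "x \<in> carrier P \<Longrightarrow> y \<in> carrier P \<Longrightarrow> f (x \<oplus>\<^bsub>P\<^esub> y) = f x \<oplus>\<^bsub>Q\<^esub> f y"
  using assms by (auto simp: additive_map_def)

lemma additive_map_zero:
  assumes "abelian_group P" "abelian_group Q" "additive_map P Q f"
  shows "f \<zero>\<^bsub>P\<^esub> = \<zero>\<^bsub>Q\<^esub>"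
proof -
  interpret P: abelian_group P by fact
  interpret Q: abelian_group Q by fact
  have c: "f \<zero>\<^bsub>P\<^esub> \<in> carrier Q" using additive_mapD(1)[OF assms(3)] by simp
  have "f \<zero>\<^bsub>P\<^esub> \<oplus>\<^bsub>Q\<^esub> f \<zero>\<^bsub>P\<^esub> = f \<zero>\<^bsub>P\<^esub>"
    using additive_mapD(2)[OF assms(3), of "\<zero>\<^bsub>P\<^esub>" "\<zero>\<^bsub>P\<^esub>"] by simp
  then show ?thesis using c by (metis Q.add.r_cancel_one')
qed

lemma additive_map_minus:
  assumes "abelian_group P" "abelian_group Q" "additive_map P Q f" "x \<in> carrier P"
  shows "f (\<ominus>\<^bsub>P\<^esub> x) = \<ominus>\<^bsub>Q\<^esub> f x"
proof -
  interpret P: abelian_group P by fact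
  interpret Q: abelian_group Q by fact
  have "f (\<ominus>\<^bsub>P\<^esub> x) \<oplus>\<^bsub>Q\<^esub> f x = \<zero>\<^bsub>Q\<^esub>"
    using additive_mapD(2)[OF assms(3), of "\<ominus>\<^bsub>P\<^esub> x" x] assms additive_map_zero[OF assms(1-3)]
    by (simp add: P.l_neg)
  then show ?thesis using additive_mapD(1)[OF assms(3)] assms(4)
    by (simp add: Q.minus_equality)
qed

lemma additive_map_diff:
  assumes "abelian_group P" "abelian_group Q" "additive_map P Q f" "x \<in> carrier P" "y \<in> carrier P"
  shows "f (x \<ominus>\<^bsub>P\<^esub> y) = f x \<ominus>\<^bsub>Q\<^esub> f y"
proof -
  interpret P: abelian_group P by fact
  show ?thesis
    using additive_mapD(2)[OF assms(3), of x "\<ominus>\<^bsub>P\<^esub> y"] additive_map_minus[OF assms(1-3)] assms(4,5)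
    by (simp add: a_minus_def)
qed

lemma additive_map_comp:
  "additive_map P Q f \<Longrightarrow> additive_map Q T g \<Longrightarrow> additive_map P T (\<lambda>x. g (f x))"
  by (auto simp: additive_map_def Pi_def)

lemma additive_map_inj_on:
  assumes "abelian_group P" "abelian_group Q" "additive_map P Q f"
    and "\<And>x. x \<in> carrier P \<Longrightarrow> f x = \<zero>\<^bsub>Q\<^esub> \<Longrightarrow> x = \<zero>\<^bsub>P\<^esub>"
  shows "inj_on f (carrier P)"
proof (rule inj_onI)
  interpret P: abelian_group P by fact
  interpret Q: abelian_group Q by fact
  fix x y assume xy: "x \<in> carrier P" "y \<in> carrier P" "f x = f y"
  have "f (x \<ominus>\<^bsub>P\<^esub> y) = \<zero>\<^bsub>Q\<^esub>"
    using additive_map_diff[OF assms(1-3) xy(1,2)] xy additive_mapD(1)[OF assms(3)]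
    by (simp add: Q.r_neg a_minus_def)
  then have "x \<oplus>\<^bsub>P\<^esub> \<ominus>\<^bsub>P\<^esub> y = \<zero>\<^bsub>P\<^esub>" using assms(4) xy by (simp add: a_minus_def)
  then show "x = y" using xy P.minus_equality[of x "\<ominus>\<^bsub>P\<^esub> y"] by simp
qed

section \<open>Linear and balanced maps\<close>

lemma linear_mapsI:
  assumes "\<And>x. x \<in> carrier M \<Longrightarrow> f x \<in> carrier N"
    and "\<And>x y. x \<in> carrier M \<Longrightarrow> y \<in> carrier M \<Longrightarrow> f (x \<oplus>\<^bsub>M\<^esub> y) = f x \<oplus>\<^bsub>N\<^esub> f y"
    and "\<And>r x. r \<in> carrier R \<Longrightarrow> x \<in> carrier M \<Longrightarrow> f (r \<odot>\<^bsub>M\<^esub> x) = r \<odot>\<^bsub>N\<^esub> f x"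
  shows "f \<in> linear_maps R M N"
  using assms by (auto simp: linear_maps_def)

lemma linear_mapsD:
  assumes "f \<in> linear_maps R M N"
  shows "x \<in> carrier M \<Longrightarrow> f x \<in> carrier N"
    and "x \<in> carrier M \<Longrightarrow> y \<in> carrier M \<Longrightarrow> f (x \<oplus>\<^bsub>M\<^esub> y) = f x \<oplus>\<^bsub>N\<^esub> f y"
    and "r \<in> carrier R \<Longrightarrow> x \<in> carrier M \<Longrightarrow> f (r \<odot>\<^bsub>M\<^esub> x) = r \<odot>\<^bsub>N\<^esub> f x"
    and "additive_map M N f"
  using assms by (auto simp: linear_maps_def additive_map_def)

lemma linear_maps_id: "id \<in> linear_maps R M M" "(\<lambda>x. x) \<in> linear_maps R M M"
  by (auto simp: linear_maps_def)

lemma linear_maps_comp: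
  "f \<in> linear_maps R M N \<Longrightarrow> g \<in> linear_maps R N P \<Longrightarrow> (\<lambda>x. g (f x)) \<in> linear_maps R M P"
  by (auto simp: linear_maps_def Pi_def)

lemma module_abelian: "module R M \<Longrightarrow> abelian_group M"
  by (simp add: module_def)

lemmas linear_map_zero = additive_map_zero[OF module_abelian module_abelian linear_mapsD(4)]
lemmas linear_map_diff = additive_map_diff[OF module_abelian module_abelian linear_mapsD(4)]
lemmas linear_map_inj_on = additive_map_inj_on[OF module_abelian module_abelian linear_mapsD(4)]

text \<open>The target carries addition only: \<open>base_change_split\<close> leads from a tensor
  product over \<open>R\<close> into one over \<open>S\<close>, whose scalars are those of
  \<open>S\<close>.\<close>

definition balanced_map ::
    "('r, 'x) ring_scheme \<Rightarrow> ('r, 'm, 'y) module_scheme \<Rightarrow> ('r, 'n, 'z) module_scheme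
      \<Rightarrow> ('p, 'w) ring_scheme \<Rightarrow> ('m \<Rightarrow> 'n \<Rightarrow> 'p) \<Rightarrow> bool" where
  "balanced_map R M N P f \<longleftrightarrow>
     (\<forall>n\<in>carrier N. additive_map M P (\<lambda>m. f m n)) \<and>
     (\<forall>m\<in>carrier M. additive_map N P (f m)) \<and>
     (\<forall>r\<in>carrier R. \<forall>m\<in>carrier M. \<forall>n\<in>carrier N. f (r \<odot>\<^bsub>M\<^esub> m) n = f m (r \<odot>\<^bsub>N\<^esub> n))"

lemma balanced_mapI:
  assumes "\<And>m n. m \<in> carrier M \<Longrightarrow> n \<in> carrier N \<Longrightarrow> f m n \<in> carrier P"
    and "\<And>m m' n. m \<in> carrier M \<Longrightarrow> m' \<in> carrier M \<Longrightarrow> n \<in> carrier N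
      \<Longrightarrow> f (m \<oplus>\<^bsub>M\<^esub> m') n = f m n \<oplus>\<^bsub>P\<^esub> f m' n"
    and "\<And>m n n'. m \<in> carrier M \<Longrightarrow> n \<in> carrier N \<Longrightarrow> n' \<in> carrier N
      \<Longrightarrow> f m (n \<oplus>\<^bsub>N\<^esub> n') = f m n \<oplus>\<^bsub>P\<^esub> f m n'"
    and "\<And>r m n. r \<in> carrier R \<Longrightarrow> m \<in> carrier M \<Longrightarrow> n \<in> carrier N
      \<Longrightarrow> f (r \<odot>\<^bsub>M\<^esub> m) n = f m (r \<odot>\<^bsub>N\<^esub> n)"
  shows "balanced_map R M N P f"
  using assms by (auto simp: balanced_map_def additive_map_def)

lemma balanced_mapD:
  assumes "balanced_map R M N P f"
  shows "m \<in> carrier M \<Longrightarrow> n \<in> carrier N \<Longrightarrow> f m n \<in> carrier P"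
    and "m \<in> carrier M \<Longrightarrow> m' \<in> carrier M \<Longrightarrow> n \<in> carrier N
      \<Longrightarrow> f (m \<oplus>\<^bsub>M\<^esub> m') n = f m n \<oplus>\<^bsub>P\<^esub> f m' n"
    and "m \<in> carrier M \<Longrightarrow> n \<in> carrier N \<Longrightarrow> n' \<in> carrier N
      \<Longrightarrow> f m (n \<oplus>\<^bsub>N\<^esub> n') = f m n \<oplus>\<^bsub>P\<^esub> f m n'"
    and "r \<in> carrier R \<Longrightarrow> m \<in> carrier M \<Longrightarrow> n \<in> carrier N
      \<Longrightarrow> f (r \<odot>\<^bsub>M\<^esub> m) n = f m (r \<odot>\<^bsub>N\<^esub> n)"
    and "n \<in> carrier N \<Longrightarrow> additive_map M P (\<lambda>m. f m n)"
    and "m \<in> carrier M \<Longrightarrow> additive_map N P (f m)"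
  using assms by (auto simp: balanced_map_def additive_map_def)

text \<open>The fold inside \<open>tensor_lift\<close>, taken on any list instead of the chosen
  representative, so that independence of the representative can be stated.\<close>

definition list_value :: "('p, 'x) ring_scheme \<Rightarrow> ('m \<Rightarrow> 'n \<Rightarrow> 'p) \<Rightarrow> ('m \<times> 'n) list \<Rightarrow> 'p" where
  "list_value P f xs = foldr (\<lambda>(m, n) s. f m n \<oplus>\<^bsub>P\<^esub> s) xs \<zero>\<^bsub>P\<^esub>"

lemma list_value_simps [simp]:
  "list_value P f [] = \<zero>\<^bsub>P\<^esub>"
  "list_value P f ((m, n) # xs) = f m n \<oplus>\<^bsub>P\<^esub> list_value P f xs"
  by (simp_all add: list_value_def)

lemma tensor_lift_list_value: "tensor_lift P f u = list_value P f (tensor_rep u)"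
  by (simp add: tensor_lift_def list_value_def)

lemma list_value_closed:
  assumes "abelian_group P" "balanced_map R M N P f" "set xs \<subseteq> carrier M \<times> carrier N"
  shows "list_value P f xs \<in> carrier P"
proof -
  interpret P: abelian_group P by fact
  show ?thesis using assms(3) by (induction xs) (auto simp: balanced_mapD[OF assms(2)])
qed

lemma list_value_append:
  assumes "abelian_group P" "balanced_map R M N P f"
    and "set xs \<subseteq> carrier M \<times> carrier N" "set ys \<subseteq> carrier M \<times> carrier N"
  shows "list_value P f (xs @ ys) = list_value P f xs \<oplus>\<^bsub>P\<^esub> list_value P f ys"
proof -
  interpret P: abelian_group P by fact
  note c = list_value_closed[OF assms(1,2)]
  show ?thesis using assms(3)
    by (induction xs) (auto simp: c assms(4) balanced_mapD[OF assms(2)] P.a_assoc)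
qed

lemma tensor_eq_carrier:
  assumes "module R M" "module R N" "tensor_eq R M N xs ys"
  shows "set xs \<subseteq> carrier M \<times> carrier N" "set ys \<subseteq> carrier M \<times> carrier N"
proof -
  interpret M: module R M by fact
  interpret N: module R N by fact
  have "set xs \<subseteq> carrier M \<times> carrier N \<and> set ys \<subseteq> carrier M \<times> carrier N"
    using assms(3) by induction auto
  then show "set xs \<subseteq> carrier M \<times> carrier N" "set ys \<subseteq> carrier M \<times> carrier N" by auto
qed

text \<open>Each generator of the congruence is a relation that balanced biadditive maps respect;
  for the zero rules this holds because additive maps between abelian groups preserve zero. It makes
  \<open>tensor_lift\<close> independent of representatives.\<close>

lemma list_value_tensor_eq:
  assumes "abelian_group P" "module R M" "module R N" "balanced_map R M N P f"
    and "tensor_eq R M N xs ys"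
  shows "list_value P f xs = list_value P f ys"
  using assms(5)
proof induction
  interpret P: abelian_group P by fact
  interpret M: module R M by fact
  interpret N: module R N by fact
  note [simp] = balanced_mapD[OF assms(4)] list_value_closed[OF assms(1,4)]
    list_value_append[OF assms(1,4)]
  case (append xs xs' ys ys')
  then show ?case
    using tensor_eq_carrier[OF assms(2,3)] by simp
next
  interpret P: abelian_group P by fact
  note [simp] = balanced_mapD[OF assms(4)] list_value_closed[OF assms(1,4)]
    list_value_append[OF assms(1,4)]
  case (comm xs ys)
  then show ?case by (simp add: P.a_comm)
next
  interpret P: abelian_group P by fact
  case (zero_left n)
  then show ?case
    using additive_map_zero[OF module_abelian[OF assms(2)] assms(1) balanced_mapD(5)[OF assms(4)]]
    by simp
next
  interpret P: abelian_group P by fact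
  case (zero_right m)
  then show ?case
    using additive_map_zero[OF module_abelian[OF assms(3)] assms(1) balanced_mapD(6)[OF assms(4)]]
    by simp
next
  interpret P: abelian_group P by fact
  case (add_left m m' n)
  then show ?case by (simp add: balanced_mapD[OF assms(4)])
next
  interpret P: abelian_group P by fact
  case (add_right m n n')
  then show ?case by (simp add: balanced_mapD[OF assms(4)])
next
  interpret P: abelian_group P by fact
  case (balanced r m n)
  then show ?case by (simp add: balanced_mapD(4)[OF assms(4)])
qed simp_all

section \<open>The tensor product as a module, and its universal property\<close>

lemma tensor_class_eq_iff:
  "set ys \<subseteq> carrier M \<times> carrier N \<Longrightarrow>
    tensor_class R M N xs = tensor_class R M N ys \<longleftrightarrow> tensor_eq R M N xs ys"
  unfolding tensor_class_def
  by (blast intro: tensor_eq.refl tensor_eq.sym tensor_eq.trans)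

lemma tensor_class_eqI:
  "tensor_eq R M N xs ys \<Longrightarrow> tensor_class R M N xs = tensor_class R M N ys"
  unfolding tensor_class_def
  by (blast intro: tensor_eq.sym tensor_eq.trans)

lemma tensor_rep_class:
  assumes "set xs \<subseteq> carrier M \<times> carrier N"
  shows "tensor_eq R M N xs (tensor_rep (tensor_class R M N xs))"
proof -
  have "xs \<in> tensor_class R M N xs" using assms by (simp add: tensor_class_def tensor_eq.refl)
  then have "tensor_rep (tensor_class R M N xs) \<in> tensor_class R M N xs"
    unfolding tensor_rep_def by (metis someI)
  then show ?thesis by (simp add: tensor_class_def)
qed

lemma tensor_carrierE:
  assumes "u \<in> carrier (tensor R M N)"
  obtains xs where "set xs \<subseteq> carrier M \<times> carrier N" "u = tensor_class R M N xs"
  using assms by (auto simp: tensor_def)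

lemma tensor_class_closed:
  "set xs \<subseteq> carrier M \<times> carrier N \<Longrightarrow> tensor_class R M N xs \<in> carrier (tensor R M N)"
  by (auto simp: tensor_def)

lemma tensor_rep:
  assumes "module R M" "module R N" "u \<in> carrier (tensor R M N)"
  shows "set (tensor_rep u) \<subseteq> carrier M \<times> carrier N" "tensor_class R M N (tensor_rep u) = u"
proof -
  obtain xs where xs: "set xs \<subseteq> carrier M \<times> carrier N" "u = tensor_class R M N xs"
    using assms(3) by (rule tensor_carrierE)
  have "tensor_eq R M N xs (tensor_rep u)" using tensor_rep_class xs by auto
  then show "set (tensor_rep u) \<subseteq> carrier M \<times> carrier N" "tensor_class R M N (tensor_rep u) = u"
    using tensor_eq_carrier[OF assms(1,2)] tensor_class_eqI xs by metis+
qed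

lemma tensor_add_class:
  assumes "set xs \<subseteq> carrier M \<times> carrier N" "set ys \<subseteq> carrier M \<times> carrier N"
  shows "tensor_class R M N xs \<oplus>\<^bsub>tensor R M N\<^esub> tensor_class R M N ys = tensor_class R M N (xs @ ys)"
  using tensor_class_eqI[OF tensor_eq.append[OF tensor_rep_class[OF assms(1), of R]
    tensor_rep_class[OF assms(2), of R]]]
  by (simp add: tensor_def)

lemma tensor_zero_class: "\<zero>\<^bsub>tensor R M N\<^esub> = tensor_class R M N []"
  by (simp add: tensor_def)

lemma tensor_eq_map:
  assumes "module R M" "module R N" "module R M'" "module R N'"
    and f: "f \<in> linear_maps R M M'" and g: "g \<in> linear_maps R N N'"
    and "tensor_eq R M N xs ys"
  shows "tensor_eq R M' N' (map (map_prod f g) xs) (map (map_prod f g) ys)"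
  using assms(7)
proof induction
  case (refl xs)
  have "set (map (map_prod f g) xs) \<subseteq> carrier M' \<times> carrier N'"
    using refl by (auto dest: linear_mapsD(1)[OF f] linear_mapsD(1)[OF g])
  then show ?case by (rule tensor_eq.refl)
next
  case (sym xs ys)
  then show ?case by (blast intro: tensor_eq.sym)
next
  case (trans xs ys zs)
  then show ?case by (blast intro: tensor_eq.trans)
next
  case (append xs xs' ys ys')
  then show ?case by (simp add: tensor_eq.append)
next
  case (comm xs ys)
  have "set (map (map_prod f g) xs) \<subseteq> carrier M' \<times> carrier N'"
    "set (map (map_prod f g) ys) \<subseteq> carrier M' \<times> carrier N'"
    using comm by (auto dest: linear_mapsD(1)[OF f] linear_mapsD(1)[OF g])
  then show ?case unfolding map_append by (rule tensor_eq.comm)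
next
  case (zero_left n)
  then show ?case using linear_map_zero[OF assms(1,3) f] linear_mapsD(1)[OF g]
    by (simp add: tensor_eq.zero_left)
next
  case (zero_right m)
  then show ?case using linear_map_zero[OF assms(2,4) g] linear_mapsD(1)[OF f]
    by (simp add: tensor_eq.zero_right)
next
  case (add_left m m' n)
  then show ?case using linear_mapsD[OF f] linear_mapsD[OF g]
    by (simp add: tensor_eq.add_left)
next
  case (add_right m n n')
  then show ?case using linear_mapsD[OF f] linear_mapsD[OF g]
    by (simp add: tensor_eq.add_right)
next
  case (balanced r m n)
  then show ?case using linear_mapsD[OF f] linear_mapsD[OF g]
    by (simp add: tensor_eq.balanced)
qed

lemma module_smult_linear:
  assumes "module R M" "r \<in> carrier R"
  shows "(\<lambda>x. r \<odot>\<^bsub>M\<^esub> x) \<in> linear_maps R M M"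
proof -
  interpret M: module R M by fact
  show ?thesis
    using assms(2)
    by (intro linear_mapsI) (simp_all add: M.smult_r_distr M.smult_assoc1[symmetric] M.R.m_comm)
qed

lemma tensor_smult_class:
  assumes "module R M" "module R N" "r \<in> carrier R" "set xs \<subseteq> carrier M \<times> carrier N"
  shows "r \<odot>\<^bsub>tensor R M N\<^esub> tensor_class R M N xs
    = tensor_class R M N (map (map_prod (\<lambda>m. r \<odot>\<^bsub>M\<^esub> m) id) xs)"
proof -
  have e: "map (\<lambda>(m, n). (r \<odot>\<^bsub>M\<^esub> m, n)) zs = map (map_prod (\<lambda>m. r \<odot>\<^bsub>M\<^esub> m) id) zs" for zs :: "('c \<times> 'e)
    list"
    by (induction zs) auto
  show ?thesis
    using tensor_class_eqI[OF tensor_eq_map[OF assms(1,2,1,2) module_smult_linear[OF assms(1,3)]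
      linear_maps_id(1) tensor_rep_class[OF assms(4)]]]
    by (simp add: tensor_def e)
qed

lemma tensor_module:
  assumes "module R M" "module R N"
  shows "module R (tensor R M N)"
proof -
  interpret M: module R M by fact
  interpret N: module R N by fact
  let ?T = "tensor R M N" and ?C = "carrier M \<times> carrier N"
  note cl = tensor_class_closed[of _ M N R]
  note add = tensor_add_class[of _ M N _ R]
  note sm = tensor_smult_class[OF assms]
  have sc: "set (map (map_prod (\<lambda>m. r \<odot>\<^bsub>M\<^esub> m) id) xs) \<subseteq> ?C"
    if "r \<in> carrier R" "set xs \<subseteq> ?C" for r xs
    using that by auto
  have neg: "tensor_eq R M N (map (map_prod (a_inv M) id) xs @ xs) []"
    if "set xs \<subseteq> ?C" for xs
    using that
  proof (induction xs)
    case (Cons x xs)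
    obtain m n where x: "x = (m, n)" by (cases x)
    then have mn: "m \<in> carrier M" "n \<in> carrier N" and xs: "set xs \<subseteq> ?C" using Cons by auto
    let ?ys = "map (map_prod (a_inv M) id) xs"
    have ys: "set ?ys \<subseteq> ?C" using xs by auto
    have a: "tensor_eq R M N [(\<ominus>\<^bsub>M\<^esub> m, n), (m, n)] []"
      using tensor_eq.trans[OF tensor_eq.sym[OF tensor_eq.add_left[of "\<ominus>\<^bsub>M\<^esub> m" M m n N R]]]
        tensor_eq.zero_left[of n N R M] mn by (simp add: M.l_neg)
    \<comment> \<open>\<open>comm\<close> exchanges whole blocks, so the new term is first moved
      past the negated tail. There it cancels against its negative, and the rest cancels by
      induction.\<close>
    have "tensor_eq R M N ((\<ominus>\<^bsub>M\<^esub> m, n) # ?ys @ [(m, n)]) ((\<ominus>\<^bsub>M\<^esub> m, n) # (m, n) # ?ys)"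
      using tensor_eq.append[OF tensor_eq.refl[of "[(\<ominus>\<^bsub>M\<^esub> m, n)]"]
          tensor_eq.comm[OF ys, of "[(m, n)]" R]] mn
      by simp
    then have "tensor_eq R M N (((\<ominus>\<^bsub>M\<^esub> m, n) # ?ys @ [(m, n)]) @ xs)
        (((\<ominus>\<^bsub>M\<^esub> m, n) # (m, n) # ?ys) @ xs)"
      by (rule tensor_eq.append) (rule tensor_eq.refl[OF xs])
    moreover have "tensor_eq R M N ([(\<ominus>\<^bsub>M\<^esub> m, n), (m, n)] @ (?ys @ xs)) ([] @ [])"
      by (rule tensor_eq.append[OF a Cons.IH[OF xs]])
    ultimately have "tensor_eq R M N (((\<ominus>\<^bsub>M\<^esub> m, n) # ?ys @ [(m, n)]) @ xs) []"
      by (auto intro: tensor_eq.trans)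
    then show ?case by (simp add: x id_def)
  qed (simp add: tensor_eq.refl)
  have "abelian_group ?T"
  proof (rule abelian_groupI)
    fix x y assume "x \<in> carrier ?T" "y \<in> carrier ?T"
    then show "x \<oplus>\<^bsub>?T\<^esub> y \<in> carrier ?T"
      by (elim tensor_carrierE) (auto simp: add intro!: cl)
  next
    show "\<zero>\<^bsub>?T\<^esub> \<in> carrier ?T" unfolding tensor_zero_class by (rule cl) simp
  next
    fix x y z assume "x \<in> carrier ?T" "y \<in> carrier ?T" "z \<in> carrier ?T"
    then show "x \<oplus>\<^bsub>?T\<^esub> y \<oplus>\<^bsub>?T\<^esub> z = x \<oplus>\<^bsub>?T\<^esub> (y \<oplus>\<^bsub>?T\<^esub> z)"
      by (elim tensor_carrierE) (auto simp: add)
  next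
    fix x y assume "x \<in> carrier ?T" "y \<in> carrier ?T"
    then show "x \<oplus>\<^bsub>?T\<^esub> y = y \<oplus>\<^bsub>?T\<^esub> x"
      by (elim tensor_carrierE) (auto simp: add intro!: tensor_class_eqI tensor_eq.comm)
  next
    fix x assume "x \<in> carrier ?T"
    then show "\<zero>\<^bsub>?T\<^esub> \<oplus>\<^bsub>?T\<^esub> x = x"
      by (elim tensor_carrierE) (auto simp: add tensor_zero_class)
  next
    fix x assume "x \<in> carrier ?T"
    then obtain xs where xs: "set xs \<subseteq> ?C" "x = tensor_class R M N xs" by (rule tensor_carrierE)
    have n: "set (map (map_prod (a_inv M) id) xs) \<subseteq> ?C" using xs by auto
    show "\<exists>y\<in>carrier ?T. y \<oplus>\<^bsub>?T\<^esub> x = \<zero>\<^bsub>?T\<^esub>"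
      by (rule bexI[OF _ cl[OF n]])
        (simp add: xs add[OF n xs(1)] tensor_zero_class tensor_class_eqI[OF neg[OF xs(1)]])
  qed
  moreover have "(a \<oplus>\<^bsub>R\<^esub> b) \<odot>\<^bsub>?T\<^esub> x = a \<odot>\<^bsub>?T\<^esub> x \<oplus>\<^bsub>?T\<^esub> b \<odot>\<^bsub>?T\<^esub> x"
    if ab: "a \<in> carrier R" "b \<in> carrier R" and "x \<in> carrier ?T" for a b x
  proof -
    obtain xs where xs: "set xs \<subseteq> ?C" "x = tensor_class R M N xs"
      using \<open>x \<in> carrier ?T\<close> by (rule tensor_carrierE)
    have "tensor_eq R M N (map (map_prod (\<lambda>m. (a \<oplus>\<^bsub>R\<^esub> b) \<odot>\<^bsub>M\<^esub> m) id) xs)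
      (map (map_prod (\<lambda>m. a \<odot>\<^bsub>M\<^esub> m) id) xs @ map (map_prod (\<lambda>m. b \<odot>\<^bsub>M\<^esub> m) id) xs)"
      using xs(1)
    proof (induction xs)
      case (Cons x xs)
      obtain m n where x: "x = (m, n)" by (cases x)
      then have mn: "m \<in> carrier M" "n \<in> carrier N" and xs: "set xs \<subseteq> ?C" using Cons by auto
      let ?ya = "map (map_prod (\<lambda>m. a \<odot>\<^bsub>M\<^esub> m) id) xs"
        and ?yb = "map (map_prod (\<lambda>m. b \<odot>\<^bsub>M\<^esub> m) id) xs"
      have ya: "set ?ya \<subseteq> ?C" and yb: "set ?yb \<subseteq> ?C" using sc[OF _ xs] ab by auto
      have "tensor_eq R M N [((a \<oplus>\<^bsub>R\<^esub> b) \<odot>\<^bsub>M\<^esub> m, n)] [(a \<odot>\<^bsub>M\<^esub> m, n), (b \<odot>\<^bsub>M\<^esub> m, n)]"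
        using ab mn by (simp add: M.smult_l_distr tensor_eq.add_left)
      from tensor_eq.append[OF this Cons.IH[OF xs]]
      have 1: "tensor_eq R M N (map (map_prod (\<lambda>m. (a \<oplus>\<^bsub>R\<^esub> b) \<odot>\<^bsub>M\<^esub> m) id) (x # xs))
        ([(a \<odot>\<^bsub>M\<^esub> m, n)] @ ([(b \<odot>\<^bsub>M\<^esub> m, n)] @ ?ya) @ ?yb)" by (simp add: x id_def)
      \<comment> \<open>Additivity produces the \<open>a\<close>-terms and \<open>b\<close>-terms
        alternately; one exchange per step sorts them into two sums.\<close>
      have "tensor_eq R M N ([(a \<odot>\<^bsub>M\<^esub> m, n)] @ ([(b \<odot>\<^bsub>M\<^esub> m, n)] @ ?ya) @ ?yb)
         ([(a \<odot>\<^bsub>M\<^esub> m, n)] @ (?ya @ [(b \<odot>\<^bsub>M\<^esub> m, n)]) @ ?yb)"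
        by (rule tensor_eq.append[OF tensor_eq.refl tensor_eq.append[OF tensor_eq.comm
          tensor_eq.refl[OF yb]]])
          (use ab mn ya in auto)
      with 1 have "tensor_eq R M N (map (map_prod (\<lambda>m. (a \<oplus>\<^bsub>R\<^esub> b) \<odot>\<^bsub>M\<^esub> m) id) (x # xs))
        ([(a \<odot>\<^bsub>M\<^esub> m, n)] @ (?ya @ [(b \<odot>\<^bsub>M\<^esub> m, n)]) @ ?yb)" by (rule tensor_eq.trans)
      then show ?case by (simp add: x id_def)
    qed (simp add: tensor_eq.refl)
    then show ?thesis using ab xs sc[OF _ xs(1)]
      by (simp add: sm add tensor_class_eqI)
  qed
  moreover have "(a \<otimes>\<^bsub>R\<^esub> b) \<odot>\<^bsub>?T\<^esub> x = a \<odot>\<^bsub>?T\<^esub> (b \<odot>\<^bsub>?T\<^esub> x)"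
    if ab: "a \<in> carrier R" "b \<in> carrier R" and "x \<in> carrier ?T" for a b x
  proof -
    obtain xs where xs: "set xs \<subseteq> ?C" "x = tensor_class R M N xs"
      using \<open>x \<in> carrier ?T\<close> by (rule tensor_carrierE)
    have "map (map_prod (\<lambda>m. (a \<otimes>\<^bsub>R\<^esub> b) \<odot>\<^bsub>M\<^esub> m) id) xs
       = map (map_prod (\<lambda>m. a \<odot>\<^bsub>M\<^esub> m) id) (map (map_prod (\<lambda>m. b \<odot>\<^bsub>M\<^esub> m) id) xs)"
      using xs(1) ab by (auto simp: M.smult_assoc1)
    then show ?thesis using ab xs sc[OF _ xs(1)] by (simp add: sm del: map_map map_eq_conv)
  qed
  moreover have "\<one>\<^bsub>R\<^esub> \<odot>\<^bsub>?T\<^esub> x = x" if "x \<in> carrier ?T" for x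
  proof -
    obtain xs where xs: "set xs \<subseteq> ?C" "x = tensor_class R M N xs"
      using \<open>x \<in> carrier ?T\<close> by (rule tensor_carrierE)
    have "map (map_prod (\<lambda>m. \<one>\<^bsub>R\<^esub> \<odot>\<^bsub>M\<^esub> m) id) xs = xs"
      using xs(1) by (auto intro!: map_idI)
    then show ?thesis using xs by (simp add: sm)
  qed
  moreover have "a \<odot>\<^bsub>?T\<^esub> (x \<oplus>\<^bsub>?T\<^esub> y) = a \<odot>\<^bsub>?T\<^esub> x \<oplus>\<^bsub>?T\<^esub> a \<odot>\<^bsub>?T\<^esub> y"
    if "a \<in> carrier R" "x \<in> carrier ?T" "y \<in> carrier ?T" for a x y
    using that(2,3) that(1) by (elim tensor_carrierE) (simp add: sm add sc[unfolded set_map])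
  moreover have "a \<odot>\<^bsub>?T\<^esub> x \<in> carrier ?T" if "a \<in> carrier R" "x \<in> carrier ?T" for a x
    using that(2,1) by (elim tensor_carrierE) (simp add: sm cl sc[unfolded set_map])
  ultimately show ?thesis using M.R.cring_axioms by (intro moduleI)
qed

lemma tensor_abelian: "module R M \<Longrightarrow> module R N \<Longrightarrow> abelian_group (tensor R M N)"
  by (rule module_abelian[OF tensor_module])

lemma balanced_pure_tensor: "balanced_map R M N (tensor R M N) (pure_tensor R M N)"
  by (rule balanced_mapI)
    (auto simp: pure_tensor_def tensor_add_class
      intro!: tensor_class_closed tensor_class_eqI tensor_eq.add_left tensor_eq.add_right
        tensor_eq.balanced)

lemmas pure_tensor_closed = balanced_mapD(1)[OF balanced_pure_tensor]
lemmas pure_tensor_add_left = balanced_mapD(2)[OF balanced_pure_tensor]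
lemmas pure_tensor_add_right = balanced_mapD(3)[OF balanced_pure_tensor]
lemmas pure_tensor_balanced = balanced_mapD(4)[OF balanced_pure_tensor]

lemma pure_tensor_smult:
  assumes "module R M" "module R N" "r \<in> carrier R" "m \<in> carrier M" "n \<in> carrier N"
  shows "r \<odot>\<^bsub>tensor R M N\<^esub> pure_tensor R M N m n = pure_tensor R M N (r \<odot>\<^bsub>M\<^esub> m) n"
  using assms by (simp add: pure_tensor_def tensor_smult_class)

lemma pure_tensor_linear:
  assumes "module R M" "module R N"
  shows "m \<in> carrier M \<Longrightarrow> pure_tensor R M N m \<in> linear_maps R N (tensor R M N)"
    and "n \<in> carrier N \<Longrightarrow> (\<lambda>m. pure_tensor R M N m n) \<in> linear_maps R M (tensor R M N)"
  by (rule linear_mapsI; simp add: pure_tensor_closed pure_tensor_add_left pure_tensor_add_right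
      pure_tensor_balanced[symmetric] pure_tensor_smult[OF assms])+

lemma tensor_class_Cons:
  assumes "m \<in> carrier M" "n \<in> carrier N" "set xs \<subseteq> carrier M \<times> carrier N"
  shows "tensor_class R M N ((m, n) # xs)
    = pure_tensor R M N m n \<oplus>\<^bsub>tensor R M N\<^esub> tensor_class R M N xs"
  using assms by (simp add: pure_tensor_def tensor_add_class)

text \<open>Lists are formal sums, and the negative of a pure tensor is again pure, so sums of pure
  tensors exhaust the carrier.\<close>

lemma tensor_induct [consumes 1, case_names zero pure add]:
  assumes "u \<in> carrier (tensor R M N)"
    and "P \<zero>\<^bsub>tensor R M N\<^esub>"
    and "\<And>m n. m \<in> carrier M \<Longrightarrow> n \<in> carrier N \<Longrightarrow> P (pure_tensor R M N m n)"
    and "\<And>u v. u \<in> carrier (tensor R M N) \<Longrightarrow> v \<in> carrier (tensor R M N)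
      \<Longrightarrow> P u \<Longrightarrow> P v \<Longrightarrow> P (u \<oplus>\<^bsub>tensor R M N\<^esub> v)"
  shows "P u"
proof -
  obtain xs where "set xs \<subseteq> carrier M \<times> carrier N" and u: "u = tensor_class R M N xs"
    using assms(1) by (rule tensor_carrierE)
  from this(1) have "P (tensor_class R M N xs)"
  proof (induction xs)
    case Nil
    then show ?case using assms(2) by (simp add: tensor_zero_class)
  next
    case (Cons x xs)
    obtain m n where x: "x = (m, n)" by (cases x)
    with Cons show ?case
      by (auto simp: tensor_class_Cons intro!: assms(3,4) pure_tensor_closed tensor_class_closed)
  qed
  then show ?thesis using u by simp
qed

text \<open>The uniqueness half of the universal property. Identities between maps out of tensor
  products are reduced to pure tensors by it.\<close>

lemma tensor_ext:
  assumes "module R M" "module R N" "abelian_group P"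
    and "additive_map (tensor R M N) P f" "additive_map (tensor R M N) P g"
    and "\<And>m n. m \<in> carrier M \<Longrightarrow> n \<in> carrier N
      \<Longrightarrow> f (pure_tensor R M N m n) = g (pure_tensor R M N m n)"
    and "u \<in> carrier (tensor R M N)"
  shows "f u = g u"
  using assms(7)
proof (induction rule: tensor_induct)
  case zero
  show ?case
    by (simp add: additive_map_zero[OF tensor_abelian[OF assms(1,2)] assms(3)] assms(4,5))
next
  case (pure m n)
  then show ?case by (rule assms(6))
next
  case (add u v)
  then show ?case by (simp add: additive_mapD(2)[OF assms(4)] additive_mapD(2)[OF assms(5)])
qed

context
  fixes R :: "('r, 'x) ring_scheme" and M :: "('r, 'm, 'y) module_scheme"
    and N :: "('r, 'n, 'z) module_scheme" and P :: "('p, 'w) ring_scheme" and f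
  assumes M: "module R M" and N: "module R N" and P: "abelian_group P"
    and f: "balanced_map R M N P f"
begin

lemma tensor_lift_class:
  assumes "set xs \<subseteq> carrier M \<times> carrier N"
  shows "tensor_lift P f (tensor_class R M N xs) = list_value P f xs"
  using list_value_tensor_eq[OF P M N f tensor_rep_class[OF assms]]
  by (simp add: tensor_lift_list_value)

lemma tensor_lift_additive: "additive_map (tensor R M N) P (tensor_lift P f)"
  unfolding additive_map_def
proof (intro conjI ballI funcsetI)
  fix u assume "u \<in> carrier (tensor R M N)"
  then show "tensor_lift P f u \<in> carrier P"
    by (elim tensor_carrierE) (simp add: tensor_lift_class list_value_closed[OF P f])
next
  fix u v assume "u \<in> carrier (tensor R M N)" "v \<in> carrier (tensor R M N)"
  then show "tensor_lift P f (u \<oplus>\<^bsub>tensor R M N\<^esub> v) = tensor_lift P f u \<oplus>\<^bsub>P\<^esub> tensor_lift P f v"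
    by (elim tensor_carrierE)
      (simp add: tensor_lift_class tensor_add_class list_value_append[OF P f])
qed

lemma tensor_lift_pure:
  assumes "m \<in> carrier M" "n \<in> carrier N"
  shows "tensor_lift P f (pure_tensor R M N m n) = f m n"
proof -
  interpret P: abelian_group P by (rule P)
  show ?thesis using assms
    by (simp add: pure_tensor_def tensor_lift_class balanced_mapD(1)[OF f])
qed

end

lemma tensor_lift_linear:
  assumes M: "module R M" and N: "module R N" and P: "module R P"
    and f: "balanced_map R M N P f"
    and sm: "\<And>r m n. r \<in> carrier R \<Longrightarrow> m \<in> carrier M \<Longrightarrow> n \<in> carrier N
      \<Longrightarrow> f (r \<odot>\<^bsub>M\<^esub> m) n = r \<odot>\<^bsub>P\<^esub> f m n"
  shows "tensor_lift P f \<in> linear_maps R (tensor R M N) P"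
proof (rule linear_mapsI)
  note add = tensor_lift_additive[OF M N module_abelian[OF P] f]
  interpret M: module R M by (rule M)
  interpret P: module R P by (rule P)
  interpret T: module R "tensor R M N" by (rule tensor_module[OF M N])
  show "tensor_lift P f x \<in> carrier P" if "x \<in> carrier (tensor R M N)" for x
    using additive_mapD(1)[OF add that] .
  show "tensor_lift P f (x \<oplus>\<^bsub>tensor R M N\<^esub> y) = tensor_lift P f x \<oplus>\<^bsub>P\<^esub> tensor_lift P f y"
    if "x \<in> carrier (tensor R M N)" "y \<in> carrier (tensor R M N)" for x y
    using additive_mapD(2)[OF add that] .
  fix r x assume r: "r \<in> carrier R" and x: "x \<in> carrier (tensor R M N)"
  show "tensor_lift P f (r \<odot>\<^bsub>tensor R M N\<^esub> x) = r \<odot>\<^bsub>P\<^esub> tensor_lift P f x"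
  proof (rule tensor_ext[OF M N module_abelian[OF P] _ _ _ x])
    show "additive_map (tensor R M N) P (\<lambda>x. tensor_lift P f (r \<odot>\<^bsub>tensor R M N\<^esub> x))"
      by (rule additive_map_comp[OF linear_mapsD(4)[OF module_smult_linear[OF tensor_module[OF M N]
        r]] add])
    show "additive_map (tensor R M N) P (\<lambda>x. r \<odot>\<^bsub>P\<^esub> tensor_lift P f x)"
      by (rule additive_map_comp[OF add linear_mapsD(4)[OF module_smult_linear[OF P r]]])
    fix m n assume "m \<in> carrier M" "n \<in> carrier N"
    with r show "tensor_lift P f (r \<odot>\<^bsub>tensor R M N\<^esub> pure_tensor R M N m n)
        = r \<odot>\<^bsub>P\<^esub> tensor_lift P f (pure_tensor R M N m n)"
      by (simp add: pure_tensor_smult[OF M N] tensor_lift_pure[OF M N module_abelian[OF P] f] sm)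
  qed
qed

section \<open>Functoriality of the tensor product\<close>

context
  fixes R :: "('r, 'x) ring_scheme" and M :: "('r, 'm, 'y) module_scheme"
    and N :: "('r, 'n, 'z) module_scheme"
    and M' :: "('r, 'm1, 'y1) module_scheme" and N' :: "('r, 'n1, 'z1) module_scheme"
    and f g
  assumes M: "module R M" and N: "module R N" and M': "module R M'" and N': "module R N'"
    and f: "f \<in> linear_maps R M M'" and g: "g \<in> linear_maps R N N'"
begin

lemma tensor_map_balanced:
  "balanced_map R M N (tensor R M' N') (\<lambda>m n. pure_tensor R M' N' (f m) (g n))"
  by (rule balanced_mapI)
    (simp_all add: linear_mapsD[OF f] linear_mapsD[OF g] pure_tensor_closed pure_tensor_add_left
      pure_tensor_add_right pure_tensor_balanced)

lemma tensor_map_linear: "tensor_map R M' N' f g \<in> linear_maps R (tensor R M N) (tensor R M' N')"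
  unfolding tensor_map_def
  by (rule tensor_lift_linear[OF M N tensor_module[OF M' N'] tensor_map_balanced])
    (simp add: linear_mapsD[OF f] linear_mapsD[OF g] pure_tensor_smult[OF M' N'])

lemma tensor_map_pure:
  "m \<in> carrier M \<Longrightarrow> n \<in> carrier N
    \<Longrightarrow> tensor_map R M' N' f g (pure_tensor R M N m n) = pure_tensor R M' N' (f m) (g n)"
  unfolding tensor_map_def
  by (rule tensor_lift_pure[OF M N tensor_abelian[OF M' N'] tensor_map_balanced])

lemma tensor_map_class:
  assumes "set xs \<subseteq> carrier M \<times> carrier N"
  shows "tensor_map R M' N' f g (tensor_class R M N xs)
    = tensor_class R M' N' (map (map_prod f g) xs)"
proof -
  have "list_value (tensor R M' N') (\<lambda>m n. pure_tensor R M' N' (f m) (g n)) xs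
      = tensor_class R M' N' (map (map_prod f g) xs)" using assms
  proof (induction xs)
    case (Cons x xs)
    have "set (map (map_prod f g) xs) \<subseteq> carrier M' \<times> carrier N'"
      using Cons by (auto dest: linear_mapsD(1)[OF f] linear_mapsD(1)[OF g])
    with Cons show ?case
      by (cases x) (simp add: tensor_class_Cons linear_mapsD(1)[OF f] linear_mapsD(1)[OF g])
  qed (simp add: tensor_zero_class)
  then show ?thesis unfolding tensor_map_def
    using tensor_lift_class[OF M N tensor_abelian[OF M' N'] tensor_map_balanced assms] by simp
qed

end

lemma tensor_map_comp:
  assumes "module R M" "module R N" "module R M'" "module R N'" "module R M''" "module R N''"
    and "f \<in> linear_maps R M M'" "g \<in> linear_maps R N N'"
    and "f' \<in> linear_maps R M' M''" "g' \<in> linear_maps R N' N''"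
    and "u \<in> carrier (tensor R M N)"
  shows "tensor_map R M'' N'' f' g' (tensor_map R M' N' f g u)
    = tensor_map R M'' N'' (\<lambda>x. f' (f x)) (\<lambda>x. g' (g x)) u"
proof (rule tensor_ext[OF assms(1,2) tensor_abelian[OF assms(5,6)] _ _ _ assms(11)])
  note c = linear_maps_comp[OF assms(7,9)] linear_maps_comp[OF assms(8,10)]
  show "additive_map (tensor R M N) (tensor R M'' N'')
      (\<lambda>u. tensor_map R M'' N'' f' g' (tensor_map R M' N' f g u))"
    by (rule linear_mapsD(4)[OF linear_maps_comp[OF tensor_map_linear tensor_map_linear]])
      (fact assms)+
  show "additive_map (tensor R M N) (tensor R M'' N'')
      (tensor_map R M'' N'' (\<lambda>x. f' (f x)) (\<lambda>x. g' (g x)))"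
    by (rule linear_mapsD(4)[OF tensor_map_linear]) (fact assms c)+
  fix m n assume "m \<in> carrier M" "n \<in> carrier N"
  then show "tensor_map R M'' N'' f' g' (tensor_map R M' N' f g (pure_tensor R M N m n))
    = tensor_map R M'' N'' (\<lambda>x. f' (f x)) (\<lambda>x. g' (g x)) (pure_tensor R M N m n)"
    by (simp add: tensor_map_pure[OF assms(1-4,7,8)] tensor_map_pure[OF assms(3-6,9,10)]
      tensor_map_pure[OF assms(1,2,5,6) c] linear_mapsD(1)[OF assms(7)]
        linear_mapsD(1)[OF assms(8)])
qed

lemma linear_maps_cong:
  assumes "module R M" "f \<in> linear_maps R M N" "\<And>x. x \<in> carrier M \<Longrightarrow> f x = f' x"
  shows "f' \<in> linear_maps R M N"
proof -
  interpret M: module R M by fact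
  show ?thesis using linear_mapsD[OF assms(2)]
    by (intro linear_mapsI) (simp_all add: assms(3)[symmetric])
qed

lemma tensor_map_cong:
  assumes "module R M" "module R N" "module R M'" "module R N'"
    and "f \<in> linear_maps R M M'" "g \<in> linear_maps R N N'"
    and "\<And>x. x \<in> carrier M \<Longrightarrow> f x = f' x" "\<And>x. x \<in> carrier N \<Longrightarrow> g x = g' x"
    and "u \<in> carrier (tensor R M N)"
  shows "tensor_map R M' N' f g u = tensor_map R M' N' f' g' u"
proof -
  have f': "f' \<in> linear_maps R M M'" and g': "g' \<in> linear_maps R N N'"
    using linear_maps_cong assms(1,2,5-8) by blast+
  show ?thesis
    by (rule tensor_ext[OF assms(1,2) tensor_abelian[OF assms(3,4)] _ _ _ assms(9)])
      (use assms f' g' in \<open>auto simp: tensor_map_pure intro!: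
        linear_mapsD(4)[OF tensor_map_linear]\<close>)
qed

lemma tensor_map_id:
  assumes "module R M" "module R N" "\<And>x. x \<in> carrier M \<Longrightarrow> f x = x" "\<And>x. x \<in> carrier N \<Longrightarrow> g x = x"
    and "u \<in> carrier (tensor R M N)"
  shows "tensor_map R M N f g u = u"
proof -
  have f: "f \<in> linear_maps R M M" and g: "g \<in> linear_maps R N N"
    using linear_maps_cong[OF assms(1) linear_maps_id(1), of f]
      linear_maps_cong[OF assms(2) linear_maps_id(1), of g] assms(3,4) by auto
  show ?thesis
    by (rule tensor_ext[OF assms(1,2) tensor_abelian[OF assms(1,2)] _ _ _ assms(5)])
      (simp_all add: tensor_map_pure[OF assms(1,2,1,2) f g] assms(3,4)
        linear_mapsD(4)[OF tensor_map_linear[OF assms(1,2,1,2) f g]]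
          linear_mapsD(4)[OF linear_maps_id(2)])
qed

lemma tensor_map_commute:
  assumes "module R M" "module R M'" "module R N" "module R N'"
    and "f \<in> linear_maps R M M'" "g \<in> linear_maps R N N'" "u \<in> carrier (tensor R M N)"
  shows "tensor_map R M' N' id g (tensor_map R M' N f id u)
    = tensor_map R M' N' f id (tensor_map R M N' id g u)"
proof -
  note i = linear_maps_id(1)[of R]
  show ?thesis
    using tensor_map_comp[OF assms(1,3,2,3,2,4) assms(5) i i assms(6,7)]
      tensor_map_comp[OF assms(1,3,1,4,2,4) i assms(6) assms(5) i assms(7)]
    by simp
qed

lemma tensor_map_smult_left:
  assumes "module R M" "module R N" "r \<in> carrier R" "u \<in> carrier (tensor R M N)"
  shows "tensor_map R M N (\<lambda>m. r \<odot>\<^bsub>M\<^esub> m) id u = r \<odot>\<^bsub>tensor R M N\<^esub> u"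
proof (rule tensor_ext[OF assms(1,2) tensor_abelian[OF assms(1,2)] _ _ _ assms(4)])
  note sm = module_smult_linear[OF assms(1,3)]
  show "additive_map (tensor R M N) (tensor R M N) (tensor_map R M N (\<lambda>m. r \<odot>\<^bsub>M\<^esub> m) id)"
    by (rule linear_mapsD(4)[OF tensor_map_linear[OF assms(1,2,1,2) sm linear_maps_id(1)]])
  show "additive_map (tensor R M N) (tensor R M N) ((\<odot>\<^bsub>tensor R M N\<^esub>) r)"
    by (rule linear_mapsD(4)[OF module_smult_linear[OF tensor_module[OF assms(1,2)] assms(3)]])
  fix m n assume "m \<in> carrier M" "n \<in> carrier N"
  then show "tensor_map R M N (\<lambda>m. r \<odot>\<^bsub>M\<^esub> m) id (pure_tensor R M N m n)
      = r \<odot>\<^bsub>tensor R M N\<^esub> pure_tensor R M N m n"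
    using assms by (simp add: tensor_map_pure[OF assms(1,2,1,2) sm linear_maps_id(1)]
      pure_tensor_smult)
qed

lemma tensor_map_surj:
  assumes "module R M" "module R N" "module R M'" "f \<in> linear_maps R M M'" "f ` carrier M = carrier
    M'"
    and "u \<in> carrier (tensor R M' N)"
  obtains v where "v \<in> carrier (tensor R M N)" "u = tensor_map R M' N f id v"
proof -
  interpret T: module R "tensor R M N" by (rule tensor_module) fact+
  note l = tensor_map_linear[OF assms(1,2,3,2,4) linear_maps_id(1)]
  have "\<exists>v\<in>carrier (tensor R M N). u = tensor_map R M' N f id v"
    using assms(6)
  proof (induction rule: tensor_induct)
    case zero
    have "\<zero>\<^bsub>tensor R M' N\<^esub> = tensor_map R M' N f id \<zero>\<^bsub>tensor R M N\<^esub>"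
      using linear_map_zero[OF tensor_module[OF assms(1,2)] tensor_module[OF assms(3,2)] l] by simp
    then show ?case by (rule bexI[OF _ T.zero_closed])
  next
    case (pure m' n)
    then obtain m where m: "m \<in> carrier M" "m' = f m" using assms(5) by blast
    then have "pure_tensor R M' N m' n = tensor_map R M' N f id (pure_tensor R M N m n)"
      unfolding tensor_map_pure[OF assms(1,2,3,2,4) linear_maps_id(1) m(1) pure(2)] by simp
    then show ?case by (rule bexI) (simp add: m pure pure_tensor_closed)
  next
    case (add u v)
    then obtain u' v' where u': "u' \<in> carrier (tensor R M N)" "u = tensor_map R M' N f id u'"
      and v': "v' \<in> carrier (tensor R M N)" "v = tensor_map R M' N f id v'" by blast
    show ?case unfolding u'(2) v'(2)
      by (rule bexI, rule linear_mapsD(2)[OF l u'(1) v'(1), symmetric], rule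
        T.a_closed[OF u'(1) v'(1)])
  qed
  with that show ?thesis by blast
qed

text \<open>A derivation of the congruence is finite and mentions finitely many elements of
  \<open>M\<close>, including those of the intermediate lists introduced by transitivity. Over any
  submodule that contains them the same derivation goes through. This is how the commutation of
  tensor products with filtered unions is used.\<close>

lemma tensor_eq_finite_support:
  assumes "module R M" "module R N" "tensor_eq R M N xs ys"
  shows "\<exists>F. finite F \<and> F \<subseteq> carrier M \<and>
    (\<forall>H. submodule H R M \<longrightarrow> F \<subseteq> H \<longrightarrow> tensor_eq R (M\<lparr>carrier := H\<rparr>) N xs ys)"
    (is "\<exists>F. ?P F xs ys")
proof -
  interpret M: module R M by fact
  let ?M = "\<lambda>H. M\<lparr>carrier := H\<rparr>"
  show ?thesis using assms(3)
  proof induction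
    case (refl xs)
    have "tensor_eq R (?M H) N xs xs" if "fst ` set xs \<subseteq> H" for H
      by (rule tensor_eq.refl) (use refl that in auto)
    moreover have "fst ` set xs \<subseteq> carrier M" using refl by auto
    ultimately show ?case by (intro exI[of _ "fst ` set xs"]) auto
  next
    case (sym xs ys)
    then obtain F where F: "?P F xs ys" by (elim exE)
    then have "?P F ys xs" by (simp add: tensor_eq.sym)
    then show ?case by (rule exI)
  next
    case (trans xs ys zs)
    from trans.IH obtain F G where F: "?P F xs ys" and G: "?P G ys zs" by (elim exE)
    have "tensor_eq R (?M H) N xs zs" if "submodule H R M" "F \<union> G \<subseteq> H" for H
      using tensor_eq.trans[of R "?M H" N xs ys zs] F G that by simp
    with F G show ?case by (intro exI[of _ "F \<union> G"]) simp
  next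
    case (append xs xs' ys ys')
    from append.IH obtain F G where F: "?P F xs xs'" and G: "?P G ys ys'" by (elim exE)
    have "tensor_eq R (?M H) N (xs @ ys) (xs' @ ys')" if "submodule H R M" "F \<union> G \<subseteq> H" for H
      using tensor_eq.append[of R "?M H" N xs xs' ys ys'] F G that by simp
    with F G show ?case by (intro exI[of _ "F \<union> G"]) simp
  next
    case (comm xs ys)
    have "tensor_eq R (?M H) N (xs @ ys) (ys @ xs)" if "fst ` set xs \<union> fst ` set ys \<subseteq> H" for H
      by (rule tensor_eq.comm) (use comm that in auto)
    moreover have "fst ` set xs \<union> fst ` set ys \<subseteq> carrier M" using comm by auto
    ultimately show ?case by (intro exI[of _ "fst ` set xs \<union> fst ` set ys"]) auto
  next
    case (zero_left n)
    have "tensor_eq R (?M H) N [(\<zero>\<^bsub>M\<^esub>, n)] []" for H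
      using tensor_eq.zero_left[OF zero_left, of R "?M H"] by simp
    then show ?case by (intro exI[of _ "{}"]) auto
  next
    case (zero_right m)
    have "tensor_eq R (?M H) N [(m, \<zero>\<^bsub>N\<^esub>)] []" if "m \<in> H" for H
      using tensor_eq.zero_right[of m "?M H" R N] that by simp
    then show ?case using zero_right by (intro exI[of _ "{m}"]) auto
  next
    case (add_left m m' n)
    have "tensor_eq R (?M H) N [(m \<oplus>\<^bsub>M\<^esub> m', n)] [(m, n), (m', n)]" if "m \<in> H" "m' \<in> H" for H
      using tensor_eq.add_left[of m "?M H" m' n N R] that add_left by simp
    then show ?case using add_left by (intro exI[of _ "{m, m'}"]) auto
  next
    case (add_right m n n')
    have "tensor_eq R (?M H) N [(m, n \<oplus>\<^bsub>N\<^esub> n')] [(m, n), (m, n')]" if "m \<in> H" for H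
      using tensor_eq.add_right[of m "?M H" n N n' R] that add_right by simp
    then show ?case using add_right by (intro exI[of _ "{m}"]) auto
  next
    case (balanced r m n)
    have "tensor_eq R (?M H) N [(r \<odot>\<^bsub>M\<^esub> m, n)] [(m, r \<odot>\<^bsub>N\<^esub> n)]" if "m \<in> H" for H
      using tensor_eq.balanced[of r R m "?M H" n N] that balanced by simp
    then show ?case using balanced by (intro exI[of _ "{m}"]) auto
  qed
qed

section \<open>Submodules, quotients and flatness\<close>

text \<open>The module axioms are equations, and the existence of negatives also passes along a
  surjection that respects the operations. This serves both quotients and changes of the underlying
  type.\<close>

lemma module_image:
  assumes M: "module R M"
    and carr: "carrier Q = p ` carrier M" and zero: "\<zero>\<^bsub>Q\<^esub> = p \<zero>\<^bsub>M\<^esub>"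
    and add: "\<And>x y. x \<in> carrier M \<Longrightarrow> y \<in> carrier M \<Longrightarrow> p x \<oplus>\<^bsub>Q\<^esub> p y = p (x \<oplus>\<^bsub>M\<^esub> y)"
    and smult: "\<And>r x. r \<in> carrier R \<Longrightarrow> x \<in> carrier M \<Longrightarrow> r \<odot>\<^bsub>Q\<^esub> p x = p (r \<odot>\<^bsub>M\<^esub> x)"
  shows "module R Q" "p \<in> linear_maps R M Q"
proof -
  interpret M: module R M by (rule M)
  have "abelian_group Q"
  proof (rule abelian_groupI)
    show "\<exists>y\<in>carrier Q. y \<oplus>\<^bsub>Q\<^esub> x = \<zero>\<^bsub>Q\<^esub>" if "x \<in> carrier Q" for x
    proof -
      from that obtain m where "m \<in> carrier M" "x = p m" unfolding carr by blast
      then show ?thesis unfolding carr zero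
        by (intro bexI[of _ "p (\<ominus>\<^bsub>M\<^esub> m)"]) (simp_all add: add M.l_neg)
    qed
  qed (auto simp: carr zero add M.a_ac)
  then show "module R Q"
    using M.R.cring_axioms
    by (intro moduleI) (auto simp: carr smult add M.smult_l_distr M.smult_r_distr M.smult_assoc1)
  show "p \<in> linear_maps R M Q"
    by (rule linear_mapsI) (simp_all add: carr add smult)
qed

section \<open>Submodules, quotients and right exactness\<close>

lemma submodule_subset: "submodule H R M \<Longrightarrow> H \<subseteq> carrier M"
  using subgroup.subset[of H "add_monoid M"] by (simp add: submodule_def)

lemma submodule_zero: "submodule H R M \<Longrightarrow> \<zero>\<^bsub>M\<^esub> \<in> H"
  using subgroup.one_closed[of H "add_monoid M"] by (simp add: submodule_def)

lemma submodule_add: "submodule H R M \<Longrightarrow> x \<in> H \<Longrightarrow> y \<in> H \<Longrightarrow> x \<oplus>\<^bsub>M\<^esub> y \<in> H"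
  using subgroup.m_closed[of H "add_monoid M" x y] by (simp add: submodule_def)

lemma submodule_smult: "submodule H R M \<Longrightarrow> r \<in> carrier R \<Longrightarrow> x \<in> H \<Longrightarrow> r \<odot>\<^bsub>M\<^esub> x \<in> H"
  by (rule submodule.smult_closed)

lemma submodule_neg: "module R M \<Longrightarrow> submodule H R M \<Longrightarrow> x \<in> H \<Longrightarrow> \<ominus>\<^bsub>M\<^esub> x \<in> H"
  by (rule module.submoduleE(3))

lemma submoduleI':
  assumes "module R M" "H \<subseteq> carrier M" "\<zero>\<^bsub>M\<^esub> \<in> H"
    and "\<And>x y. x \<in> H \<Longrightarrow> y \<in> H \<Longrightarrow> x \<oplus>\<^bsub>M\<^esub> y \<in> H"
    and "\<And>r x. r \<in> carrier R \<Longrightarrow> x \<in> H \<Longrightarrow> r \<odot>\<^bsub>M\<^esub> x \<in> H"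
  shows "submodule H R M"
proof -
  interpret M: module R M by fact
  have "\<ominus>\<^bsub>M\<^esub> x \<in> H" if "x \<in> H" for x
    using assms(5)[of "\<ominus>\<^bsub>R\<^esub> \<one>\<^bsub>R\<^esub>" x] that assms(2) by (auto simp: M.smult_l_minus)
  then show ?thesis using assms by (intro M.submoduleI) auto
qed

lemma image_submodule:
  assumes M: "module R M" and K: "module R K" and f: "f \<in> linear_maps R M K"
  shows "submodule (f ` carrier M) R K"
proof (rule submoduleI'[OF K])
  interpret M: module R M by (rule M)
  note fD = linear_mapsD[OF f]
  show "f ` carrier M \<subseteq> carrier K" using fD(1) by blast
  show "\<zero>\<^bsub>K\<^esub> \<in> f ` carrier M" using linear_map_zero[OF M K f] M.zero_closed by (metis imageI)
  show "x \<oplus>\<^bsub>K\<^esub> y \<in> f ` carrier M" if xy: "x \<in> f ` carrier M" "y \<in> f ` carrier M" for x y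
  proof -
    from xy obtain m n where "m \<in> carrier M" "n \<in> carrier M" "x = f m" "y = f n" by blast
    then show ?thesis by (intro image_eqI[of _ _ "m \<oplus>\<^bsub>M\<^esub> n"]) (simp_all add: fD(2))
  qed
  show "r \<odot>\<^bsub>K\<^esub> x \<in> f ` carrier M" if r: "r \<in> carrier R" and "x \<in> f ` carrier M" for r x
  proof -
    from that obtain m where "m \<in> carrier M" "x = f m" by blast
    with r show ?thesis by (intro image_eqI[of _ _ "r \<odot>\<^bsub>M\<^esub> m"]) (simp_all add: fD(3))
  qed
qed

lemma restrict_module: "module R M \<Longrightarrow> submodule H R M \<Longrightarrow> module R (M\<lparr>carrier := H\<rparr>)"
  by (rule submodule.submodule_is_module)

lemma restrict_inclusion: "H \<subseteq> H' \<Longrightarrow> id \<in> linear_maps R (M\<lparr>carrier := H\<rparr>) (M\<lparr>carrier := H'\<rparr>)"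
  by (auto simp: linear_maps_def)

lemma restrict_inclusion': "H \<subseteq> carrier M \<Longrightarrow> id \<in> linear_maps R (M\<lparr>carrier := H\<rparr>) M"
  by (auto simp: linear_maps_def)

text \<open>The classes are represented by chosen elements, so that \<open>M\<close> and its quotient are modules
  on the same type.\<close>

lemma quotient_module:
  fixes R :: "('r, 'x) ring_scheme" and M :: "('r, 'm) module"
  assumes M: "module R M" and H: "submodule H R M"
  obtains Q :: "('r, 'm) module" and p where "module R Q" "p \<in> linear_maps R M Q"
    "p ` carrier M = carrier Q" "\<And>m. m \<in> carrier M \<Longrightarrow> p m = \<zero>\<^bsub>Q\<^esub> \<longleftrightarrow> m \<in> H"
proof -
  interpret M: module R M by (rule M)
  have Hc: "h \<in> carrier M" if "h \<in> H" for h using submodule_subset[OF H] that by blast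
  define E where "E x = {y. \<exists>h\<in>H. y = x \<oplus>\<^bsub>M\<^esub> h}" for x
  define p where "p x = (SOME y. y \<in> E x)" for x
  have self: "x \<in> E x" if "x \<in> carrier M" for x
    unfolding E_def using that submodule_zero[OF H] by force
  then have "p x \<in> E x" if "x \<in> carrier M" for x
    unfolding p_def using that by (metis someI)
  then have pE: "\<exists>h\<in>H. p x = x \<oplus>\<^bsub>M\<^esub> h" if "x \<in> carrier M" for x
    using that by (auto simp: E_def)
  have sub: "E (x \<oplus>\<^bsub>M\<^esub> h) \<subseteq> E x" if "x \<in> carrier M" "h \<in> H" for x h
    unfolding E_def using that submodule_add[OF H] Hc by (fastforce simp: M.a_assoc)
  have eq: "p (x \<oplus>\<^bsub>M\<^esub> h) = p x" if x: "x \<in> carrier M" and h: "h \<in> H" for x h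
  proof -
    have "E x = E (x \<oplus>\<^bsub>M\<^esub> h \<oplus>\<^bsub>M\<^esub> \<ominus>\<^bsub>M\<^esub> h)" using x Hc[OF h] by (simp add: M.a_assoc M.r_neg)
    also have "\<dots> \<subseteq> E (x \<oplus>\<^bsub>M\<^esub> h)" using sub[of "x \<oplus>\<^bsub>M\<^esub> h" "\<ominus>\<^bsub>M\<^esub> h"] x Hc[OF h] submodule_neg[OF M H h] by
      simp
    finally have "E (x \<oplus>\<^bsub>M\<^esub> h) = E x" using sub[OF x h] by blast
    then show ?thesis by (simp add: p_def)
  qed
  have pc: "p x \<in> carrier M" if "x \<in> carrier M" for x using pE[OF that] that Hc by auto
  define Q :: "('r, 'm) module" where "Q = \<lparr>carrier = p ` carrier M, monoid.mult = monoid.mult M,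
    one = one M,
    ring.zero = p \<zero>\<^bsub>M\<^esub>, ring.add = (\<lambda>x y. p (x \<oplus>\<^bsub>M\<^esub> y)), smult = (\<lambda>r x. p (r \<odot>\<^bsub>M\<^esub> x))\<rparr>"
  have add: "p (p x \<oplus>\<^bsub>M\<^esub> p y) = p (x \<oplus>\<^bsub>M\<^esub> y)" if "x \<in> carrier M" "y \<in> carrier M" for x y
  proof -
    obtain h k where hk: "h \<in> H" "p x = x \<oplus>\<^bsub>M\<^esub> h" "k \<in> H" "p y = y \<oplus>\<^bsub>M\<^esub> k" using pE \<open>x \<in> _\<close> \<open>y \<in> _\<close> by
      blast
    have "p x \<oplus>\<^bsub>M\<^esub> p y = x \<oplus>\<^bsub>M\<^esub> y \<oplus>\<^bsub>M\<^esub> (h \<oplus>\<^bsub>M\<^esub> k)" using that Hc[OF hk(1)] Hc[OF hk(3)] hk by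
      (simp add: M.a_ac)
    then show ?thesis using eq that submodule_add[OF H hk(1,3)] by simp
  qed
  have sm: "p (r \<odot>\<^bsub>M\<^esub> p x) = p (r \<odot>\<^bsub>M\<^esub> x)" if "r \<in> carrier R" "x \<in> carrier M" for r x
  proof -
    obtain h where h: "h \<in> H" "p x = x \<oplus>\<^bsub>M\<^esub> h" using pE \<open>x \<in> _\<close> by blast
    then show ?thesis using eq[of "r \<odot>\<^bsub>M\<^esub> x" "r \<odot>\<^bsub>M\<^esub> h"] that Hc[OF h(1)]
      submodule_smult[OF H that(1) h(1)]
      by (simp add: M.smult_r_distr)
  qed
  have mod: "module R Q" "p \<in> linear_maps R M Q"
    by (rule module_image[OF M, of Q p]; simp add: Q_def add sm)+
  moreover have "p ` carrier M = carrier Q" by (simp add: Q_def)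
  moreover have "p m = \<zero>\<^bsub>Q\<^esub> \<longleftrightarrow> m \<in> H" if m: "m \<in> carrier M" for m
  proof
    assume "m \<in> H"
    then show "p m = \<zero>\<^bsub>Q\<^esub>" using eq[OF M.zero_closed, of m] m by (simp add: Q_def)
  next
    assume "p m = \<zero>\<^bsub>Q\<^esub>"
    then have e: "p m = p \<zero>\<^bsub>M\<^esub>" by (simp add: Q_def)
    obtain h k where hk: "h \<in> H" "p m = m \<oplus>\<^bsub>M\<^esub> h" "k \<in> H" "p \<zero>\<^bsub>M\<^esub> = \<zero>\<^bsub>M\<^esub> \<oplus>\<^bsub>M\<^esub> k"
      using pE m M.zero_closed by blast
    have "m = k \<oplus>\<^bsub>M\<^esub> \<ominus>\<^bsub>M\<^esub> h"
      using hk e m Hc[OF hk(1)] Hc[OF hk(3)] M.add.inv_solve_right[of m k h] by simp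
    then show "m \<in> H" using submodule_add[OF H hk(3) submodule_neg[OF M H hk(1)]] by simp
  qed
  ultimately show thesis by (rule that)
qed

text \<open>Right exactness: \<open>M \<otimes> N\<close> modulo the image of \<open>M' \<otimes> N\<close> receives a map from \<open>M'' \<otimes> N\<close>, as lifts
  of
  \<open>m''\<close> to \<open>M\<close> differ by elements of the image of \<open>M'\<close>.\<close>

lemma tensor_right_exact:
  fixes M :: "('r, 'm, 'y) module_scheme" and N :: "('r, 'n, 'z) module_scheme"
  assumes M': "module R M'" and M: "module R M" and M'': "module R M''" and N: "module R N"
    and i: "i \<in> linear_maps R M' M" and p: "p \<in> linear_maps R M M''"
    and surj: "p ` carrier M = carrier M''"
    and ker: "\<And>m. m \<in> carrier M \<Longrightarrow> p m = \<zero>\<^bsub>M''\<^esub> \<Longrightarrow> m \<in> i ` carrier M'"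
    and u: "u \<in> carrier (tensor R M N)" "tensor_map R M'' N p id u = \<zero>\<^bsub>tensor R M'' N\<^esub>"
  obtains v where "v \<in> carrier (tensor R M' N)" "u = tensor_map R M N i id v"
proof -
  interpret M: module R M by (rule M)
  interpret M'': module R M'' by (rule M'')
  interpret N: module R N by (rule N)
  note T = tensor_module[OF M N] and id = linear_maps_id(1)
  let ?t = "pure_tensor R M N"
  let ?I = "tensor_map R M N i id ` carrier (tensor R M' N)"
  have I: "submodule ?I R (tensor R M N)"
    by (rule image_submodule[OF tensor_module[OF M' N] T tensor_map_linear[OF M' N M N i id]])
  obtain Q :: "('r, ('m \<times> 'n) list set) module" and q
    where Q: "module R Q" and q: "q \<in> linear_maps R (tensor R M N) Q"
    and kerq: "\<And>m. m \<in> carrier (tensor R M N) \<Longrightarrow> q m = \<zero>\<^bsub>Q\<^esub> \<longleftrightarrow> m \<in> ?I"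
    by (rule quotient_module[OF T I]) (rule that; assumption)
  interpret Q: module R Q by (rule Q)
  note qt = additive_map_comp[OF balanced_mapD(5)[OF balanced_pure_tensor] linear_mapsD(4)[OF q]]
  define f where "f m'' n = q (?t (inv_into (carrier M) p m'') n)" for m'' n
  have f: "f (p m) n = q (?t m n)" if m: "m \<in> carrier M" and n: "n \<in> carrier N" for m n
  proof -
    define l where "l = inv_into (carrier M) p (p m)"
    have l: "l \<in> carrier M" "p l = p m"
      unfolding l_def using m by (simp_all add: inv_into_into f_inv_into_f)
    have "p (l \<ominus>\<^bsub>M\<^esub> m) = \<zero>\<^bsub>M''\<^esub>"
      using linear_map_diff[OF M M'' p l(1) m] l(2) linear_mapsD(1)[OF p m] by
        (simp add: a_minus_def M''.r_neg)
    moreover have "l \<ominus>\<^bsub>M\<^esub> m \<in> carrier M" using l(1) m by (simp add: a_minus_def)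
    ultimately obtain k where k: "k \<in> carrier M'" "l \<ominus>\<^bsub>M\<^esub> m = i k" using ker by blast
    have "?t (i k) n \<in> ?I"
      using tensor_map_pure[OF M' N M N i id k(1) n] pure_tensor_closed[OF k(1) n] by
        (metis id_apply imageI)
    then have "q (?t (l \<ominus>\<^bsub>M\<^esub> m) n) = \<zero>\<^bsub>Q\<^esub>"
      unfolding k(2) using kerq pure_tensor_closed[OF linear_mapsD(1)[OF i k(1)] n] by blast
    then have "q (?t l n) \<oplus>\<^bsub>Q\<^esub> \<ominus>\<^bsub>Q\<^esub> q (?t m n) = \<zero>\<^bsub>Q\<^esub>"
      using additive_map_diff[OF module_abelian[OF M] module_abelian[OF Q] qt[OF n] l(1) m]
      unfolding a_minus_def by (simp only:)
    then show ?thesis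
      unfolding f_def l_def[symmetric]
      using Q.minus_equality[of "q (?t l n)" "\<ominus>\<^bsub>Q\<^esub> q (?t m n)"] additive_mapD(1)[OF qt[OF n]] l(1) m
        by simp
  qed
  have "balanced_map R M'' N Q f"
  proof (rule balanced_mapI; unfold surj[symmetric]; elim imageE; hypsubst)
    fix m n assume mn: "m \<in> carrier M" "n \<in> carrier N"
    show "f (p m) n \<in> carrier Q" using additive_mapD(1)[OF qt[OF mn(2)] mn(1)] by (simp add: f mn)
    show "f (p m \<oplus>\<^bsub>M''\<^esub> p m') n = f (p m) n \<oplus>\<^bsub>Q\<^esub> f (p m') n" if "m' \<in> carrier M" for m'
      using additive_mapD(2)[OF qt[OF mn(2)] mn(1) that] mn that
      by (simp add: linear_mapsD(2)[OF p, symmetric] f)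
    show "f (p m) (n \<oplus>\<^bsub>N\<^esub> n') = f (p m) n \<oplus>\<^bsub>Q\<^esub> f (p m) n'" if "n' \<in> carrier N" for n'
      using mn that by (simp add: f pure_tensor_add_right linear_mapsD(2)[OF q] pure_tensor_closed)
    show "f (r \<odot>\<^bsub>M''\<^esub> p m) n = f (p m) (r \<odot>\<^bsub>N\<^esub> n)" if "r \<in> carrier R" for r
      using mn that by (simp add: linear_mapsD(3)[OF p, symmetric] f pure_tensor_balanced)
  qed
  note g = tensor_lift_additive[OF M'' N module_abelian[OF Q] this]
    and g_pure = tensor_lift_pure[OF M'' N module_abelian[OF Q] this]
  note pl = tensor_map_linear[OF M N M'' N p id]
  \<comment> \<open>The projection \<open>q\<close> factors through the tensor product with
    \<open>M''\<close>; hence what dies there dies in \<open>Q\<close> and lies in the image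
    \<open>?I\<close>.\<close>
  have "tensor_lift Q f (tensor_map R M'' N p id u) = q u"
  proof (rule tensor_ext[OF M N module_abelian[OF Q] additive_map_comp[OF linear_mapsD(4)[OF pl] g]
    linear_mapsD(4)[OF q] _ u(1)])
    fix m n assume mn: "m \<in> carrier M" "n \<in> carrier N"
    show "tensor_lift Q f (tensor_map R M'' N p id (?t m n)) = q (?t m n)"
      unfolding tensor_map_pure[OF M N M'' N p id mn] id_apply
        g_pure[OF linear_mapsD(1)[OF p mn(1)] mn(2)]
      by (rule f[OF mn])
  qed
  then have "q u = \<zero>\<^bsub>Q\<^esub>"
    unfolding u(2) using additive_map_zero[OF tensor_abelian[OF M'' N] module_abelian[OF Q] g] by
      simp
  then have "u \<in> ?I" using kerq[OF u(1)] by simp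
  with that show thesis by blast
qed

text \<open>It moves finitely generated modules to the type of the test modules in
  \<open>flat\<close>. As no product is involved, \<open>mult\<close> and \<open>one\<close> are
  left undefined.\<close>

lemma transport_module:
  fixes R :: "('r, 'x) ring_scheme" and M :: "('r, 'm, 'y) module_scheme" and e :: "'m \<Rightarrow> 't"
  assumes M: "module R M" and e: "inj_on e (carrier M)"
  obtains T :: "('r, 't) module" where "module R T" "e \<in> linear_maps R M T" "carrier T = e `
    carrier M"
    "inv_into (carrier M) e \<in> linear_maps R T M"
proof -
  interpret M: module R M by (rule M)
  let ?i = "inv_into (carrier M) e"
  define T :: "('r, 't) module" where "T = \<lparr>carrier = e ` carrier M, monoid.mult = undefined, one =
    undefined,
    ring.zero = e \<zero>\<^bsub>M\<^esub>, ring.add = (\<lambda>x y. e (?i x \<oplus>\<^bsub>M\<^esub> ?i y)), smult = (\<lambda>r x. e (r \<odot>\<^bsub>M\<^esub> ?i x))\<rparr>"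
  have i: "?i (e x) = x" if "x \<in> carrier M" for x using that e by simp
  have mod: "module R T" "e \<in> linear_maps R M T"
    by (rule module_image[OF M, of T e]; simp add: T_def i)+
  moreover have "?i \<in> linear_maps R T M"
    by (rule linear_mapsI) (auto simp: T_def i)
  moreover have "carrier T = e ` carrier M" by (simp add: T_def)
  ultimately show thesis using that by blast
qed

text \<open>The recursion adds one generator at a time. This is the filtration with cyclic quotients
  behind \<open>exact_list_span\<close>, and it lets elements be encoded by coefficient lists in
  \<open>list_span_inj\<close>.\<close>

primrec list_span where
  "list_span R M [] = {\<zero>\<^bsub>M\<^esub>}"
| "list_span R M (g # gs) = {r \<odot>\<^bsub>M\<^esub> g \<oplus>\<^bsub>M\<^esub> h | r h. r \<in> carrier R \<and> h \<in> list_span R M gs}"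

lemma submodule_adjoin:
  assumes M: "module R M" and H: "submodule H R M" and g: "g \<in> carrier M"
  shows "submodule {r \<odot>\<^bsub>M\<^esub> g \<oplus>\<^bsub>M\<^esub> h | r h. r \<in> carrier R \<and> h \<in> H} R M" (is "submodule ?H R M")
proof (rule submoduleI'[OF M])
  interpret M: module R M by (rule M)
  have Hc: "h \<in> carrier M" if "h \<in> H" for h using submodule_subset[OF H] that by blast
  show "?H \<subseteq> carrier M" using g Hc by auto
  show "\<zero>\<^bsub>M\<^esub> \<in> ?H"
    using g submodule_zero[OF H] by (auto intro!: exI[of _ "\<zero>\<^bsub>R\<^esub>"] exI[of _ "\<zero>\<^bsub>M\<^esub>"])
  show "x \<oplus>\<^bsub>M\<^esub> y \<in> ?H" if "x \<in> ?H" "y \<in> ?H" for x y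
  proof -
    from that obtain r h s k where *: "x = r \<odot>\<^bsub>M\<^esub> g \<oplus>\<^bsub>M\<^esub> h" "y = s \<odot>\<^bsub>M\<^esub> g \<oplus>\<^bsub>M\<^esub> k"
      "r \<in> carrier R" "s \<in> carrier R" "h \<in> H" "k \<in> H" by auto
    then have "x \<oplus>\<^bsub>M\<^esub> y = (r \<oplus>\<^bsub>R\<^esub> s) \<odot>\<^bsub>M\<^esub> g \<oplus>\<^bsub>M\<^esub> (h \<oplus>\<^bsub>M\<^esub> k)"
      using g Hc by (simp add: M.smult_l_distr M.a_ac)
    then show ?thesis using * submodule_add[OF H] by fastforce
  qed
  show "r \<odot>\<^bsub>M\<^esub> x \<in> ?H" if r: "r \<in> carrier R" and "x \<in> ?H" for r x
  proof -
    from that obtain s h where *: "x = s \<odot>\<^bsub>M\<^esub> g \<oplus>\<^bsub>M\<^esub> h" "s \<in> carrier R" "h \<in> H" by auto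
    then have "r \<odot>\<^bsub>M\<^esub> x = (r \<otimes>\<^bsub>R\<^esub> s) \<odot>\<^bsub>M\<^esub> g \<oplus>\<^bsub>M\<^esub> r \<odot>\<^bsub>M\<^esub> h"
      using g r Hc by (simp add: M.smult_r_distr M.smult_assoc1)
    then show ?thesis using * r submodule_smult[OF H] by fastforce
  qed
qed

lemma submodule_trivial:
  assumes "module R M"
  shows "submodule {\<zero>\<^bsub>M\<^esub>} R M"
proof -
  interpret M: module R M by fact
  show ?thesis by (rule submoduleI'[OF assms]) auto
qed

lemma adjoin_incl:
  assumes "module R M" "submodule H R M" "g \<in> carrier M"
  shows "H \<subseteq> {r \<odot>\<^bsub>M\<^esub> g \<oplus>\<^bsub>M\<^esub> h | r h. r \<in> carrier R \<and> h \<in> H}" (is "_ \<subseteq> ?H")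
    and "g \<in> {r \<odot>\<^bsub>M\<^esub> g \<oplus>\<^bsub>M\<^esub> h | r h. r \<in> carrier R \<and> h \<in> H}"
proof -
  interpret M: module R M by fact
  show "H \<subseteq> ?H"
  proof
    fix h assume "h \<in> H"
    then show "h \<in> ?H" using assms(3) submodule_subset[OF assms(2)]
      by (auto intro!: exI[of _ "\<zero>\<^bsub>R\<^esub>"] exI[of _ h])
  qed
  show "g \<in> ?H" using assms(3) submodule_zero[OF assms(2)]
    by (auto intro!: exI[of _ "\<one>\<^bsub>R\<^esub>"] exI[of _ "\<zero>\<^bsub>M\<^esub>"])
qed

lemma list_span_submodule:
  assumes "module R M" "set gs \<subseteq> carrier M"
  shows "submodule (list_span R M gs) R M"
  using assms(2) by (induction gs) (simp_all add: submodule_trivial submodule_adjoin assms(1))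

lemma list_span_incl:
  assumes "module R M" "set gs \<subseteq> carrier M"
  shows "set gs \<subseteq> list_span R M gs"
  using assms(2)
proof (induction gs)
  case (Cons g gs)
  then show ?case
    using adjoin_incl[OF assms(1) list_span_submodule[OF assms(1), of gs], of g] by auto
qed simp

lemma list_span_image:
  assumes M: "module R M" and N: "module R N" and f: "f \<in> linear_maps R M N"
    and "set gs \<subseteq> carrier M" "f ` set gs \<subseteq> H" and H: "submodule H R N"
  shows "f ` list_span R M gs \<subseteq> H"
  using assms(4,5)
proof (induction gs)
  case Nil
  then show ?case using linear_map_zero[OF M N f] submodule_zero[OF H] by simp
next
  interpret M: module R M by (rule M)
  case (Cons g gs)
  then have "h \<in> carrier M" if "h \<in> list_span R M gs" for h
    using that submodule_subset[OF list_span_submodule[OF M, of gs]] by auto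
  with Cons show ?case
    by (auto simp: linear_mapsD(2,3)[OF f] intro!: submodule_add[OF H] submodule_smult[OF H])
qed

text \<open>An element is encoded by a nonempty set of coefficient lists that produce it. Distinct
  elements get disjoint sets: a common list fixes the first coefficient, and its tail fixes the
  remaining summand by induction. Sets avoid a choice among the many coefficient lists of one
  element.\<close>

lemma list_span_inj:
  fixes R :: "('r, 'x) ring_scheme"
  obtains e :: "'m \<Rightarrow> 'r list set" where "inj_on e (list_span R M gs)"
proof -
  have "\<exists>e :: 'm \<Rightarrow> 'r list set. \<forall>x\<in>list_span R M gs. e x \<noteq> {} \<and>
    (\<forall>y\<in>list_span R M gs. e x \<inter> e y \<noteq> {} \<longrightarrow> x = y)"
  proof (induction gs)
    case Nil
    show ?case by (intro exI[of _ "\<lambda>_. {[]}"]) simp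
  next
    case (Cons g gs)
    then obtain e :: "'m \<Rightarrow> 'r list set" where e: "\<And>x. x \<in> list_span R M gs \<Longrightarrow> e x \<noteq> {}"
      "\<And>x y. x \<in> list_span R M gs \<Longrightarrow> y \<in> list_span R M gs \<Longrightarrow> e x \<inter> e y \<noteq> {} \<Longrightarrow> x = y" by metis
    define e' where "e' x = {r # cs | r h cs. r \<in> carrier R \<and> h \<in> list_span R M gs
        \<and> x = r \<odot>\<^bsub>M\<^esub> g \<oplus>\<^bsub>M\<^esub> h \<and> cs \<in> e h}" for x
    have "e' x \<noteq> {}" if "x \<in> list_span R M (g # gs)" for x
      using that e(1) unfolding e'_def by fastforce
    moreover have "x = y" if "e' x \<inter> e' y \<noteq> {}" for x y
    proof -
      from that obtain r cs h k where "x = r \<odot>\<^bsub>M\<^esub> g \<oplus>\<^bsub>M\<^esub> h" "y = r \<odot>\<^bsub>M\<^esub> g \<oplus>\<^bsub>M\<^esub> k"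
        "h \<in> list_span R M gs" "k \<in> list_span R M gs" "cs \<in> e h" "cs \<in> e k"
        unfolding e'_def by auto
      then show ?thesis using e(2)[of h k] by auto
    qed
    ultimately show ?case by (intro exI[of _ e']) blast
  qed
  then obtain e :: "'m \<Rightarrow> 'r list set" where e: "\<forall>x\<in>list_span R M gs. e x \<noteq> {} \<and>
    (\<forall>y\<in>list_span R M gs. e x \<inter> e y \<noteq> {} \<longrightarrow> x = y)" by blast
  then have "inj_on e (list_span R M gs)" by (intro inj_onI) (metis Int_absorb)
  with that show thesis .
qed

section \<open>Finitely generated support of tensors, and flatness on arbitrary types\<close>

lemma tensor_map_inclusion:
  assumes "module R M" "module R N" "submodule H R M" "set xs \<subseteq> H \<times> carrier N"
  shows "tensor_map R M N id id (tensor_class R (M\<lparr>carrier := H\<rparr>) N xs) = tensor_class R M N xs"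
  using tensor_map_class[OF restrict_module[OF assms(1,3)] assms(2,1,2)
      restrict_inclusion'[OF submodule_subset[OF assms(3)]] linear_maps_id(1), of xs] assms(4)
  by (simp add: map_prod.id)

text \<open>A representing list has finitely many first components, and over any submodule
  containing them the same list represents a preimage.\<close>

lemma tensor_finite_rep:
  assumes M: "module R M" and N: "module R N" and u: "u \<in> carrier (tensor R M N)"
  obtains gs where "set gs \<subseteq> carrier M" "\<And>H. submodule H R M \<Longrightarrow> set gs \<subseteq> H \<Longrightarrow>
    \<exists>v\<in>carrier (tensor R (M\<lparr>carrier := H\<rparr>) N). u = tensor_map R M N id id v"
proof -
  obtain xs where xs: "set xs \<subseteq> carrier M \<times> carrier N" "u = tensor_class R M N xs"
    using u by (rule tensor_carrierE)
  show thesis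
  proof (rule that[of "map fst xs"])
    show "set (map fst xs) \<subseteq> carrier M" using xs by auto
    fix H assume H: "submodule H R M" "set (map fst xs) \<subseteq> H"
    then have s: "set xs \<subseteq> H \<times> carrier N" using xs(1) by auto
    have "tensor_class R (M\<lparr>carrier := H\<rparr>) N xs \<in> carrier (tensor R (M\<lparr>carrier := H\<rparr>) N)"
      by (rule tensor_class_closed) (use s in simp)
    then show "\<exists>v\<in>carrier (tensor R (M\<lparr>carrier := H\<rparr>) N). u = tensor_map R M N id id v"
      using tensor_map_inclusion[OF M N H(1) s] xs(2) by (intro bexI) auto
  qed
qed

text \<open>The vanishing over \<open>M\<close> is witnessed by one derivation, so it already
  happens over a submodule containing the finitely many elements used. \<open>H0\<close> must stay
  inside that submodule so that \<open>u\<close> can be mapped there.\<close>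

lemma tensor_finite_zero:
  assumes M: "module R M" and N: "module R N" and H0: "submodule H0 R M"
    and u: "u \<in> carrier (tensor R (M\<lparr>carrier := H0\<rparr>) N)" "tensor_map R M N id id u = \<zero>\<^bsub>tensor R M N\<^esub>"
  obtains gs where "set gs \<subseteq> carrier M" "\<And>H. submodule H R M \<Longrightarrow> set gs \<subseteq> H \<Longrightarrow> H0 \<subseteq> H \<Longrightarrow>
    tensor_map R (M\<lparr>carrier := H\<rparr>) N id id u = \<zero>\<^bsub>tensor R (M\<lparr>carrier := H\<rparr>) N\<^esub>"
proof -
  obtain xs where xs: "set xs \<subseteq> H0 \<times> carrier N" "u = tensor_class R (M\<lparr>carrier := H0\<rparr>) N xs"
    using u(1) by (elim tensor_carrierE) auto
  have "tensor_class R M N xs = tensor_class R M N []"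
    using u(2) tensor_map_inclusion[OF M N H0 xs(1)] xs(2) by (simp add: tensor_zero_class)
  then have "tensor_eq R M N xs []" by (subst (asm) tensor_class_eq_iff) auto
  then obtain F where F: "finite F" "F \<subseteq> carrier M" and
    eq: "\<And>H. submodule H R M \<Longrightarrow> F \<subseteq> H \<Longrightarrow> tensor_eq R (M\<lparr>carrier := H\<rparr>) N xs []"
    using tensor_eq_finite_support[OF M N] by meson
  obtain gs where gs: "set gs = F" using finite_list[OF F(1)] by blast
  show thesis
  proof (rule that[of gs])
    show "set gs \<subseteq> carrier M" using F gs by simp
    fix H assume H: "submodule H R M" "set gs \<subseteq> H" "H0 \<subseteq> H"
    have "tensor_map R (M\<lparr>carrier := H\<rparr>) N id id u = tensor_class R (M\<lparr>carrier := H\<rparr>) N xs"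
      using tensor_map_class[OF restrict_module[OF M H0] N restrict_module[OF M H(1)] N
          restrict_inclusion[OF H(3)] linear_maps_id(1), of xs] xs
      by (simp add: map_prod.id)
    also have "\<dots> = tensor_class R (M\<lparr>carrier := H\<rparr>) N []"
      by (rule tensor_class_eqI[OF eq]) (use H gs in auto)
    finally show "tensor_map R (M\<lparr>carrier := H\<rparr>) N id id u = \<zero>\<^bsub>tensor R (M\<lparr>carrier := H\<rparr>) N\<^esub>"
      by (simp add: tensor_zero_class)
  qed
qed

text \<open>Flatness against modules on arbitrary types: a tensor in the kernel already vanishes over
  finitely generated submodules, which embed into the type of the test modules.\<close>

lemma flat_injective:
  fixes R :: "('r, 'x) ring_scheme" and N :: "('r, 'n, 'y) module_scheme"
    and N' :: "('r, 'n1, 'y1) module_scheme"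
  assumes P: "flat R P" and N: "module R N" and N': "module R N'"
    and f: "f \<in> linear_maps R N N'" "inj_on f (carrier N)"
    and u: "u \<in> carrier (tensor R N P)" "tensor_map R N' P f id u = \<zero>\<^bsub>tensor R N' P\<^esub>"
  shows "u = \<zero>\<^bsub>tensor R N P\<^esub>"
proof -
  have Pm: "module R P" using P by (simp add: flat_def)
  interpret N: module R N by (rule N)
  interpret N': module R N' by (rule N')
  obtain xs where xs: "set xs \<subseteq> carrier N \<times> carrier P" "u = tensor_class R N P xs"
    using u(1) by (rule tensor_carrierE)
  let ?ys = "map (map_prod f id) xs"
  have "tensor_class R N' P ?ys = tensor_class R N' P []"
    using u(2) tensor_map_class[OF N Pm N' Pm f(1) linear_maps_id(1) xs(1)] xs(2)
    by (simp only: tensor_zero_class)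
  then have "tensor_eq R N' P ?ys []" by (subst (asm) tensor_class_eq_iff) auto
  then obtain F where F: "finite F" "F \<subseteq> carrier N'" and
    eq: "\<And>H. submodule H R N' \<Longrightarrow> F \<subseteq> H \<Longrightarrow> tensor_eq R (N'\<lparr>carrier := H\<rparr>) P ?ys []"
    using tensor_eq_finite_support[OF N' Pm] by meson
  obtain fs where fs: "set fs = F" using finite_list[OF F(1)] by blast
  let ?gs = "map fst xs"
  \<comment> \<open>Two demands on the target: \<open>fs\<close> makes the image tensor vanish
    already there, and the images of \<open>?gs\<close> make \<open>f\<close> restrict to a map from
    \<open>H\<close> to \<open>H'\<close>.\<close>
  let ?hs = "fs @ map f ?gs"
  have gs: "set ?gs \<subseteq> carrier N" and hs: "set ?hs \<subseteq> carrier N'"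
    using xs F fs linear_mapsD(1)[OF f(1)] by auto
  define H where "H = list_span R N ?gs"
  define H' where "H' = list_span R N' ?hs"
  have sH: "submodule H R N" and sH': "submodule H' R N'"
    unfolding H_def H'_def by (rule list_span_submodule[OF N gs] list_span_submodule[OF N' hs])+
  let ?M = "N\<lparr>carrier := H\<rparr>" and ?M' = "N'\<lparr>carrier := H'\<rparr>"
  have M: "module R ?M" and M': "module R ?M'"
    by (rule restrict_module[OF N sH] restrict_module[OF N' sH'])+
  have inc: "set ?gs \<subseteq> H" "set ?hs \<subseteq> H'"
    unfolding H_def H'_def by (rule list_span_incl[OF N gs] list_span_incl[OF N' hs])+
  have "f ` H \<subseteq> H'" unfolding H_def
    by (rule list_span_image[OF N N' f(1) gs _ sH']) (use inc in auto)
  then have fM: "f \<in> linear_maps R ?M ?M'"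
    by (intro linear_mapsI) (use submodule_subset[OF sH] in \<open>auto simp: linear_mapsD[OF f(1)]
      subset_iff\<close>)
  obtain e :: "'n \<Rightarrow> 'r list set" where e: "inj_on e H" unfolding H_def by (rule list_span_inj)
  obtain e' :: "'n1 \<Rightarrow> 'r list set" where e': "inj_on e' H'" unfolding H'_def by (rule list_span_inj)
  let ?i = "inv_into H e"
  obtain T :: "('r, 'r list set) module" where T: "module R T" "e \<in> linear_maps R ?M T"
    "carrier T = e ` H" "?i \<in> linear_maps R T ?M"
    using transport_module[OF M, of e] e by auto
  obtain T' :: "('r, 'r list set) module" where T': "module R T'" "e' \<in> linear_maps R ?M' T'"
    by (rule transport_module[OF M', of e']) (use e' in auto)
  \<comment> \<open>The restriction of \<open>f\<close> to \<open>H\<close>, seen through the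
    encodings as an injection between test modules; the flatness assumption applies to it.\<close>
  define k where "k = (\<lambda>x. e' (f (?i x)))"
  have k: "k \<in> linear_maps R T T'"
    unfolding k_def by (rule linear_maps_comp[OF linear_maps_comp[OF T(4) fM] T'(2)])
  have "inj_on k (carrier T)"
  proof (rule inj_onI)
    fix x y assume xy: "x \<in> carrier T" "y \<in> carrier T" "k x = k y"
    then obtain a b where ab: "a \<in> H" "b \<in> H" "x = e a" "y = e b" using T(3) by auto
    have "e' (f a) = e' (f b)" using xy(3) ab e by (simp add: k_def)
    then have "f a = f b" using e' ab \<open>f ` H \<subseteq> H'\<close> by (auto dest: inj_onD)
    then show "x = y" using f(2) ab submodule_subset[OF sH] by (auto dest: inj_onD)
  qed
  then have inj: "inj_on (tensor_map R T' P k id) (carrier (tensor R T P))"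
    using P T(1) T'(1) k unfolding flat_def by blast
  let ?u = "tensor_class R ?M P xs"
  have xsH: "set xs \<subseteq> H \<times> carrier P" using xs inc(1) by auto
  have uc: "?u \<in> carrier (tensor R ?M P)" by (rule tensor_class_closed) (use xsH in simp)
  let ?v = "tensor_map R T P e id ?u"
  note id = linear_maps_id(1)
  have vc: "?v \<in> carrier (tensor R T P)"
    by (rule linear_mapsD(1)[OF tensor_map_linear[OF M Pm T(1) Pm T(2) id] uc])
  have "tensor_map R T' P k id ?v = tensor_map R T' P (\<lambda>x. k (e x)) (\<lambda>x. id (id x)) ?u"
    by (rule tensor_map_comp[OF M Pm T(1) Pm T'(1) Pm T(2) id k id uc])
  also have "\<dots> = tensor_map R T' P (\<lambda>x. e' (f x)) (\<lambda>x. id (id x)) ?u"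
    by (rule tensor_map_cong[OF M Pm T'(1) Pm linear_maps_comp[OF T(2) k]
      linear_maps_comp[OF id id] _ _ uc])
      (use e in \<open>simp_all add: k_def\<close>)
  also have "\<dots> = tensor_map R T' P e' id (tensor_map R ?M' P f id ?u)"
    by (rule tensor_map_comp[OF M Pm M' Pm T'(1) Pm fM id T'(2) id uc, symmetric])
  also have "tensor_map R ?M' P f id ?u = tensor_class R ?M' P ?ys"
    by (rule tensor_map_class[OF M Pm M' Pm fM id]) (use xsH in simp)
  also have "\<dots> = \<zero>\<^bsub>tensor R ?M' P\<^esub>"
    unfolding tensor_zero_class by (rule tensor_class_eqI[OF eq[OF sH']]) (use inc fs in auto)
  also have "tensor_map R T' P e' id \<zero>\<^bsub>tensor R ?M' P\<^esub> = \<zero>\<^bsub>tensor R T' P\<^esub>"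
    by (rule linear_map_zero[OF tensor_module[OF M' Pm] tensor_module[OF T'(1) Pm]
          tensor_map_linear[OF M' Pm T'(1) Pm T'(2) id]])
  also have "\<dots> = tensor_map R T' P k id \<zero>\<^bsub>tensor R T P\<^esub>"
    by (rule linear_map_zero[OF tensor_module[OF T(1) Pm] tensor_module[OF T'(1) Pm]
          tensor_map_linear[OF T(1) Pm T'(1) Pm k id], symmetric])
  finally have v0: "?v = \<zero>\<^bsub>tensor R T P\<^esub>"
    by (rule inj_onD[OF inj _ vc]) (rule abelian_monoid.zero_closed[OF
      abelian_group.axioms(1)[OF tensor_abelian[OF T(1) Pm]]])
  \<comment> \<open>Decoding recovers \<open>?u\<close> from its encoded image \<open>?v\<close>,
    which has just been shown to vanish.\<close>
  have "tensor_map R ?M P ?i id ?v = tensor_map R ?M P (\<lambda>x. ?i (e x)) (\<lambda>x. id (id x)) ?u"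
    by (rule tensor_map_comp[OF M Pm T(1) Pm M Pm T(2) id T(4) id uc])
  also have "\<dots> = ?u" by (rule tensor_map_id[OF M Pm _ _ uc]) (use e in simp_all)
  finally have "?u = \<zero>\<^bsub>tensor R ?M P\<^esub>"
    unfolding v0 using linear_map_zero[OF tensor_module[OF T(1) Pm] tensor_module[OF M Pm]
          tensor_map_linear[OF T(1) Pm M Pm T(4) id]] by (simp only:)
  then have "tensor_map R N P id id ?u = \<zero>\<^bsub>tensor R N P\<^esub>"
    using linear_map_zero[OF tensor_module[OF M Pm] tensor_module[OF N Pm]
          tensor_map_linear[OF M Pm N Pm restrict_inclusion'[OF submodule_subset[OF sH]] id]] by
            (simp only:)
  then show ?thesis using tensor_map_inclusion[OF N Pm sH xsH] xs(2) by simp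
qed

section \<open>Exactness after tensoring\<close>

lemma tensor_map_zero:
  assumes "module R M" "module R N" "module R M'" "module R N'"
    and "f \<in> linear_maps R M M'" "g \<in> linear_maps R N N'"
    and "(\<forall>x\<in>carrier M. f x = \<zero>\<^bsub>M'\<^esub>) \<or> (\<forall>x\<in>carrier N. g x = \<zero>\<^bsub>N'\<^esub>)"
    and "u \<in> carrier (tensor R M N)"
  shows "tensor_map R M' N' f g u = \<zero>\<^bsub>tensor R M' N'\<^esub>"
proof (rule tensor_ext[OF assms(1,2) tensor_abelian[OF assms(3,4)] _ _ _ assms(8)])
  interpret T: module R "tensor R M' N'" by (rule tensor_module[OF assms(3,4)])
  show "additive_map (tensor R M N) (tensor R M' N') (tensor_map R M' N' f g)"
    by (rule linear_mapsD(4)[OF tensor_map_linear[OF assms(1-6)]])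
  show "additive_map (tensor R M N) (tensor R M' N') (\<lambda>_. \<zero>\<^bsub>tensor R M' N'\<^esub>)"
    by (simp add: additive_map_def)
  fix m n assume mn: "m \<in> carrier M" "n \<in> carrier N"
  then have "pure_tensor R M' N' (f m) (g n) = \<zero>\<^bsub>tensor R M' N'\<^esub>"
    using assms(7) linear_mapsD(1)[OF assms(5)] linear_mapsD(1)[OF assms(6)]
    by (auto simp: pure_tensor_def tensor_zero_class
        intro!: tensor_class_eqI tensor_eq.zero_left tensor_eq.zero_right)
  then show "tensor_map R M' N' f g (pure_tensor R M N m n) = \<zero>\<^bsub>tensor R M' N'\<^esub>"
    using mn by (simp add: tensor_map_pure[OF assms(1-6)])
qed

text \<open>Exactness of \<open>0 \<rightarrow> M \<otimes> A \<rightarrow> M \<otimes> B \<rightarrow> M \<otimes> D\<close>.\<close>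

definition tensor_exact ::
    "('r, 'x) ring_scheme \<Rightarrow> ('r, 'a, 'ya) module_scheme \<Rightarrow> ('r, 'b, 'yb) module_scheme
      \<Rightarrow> ('r, 'd, 'yd) module_scheme \<Rightarrow> ('a \<Rightarrow> 'b) \<Rightarrow> ('b \<Rightarrow> 'd) \<Rightarrow> ('r, 'm, 'y) module_scheme \<Rightarrow> bool"
        where
  "tensor_exact R A B D \<phi> d M \<longleftrightarrow>
     (\<forall>x\<in>carrier (tensor R M A). tensor_map R M B id \<phi> x = \<zero>\<^bsub>tensor R M B\<^esub> \<longrightarrow> x = \<zero>\<^bsub>tensor R M A\<^esub>) \<and>
     (\<forall>x\<in>carrier (tensor R M B). tensor_map R M D id d x = \<zero>\<^bsub>tensor R M D\<^esub> \<longrightarrow>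
        x \<in> tensor_map R M B id \<phi> ` carrier (tensor R M A))"

text \<open>Up to isomorphism these are the modules \<open>R/J\<close>, with \<open>J\<close> the
  annihilator of \<open>g\<close>. No model of \<open>R/J\<close> is fixed, so such modules may live
  on any type.\<close>

definition cyclic where
  "cyclic R M g \<longleftrightarrow> module R M \<and> g \<in> carrier M \<and> carrier M = {r \<odot>\<^bsub>M\<^esub> g | r. r \<in> carrier R}"

text \<open>It is used with \<open>D\<close> the tensor product of \<open>B\<close> and
  \<open>C\<close> and \<open>d\<close> the difference of the coaction and
  \<open>b \<mapsto> b \<otimes> 1\<close>. Since \<open>A\<close> is not assumed flat, an inclusion
  \<open>M' \<subseteq> M\<close> need not stay injective after tensoring with \<open>A\<close>;
  injectivity is always drawn from \<open>B\<close> and \<open>D\<close>.\<close>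

locale flat_complex =
  fixes R :: "('r, 'x) ring_scheme" and A :: "('r, 'a, 'ya) module_scheme"
    and B :: "('r, 'b, 'yb) module_scheme" and D :: "('r, 'd, 'yd) module_scheme"
    and \<phi> :: "'a \<Rightarrow> 'b" and d :: "'b \<Rightarrow> 'd"
  assumes A: "module R A" and flat_B: "flat R B" and flat_D: "flat R D"
    and \<phi>: "\<phi> \<in> linear_maps R A B" and d: "d \<in> linear_maps R B D"
    and complex: "a \<in> carrier A \<Longrightarrow> d (\<phi> a) = \<zero>\<^bsub>D\<^esub>"
begin

lemma B: "module R B" and D: "module R D"
  using flat_B flat_D by (simp_all add: flat_def)

abbreviation "\<Phi> M \<equiv> tensor_map R M B id \<phi>"
abbreviation "\<Delta> M \<equiv> tensor_map R M D id d"
abbreviation "exact M \<equiv> tensor_exact R A B D \<phi> d M"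

lemma \<Phi>_linear: "module R M \<Longrightarrow> \<Phi> M \<in> linear_maps R (tensor R M A) (tensor R M B)"
  by (rule tensor_map_linear[OF _ A _ B linear_maps_id(1) \<phi>])

lemma \<Delta>_linear: "module R M \<Longrightarrow> \<Delta> M \<in> linear_maps R (tensor R M B) (tensor R M D)"
  by (rule tensor_map_linear[OF _ B _ D linear_maps_id(1) d])

lemma \<Delta>_\<Phi>:
  assumes "module R M" "x \<in> carrier (tensor R M A)"
  shows "\<Delta> M (\<Phi> M x) = \<zero>\<^bsub>tensor R M D\<^esub>"
  unfolding tensor_map_comp[OF assms(1) A assms(1) B assms(1) D linear_maps_id(1) \<phi>
    linear_maps_id(1) d assms(2)]
  by (rule tensor_map_zero[OF assms(1) A assms(1) D linear_maps_comp[OF linear_maps_id(1)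
    linear_maps_id(1)]
        linear_maps_comp[OF \<phi> d] _ assms(2)]) (simp add: complex)

lemma \<Phi>_natural:
  assumes "module R M" "module R M'" "f \<in> linear_maps R M M'" "x \<in> carrier (tensor R M A)"
  shows "\<Phi> M' (tensor_map R M' A f id x) = tensor_map R M' B f id (\<Phi> M x)"
  by (rule tensor_map_commute[OF assms(1,2) A B assms(3) \<phi> assms(4)])

lemma \<Delta>_natural:
  assumes "module R M" "module R M'" "f \<in> linear_maps R M M'" "x \<in> carrier (tensor R M B)"
  shows "\<Delta> M' (tensor_map R M' B f id x) = tensor_map R M' D f id (\<Delta> M x)"
  by (rule tensor_map_commute[OF assms(1,2) B D assms(3) d assms(4)])

lemma exactD:
  assumes "exact M"
  shows "x \<in> carrier (tensor R M A) \<Longrightarrow> \<Phi> M x = \<zero>\<^bsub>tensor R M B\<^esub> \<Longrightarrow> x = \<zero>\<^bsub>tensor R M A\<^esub>"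
    and "z \<in> carrier (tensor R M B) \<Longrightarrow> \<Delta> M z = \<zero>\<^bsub>tensor R M D\<^esub>
      \<Longrightarrow> z \<in> \<Phi> M ` carrier (tensor R M A)"
  using assms unfolding tensor_exact_def by blast+

lemma exactI:
  assumes "\<And>x. x \<in> carrier (tensor R M A) \<Longrightarrow> \<Phi> M x = \<zero>\<^bsub>tensor R M B\<^esub> \<Longrightarrow> x = \<zero>\<^bsub>tensor R M A\<^esub>"
    and "\<And>z. z \<in> carrier (tensor R M B) \<Longrightarrow> \<Delta> M z = \<zero>\<^bsub>tensor R M D\<^esub>
      \<Longrightarrow> \<exists>y\<in>carrier (tensor R M A). z = \<Phi> M y"
  shows "exact M"
  using assms unfolding tensor_exact_def by blast

text \<open>A diagram chase in which the columns of \<open>A\<close> and \<open>B\<close> are right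
  exact, and those of \<open>B\<close> and \<open>D\<close> are also injective at \<open>M'\<close>
  by flatness. Injectivity of \<open>\<Phi> M\<close> uses the column of \<open>B\<close>, exactness
  in the middle that of \<open>D\<close>.\<close>

lemma exact_extension:
  assumes M': "module R M'" and M: "module R M" and M'': "module R M''"
    and i: "i \<in> linear_maps R M' M" "inj_on i (carrier M')"
    and p: "p \<in> linear_maps R M M''" "p ` carrier M = carrier M''"
    and ker: "\<And>m. m \<in> carrier M \<Longrightarrow> p m = \<zero>\<^bsub>M''\<^esub> \<longleftrightarrow> m \<in> i ` carrier M'"
    and exact: "exact M'" "exact M''"
  shows "exact M"
proof (rule exactI)
  note id = linear_maps_id(1)
  have right_exact: "\<exists>v\<in>carrier (tensor R M' N). u = tensor_map R M N i id v"
    if "module R N" "u \<in> carrier (tensor R M N)" "tensor_map R M'' N p id u = \<zero>\<^bsub>tensor R M'' N\<^esub>"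
    for N :: "('r, 'n, 'y) module_scheme" and u
    by (rule tensor_right_exact[OF M' M M'' that(1) i(1) p(1) p(2) _ that(2,3)]) (use ker in blast)+
  note iA = tensor_map_linear[OF M' A M A i(1) id] and iB = tensor_map_linear[OF M' B M B i(1) id]
  note pB = tensor_map_linear[OF M B M'' B p(1) id] and pA = tensor_map_linear[OF M A M'' A p(1) id]
  interpret MA: module R "tensor R M A" by (rule tensor_module[OF M A])
  interpret MB: module R "tensor R M B" by (rule tensor_module[OF M B])
  interpret MD: module R "tensor R M D" by (rule tensor_module[OF M D])
  interpret M''B: module R "tensor R M'' B" by (rule tensor_module[OF M'' B])
  have iz: "tensor_map R M N i id \<zero>\<^bsub>tensor R M' N\<^esub> = \<zero>\<^bsub>tensor R M N\<^esub>"
    if "module R N" for N :: "('r, 'n, 'y) module_scheme"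
    by (rule linear_map_zero[OF tensor_module[OF M' that] tensor_module[OF M that]
          tensor_map_linear[OF M' that M that i(1) id]])
  have pz: "tensor_map R M'' N p id \<zero>\<^bsub>tensor R M N\<^esub> = \<zero>\<^bsub>tensor R M'' N\<^esub>"
    if "module R N" for N :: "('r, 'n, 'y) module_scheme"
    by (rule linear_map_zero[OF tensor_module[OF M that] tensor_module[OF M'' that]
          tensor_map_linear[OF M that M'' that p(1) id]])
  {
    fix x assume x: "x \<in> carrier (tensor R M A)" "\<Phi> M x = \<zero>\<^bsub>tensor R M B\<^esub>"
    have "\<Phi> M'' (tensor_map R M'' A p id x) = \<zero>\<^bsub>tensor R M'' B\<^esub>"
      unfolding \<Phi>_natural[OF M M'' p(1) x(1)] x(2) by (rule pz[OF B])
    then have "tensor_map R M'' A p id x = \<zero>\<^bsub>tensor R M'' A\<^esub>"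
      by (rule exactD(1)[OF exact(2) linear_mapsD(1)[OF pA x(1)]])
    then obtain y where y: "y \<in> carrier (tensor R M' A)" "x = tensor_map R M A i id y"
      using right_exact[OF A x(1)] by blast
    \<comment> \<open>The preimage \<open>y\<close> over \<open>M'\<close> may not be unique, but
      \<open>\<Phi> M' y\<close> vanishes because \<open>B\<close> is flat, and exactness for
      \<open>M'\<close> then gives \<open>y = 0\<close>.\<close>
    have "tensor_map R M B i id (\<Phi> M' y) = \<zero>\<^bsub>tensor R M B\<^esub>"
      using \<Phi>_natural[OF M' M i(1) y(1)] x(2) unfolding y(2) by (simp only:)
    then have "\<Phi> M' y = \<zero>\<^bsub>tensor R M' B\<^esub>"
      by (rule flat_injective[OF flat_B M' M i linear_mapsD(1)[OF \<Phi>_linear[OF M'] y(1)]])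
    then have "y = \<zero>\<^bsub>tensor R M' A\<^esub>" by (rule exactD(1)[OF exact(1) y(1)])
    then show "x = \<zero>\<^bsub>tensor R M A\<^esub>" unfolding y(2) by (simp only: iz[OF A])
  next
    fix x assume x: "x \<in> carrier (tensor R M B)" "\<Delta> M x = \<zero>\<^bsub>tensor R M D\<^esub>"
    have "\<Delta> M'' (tensor_map R M'' B p id x) = \<zero>\<^bsub>tensor R M'' D\<^esub>"
      unfolding \<Delta>_natural[OF M M'' p(1) x(1)] x(2) by (rule pz[OF D])
    then obtain z'' where z'': "z'' \<in> carrier (tensor R M'' A)" "tensor_map R M'' B p id x = \<Phi> M''
      z''"
      using exactD(2)[OF exact(2) linear_mapsD(1)[OF pB x(1)]] by blast
    obtain z where z: "z \<in> carrier (tensor R M A)" "z'' = tensor_map R M'' A p id z"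
      by (rule tensor_map_surj[OF M A M'' p z''(1)])
    have \<Phi>z: "\<Phi> M z \<in> carrier (tensor R M B)" by (rule linear_mapsD(1)[OF \<Phi>_linear[OF M] z(1)])
    \<comment> \<open>Subtracting a lift of the solution over \<open>M''\<close> leaves an element
      that vanishes over \<open>M''\<close>, hence comes from \<open>M'\<close>. It is still a
      cycle, since composing \<Phi> with \<Delta> gives zero.\<close>
    let ?w = "x \<ominus>\<^bsub>tensor R M B\<^esub> \<Phi> M z"
    have w: "?w \<in> carrier (tensor R M B)" using x(1) \<Phi>z by (simp add: a_minus_def)
    have "tensor_map R M'' B p id ?w = \<zero>\<^bsub>tensor R M'' B\<^esub>"
      unfolding linear_map_diff[OF tensor_module[OF M B] tensor_module[OF M'' B] pB x(1) \<Phi>z]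
        z''(2) z(2) \<Phi>_natural[OF M M'' p(1) z(1)]
      using linear_mapsD(1)[OF pB \<Phi>z] by (simp add: a_minus_def M''B.r_neg)
    then obtain y where y: "y \<in> carrier (tensor R M' B)" "?w = tensor_map R M B i id y"
      using right_exact[OF B w] by blast
    have "tensor_map R M D i id (\<Delta> M' y) = \<Delta> M ?w"
      unfolding y(2) by (rule \<Delta>_natural[OF M' M i(1) y(1), symmetric])
    also have "\<dots> = \<zero>\<^bsub>tensor R M D\<^esub>"
      unfolding linear_map_diff[OF tensor_module[OF M B] tensor_module[OF M D] \<Delta>_linear[OF M] x(1)
        \<Phi>z]
        x(2) \<Delta>_\<Phi>[OF M z(1)] by (simp add: a_minus_def MD.r_neg)
    finally have "\<Delta> M' y = \<zero>\<^bsub>tensor R M' D\<^esub>"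
      by (rule flat_injective[OF flat_D M' M i linear_mapsD(1)[OF \<Delta>_linear[OF M'] y(1)]])
    then obtain v where v: "v \<in> carrier (tensor R M' A)" "y = \<Phi> M' v"
      using exactD(2)[OF exact(1) y(1)] by blast
    have iv: "tensor_map R M A i id v \<in> carrier (tensor R M A)" by
      (rule linear_mapsD(1)[OF iA v(1)])
    have "x = ?w \<oplus>\<^bsub>tensor R M B\<^esub> \<Phi> M z"
      using x(1) \<Phi>z by (simp add: a_minus_def MB.a_assoc MB.l_neg)
    also have "\<dots> = \<Phi> M (tensor_map R M A i id v \<oplus>\<^bsub>tensor R M A\<^esub> z)"
      unfolding y(2) v(2) linear_mapsD(2)[OF \<Phi>_linear[OF M] iv z(1)] \<Phi>_natural[OF M' M i(1) v(1)] ..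
    finally show "\<exists>y\<in>carrier (tensor R M A). x = \<Phi> M y"
      by (rule bexI) (rule MA.a_closed[OF iv z(1)])
  }
qed

text \<open>An element lives over some finitely generated submodule. Flatness of \<open>B\<close>,
  respectively \<open>D\<close>, ensures that its image already vanishes over that submodule, so
  exactness there applies.\<close>

lemma exact_finite_submodules:
  assumes M: "module R M"
    and exact: "\<And>gs. set gs \<subseteq> carrier M \<Longrightarrow> exact (M\<lparr>carrier := list_span R M gs\<rparr>)"
  shows "exact M"
proof (rule exactI)
  note id = linear_maps_id(1)
  {
    fix x assume x: "x \<in> carrier (tensor R M A)" "\<Phi> M x = \<zero>\<^bsub>tensor R M B\<^esub>"
    obtain gs where gs: "set gs \<subseteq> carrier M" and rep: "\<And>H. submodule H R M \<Longrightarrow> set gs \<subseteq> H \<Longrightarrow>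
      \<exists>v\<in>carrier (tensor R (M\<lparr>carrier := H\<rparr>) A). x = tensor_map R M A id id v"
      using tensor_finite_rep[OF M A x(1)] by metis
    let ?H = "list_span R M gs" let ?M = "M\<lparr>carrier := ?H\<rparr>"
    have sub: "submodule ?H R M" by (rule list_span_submodule[OF M gs])
    note mod = restrict_module[OF M sub] and inc = restrict_inclusion'[OF submodule_subset[OF sub],
      of R]
    obtain v where v: "v \<in> carrier (tensor R ?M A)" "x = tensor_map R M A id id v"
      using rep[OF sub list_span_incl[OF M gs]] by blast
    have "tensor_map R M B id id (\<Phi> ?M v) = \<zero>\<^bsub>tensor R M B\<^esub>"
      using \<Phi>_natural[OF mod M inc v(1)] x(2) unfolding v(2) by (simp only:)
    then have "\<Phi> ?M v = \<zero>\<^bsub>tensor R ?M B\<^esub>"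
      by (rule flat_injective[OF flat_B mod M inc inj_on_id
        linear_mapsD(1)[OF \<Phi>_linear[OF mod] v(1)]])
    then have "v = \<zero>\<^bsub>tensor R ?M A\<^esub>" by (rule exactD(1)[OF exact[OF gs] v(1)])
    then show "x = \<zero>\<^bsub>tensor R M A\<^esub>" unfolding v(2)
      by (simp only: linear_map_zero[OF tensor_module[OF mod A] tensor_module[OF M A]
            tensor_map_linear[OF mod A M A inc id]])
  next
    fix x assume x: "x \<in> carrier (tensor R M B)" "\<Delta> M x = \<zero>\<^bsub>tensor R M D\<^esub>"
    obtain gs where gs: "set gs \<subseteq> carrier M" and rep: "\<And>H. submodule H R M \<Longrightarrow> set gs \<subseteq> H \<Longrightarrow>
      \<exists>v\<in>carrier (tensor R (M\<lparr>carrier := H\<rparr>) B). x = tensor_map R M B id id v"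
      using tensor_finite_rep[OF M B x(1)] by metis
    let ?H = "list_span R M gs" let ?M = "M\<lparr>carrier := ?H\<rparr>"
    have sub: "submodule ?H R M" by (rule list_span_submodule[OF M gs])
    note mod = restrict_module[OF M sub] and inc = restrict_inclusion'[OF submodule_subset[OF sub],
      of R]
    obtain v where v: "v \<in> carrier (tensor R ?M B)" "x = tensor_map R M B id id v"
      using rep[OF sub list_span_incl[OF M gs]] by blast
    have "tensor_map R M D id id (\<Delta> ?M v) = \<zero>\<^bsub>tensor R M D\<^esub>"
      using \<Delta>_natural[OF mod M inc v(1)] x(2) unfolding v(2) by (simp only:)
    then have "\<Delta> ?M v = \<zero>\<^bsub>tensor R ?M D\<^esub>"
      by (rule flat_injective[OF flat_D mod M inc inj_on_id
        linear_mapsD(1)[OF \<Delta>_linear[OF mod] v(1)]])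
    then obtain y where y: "y \<in> carrier (tensor R ?M A)" "v = \<Phi> ?M y"
      using exactD(2)[OF exact[OF gs] v(1)] by blast
    show "\<exists>y\<in>carrier (tensor R M A). x = \<Phi> M y"
      by (rule bexI[OF _ linear_mapsD(1)[OF tensor_map_linear[OF mod A M A inc id] y(1)]])
        (simp only: v(2) y(2) \<Phi>_natural[OF mod M inc y(1)])
  }
qed

lemma exact_trivial:
  assumes M: "module R M" and "carrier M \<subseteq> {\<zero>\<^bsub>M\<^esub>}"
  shows "exact M"
proof -
  interpret M: module R M by (rule M)
  have triv: "x = \<zero>\<^bsub>tensor R M N\<^esub>" if N: "module R N" and x: "x \<in> carrier (tensor R M N)"
    for N :: "('r, 'n, 'y) module_scheme" and x
  proof -
    \<comment> \<open>On a trivial module the identity is also the zero map.\<close>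
    have "x = tensor_map R M N id id x" by (rule tensor_map_id[OF M N _ _ x, symmetric]) simp_all
    also have "\<dots> = \<zero>\<^bsub>tensor R M N\<^esub>"
      by (rule tensor_map_zero[OF M N M N linear_maps_id(1) linear_maps_id(1) _ x])
        (use assms(2) in auto)
    finally show ?thesis .
  qed
  interpret MA: module R "tensor R M A" by (rule tensor_module[OF M A])
  show ?thesis
  proof (rule exactI)
    fix x assume "x \<in> carrier (tensor R M B)"
    then have "x = \<Phi> M \<zero>\<^bsub>tensor R M A\<^esub>"
      using triv[OF B] linear_mapsD(1)[OF \<Phi>_linear[OF M] MA.zero_closed] by metis
    then show "\<exists>y\<in>carrier (tensor R M A). x = \<Phi> M y" by (rule bexI) simp
  qed (rule triv[OF A])
qed

text \<open>Induction on the number of generators: adding \<open>g\<close> yields an extension of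
  the smaller span by a cyclic module generated by the class of \<open>g\<close>. The quotient lies
  on the type \<open>'m\<close>, so the assumption on cyclic modules covers it.\<close>

lemma exact_list_span:
  fixes M :: "('r, 'm) module"
  assumes M: "module R M" and exact: "\<And>(Q :: ('r, 'm) module) g. cyclic R Q g \<Longrightarrow> exact Q"
    and "set gs \<subseteq> carrier M"
  shows "exact (M\<lparr>carrier := list_span R M gs\<rparr>)"
  using assms(3)
proof (induction gs)
  case Nil
  show ?case
    by (rule exact_trivial[OF restrict_module[OF M list_span_submodule[OF M]]]) simp_all
next
  interpret M: module R M by (rule M)
  case (Cons g gs)
  let ?H = "list_span R M gs" and ?H1 = "list_span R M (g # gs)"
  let ?M = "M\<lparr>carrier := ?H\<rparr>" and ?M1 = "M\<lparr>carrier := ?H1\<rparr>"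
  have sub1: "submodule ?H1 R M" by (rule list_span_submodule[OF M Cons.prems])
  have sub: "submodule ?H R M" and g: "g \<in> carrier M"
    using Cons.prems list_span_submodule[OF M, of gs] by simp_all
  note mod = restrict_module[OF M sub] and mod1 = restrict_module[OF M sub1]
  interpret M1: module R ?M1 by (rule mod1)
  have Hc: "h \<in> carrier M" if "h \<in> ?H" for h using submodule_subset[OF sub] that by blast
  have HH: "?H \<subseteq> ?H1" using adjoin_incl(1)[OF M sub g] by simp
  have gH: "g \<in> ?H1" using list_span_incl[OF M Cons.prems] by simp
  have sub': "submodule ?H R ?M1"
    by (rule submoduleI'[OF mod1])
      (use HH submodule_zero[OF sub] submodule_add[OF sub] submodule_smult[OF sub] in auto)
  obtain Q :: "('r, 'm) module" and p where Q: "module R Q" and p: "p \<in> linear_maps R ?M1 Q"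
    and surj: "p ` carrier ?M1 = carrier Q"
    and ker: "\<And>m. m \<in> carrier ?M1 \<Longrightarrow> p m = \<zero>\<^bsub>Q\<^esub> \<longleftrightarrow> m \<in> ?H"
    using quotient_module[OF mod1 sub'] by metis
  interpret Q: module R Q by (rule Q)
  \<comment> \<open>The summand in \<open>?H\<close> dies in \<open>Q\<close>, which leaves a
    multiple of the class of \<open>g\<close>.\<close>
  have span_g: "p x \<in> {r \<odot>\<^bsub>Q\<^esub> p g | r. r \<in> carrier R}" if "x \<in> ?H1" for x
  proof -
    from that obtain r h where x: "r \<in> carrier R" "h \<in> ?H" "x = r \<odot>\<^bsub>M\<^esub> g \<oplus>\<^bsub>M\<^esub> h" by auto
    have rg: "r \<odot>\<^bsub>M\<^esub> g \<in> ?H1" by (rule submodule_smult[OF sub1 x(1) gH])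
    have "p x = p (r \<odot>\<^bsub>M\<^esub> g) \<oplus>\<^bsub>Q\<^esub> p h"
      using linear_mapsD(2)[OF p, of "r \<odot>\<^bsub>M\<^esub> g" h] rg x(2) HH by
        (simp add: x(3) subset_iff del: list_span.simps)
    also have "\<dots> = r \<odot>\<^bsub>Q\<^esub> p g"
      using linear_mapsD(3)[OF p, of r g] linear_mapsD(1)[OF p, of g] ker[of h] x HH gH
      by (simp add: subset_iff del: list_span.simps)
    finally show ?thesis using x(1) by blast
  qed
  have "p g \<in> carrier Q" using linear_mapsD(1)[OF p] gH by simp
  note pg = this
  have "carrier Q = {r \<odot>\<^bsub>Q\<^esub> p g | r. r \<in> carrier R}"
  proof
    show "carrier Q \<subseteq> {r \<odot>\<^bsub>Q\<^esub> p g | r. r \<in> carrier R}"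
      using span_g unfolding surj[symmetric] by (simp add: image_subset_iff del: list_span.simps)
    show "{r \<odot>\<^bsub>Q\<^esub> p g | r. r \<in> carrier R} \<subseteq> carrier Q" using pg by auto
  qed
  with pg have "cyclic R Q (p g)" unfolding cyclic_def using Q by blast
  then have exQ: "exact Q" by (rule exact)
  have "inj_on id (carrier ?M)" by simp
  from exact_extension[OF mod mod1 Q restrict_inclusion[OF HH] this p surj _ Cons.IH exQ] ker
    Cons.prems
  show ?case by (simp del: list_span.simps)
qed

lemma exact_of_cyclic:
  fixes M :: "('r, 'm) module"
  assumes "module R M" "\<And>(Q :: ('r, 'm) module) g. cyclic R Q g \<Longrightarrow> exact Q"
  shows "exact M"
  by (rule exact_finite_submodules[OF assms(1) exact_list_span[OF assms]])

end

section \<open>Algebraically closed fields over a residue ring\<close>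

lemma poly_carrier_iff:
  "p \<in> carrier (K[X]\<^bsub>R\<^esub>) \<longleftrightarrow> p = [] \<or> set p \<subseteq> K \<and> lead_coeff p \<noteq> \<zero>\<^bsub>R\<^esub>"
  unfolding univ_poly_carrier[symmetric] polynomial_def ..

text \<open>Every element is encoded by a polynomial it is a root of, whose coefficients are quotients
  of elements of \<open>R\<close>, and by its number in an enumeration of the roots of that polynomial.\<close>

lemma algebraic_embedding:
  fixes R :: "('r, 'x) ring_scheme" and L :: "('l, 'y) ring_scheme"
  assumes L: "field L" and R: "\<one>\<^bsub>R\<^esub> \<noteq> \<zero>\<^bsub>R\<^esub>" and g: "g \<in> carrier R \<rightarrow> carrier L"
    and alg: "\<And>x. x \<in> carrier L \<Longrightarrow> \<exists>p. p \<in> carrier (poly_ring L) \<and> p \<noteq> [] \<and> ring.eval L p x = \<zero>\<^bsub>L\<^esub> \<and>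
      (\<forall>c\<in>set p. \<exists>a\<in>carrier R. \<exists>b\<in>carrier R. g b \<noteq> \<zero>\<^bsub>L\<^esub> \<and> c \<otimes>\<^bsub>L\<^esub> g b = g a)"
  obtains e :: "'l \<Rightarrow> 'r list" where "inj_on e (carrier L)"
proof -
  interpret L: field L by (rule L)
  \<comment> \<open>\<open>as\<close> and \<open>bs\<close> hold the numerators and denominators of
    the coefficients of \<open>p\<close>, position by position.\<close>
  define frac where "frac p as bs \<longleftrightarrow> length as = length p \<and> length bs = length p \<and>
    (\<forall>i<length p. p ! i \<in> carrier L \<and> as ! i \<in> carrier R \<and> bs ! i \<in> carrier R \<and>
       g (bs ! i) \<noteq> \<zero>\<^bsub>L\<^esub> \<and> p ! i \<otimes>\<^bsub>L\<^esub> g (bs ! i) = g (as ! i))" for p as bs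
  have "\<exists>p as bs. p \<in> carrier (poly_ring L) \<and> L.is_root p x \<and> frac p as bs" if x: "x \<in> carrier L"
    for x
  proof -
    from alg[OF x] obtain p where p: "p \<in> carrier (poly_ring L)" "p \<noteq> []" "L.eval p x = \<zero>\<^bsub>L\<^esub>"
      and c: "\<forall>c\<in>set p. \<exists>a\<in>carrier R. \<exists>b\<in>carrier R. g b \<noteq> \<zero>\<^bsub>L\<^esub> \<and> c \<otimes>\<^bsub>L\<^esub> g b = g a" by blast
    let ?Q = "\<lambda>c a b. a \<in> carrier R \<and> b \<in> carrier R \<and> g b \<noteq> \<zero>\<^bsub>L\<^esub> \<and> c \<otimes>\<^bsub>L\<^esub> g b = g a"
    have "\<forall>c\<in>set p. \<exists>ab. ?Q c (fst ab) (snd ab)"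
    proof
      fix z assume "z \<in> set p"
      with c obtain a b where "?Q z a b" by blast
      then show "\<exists>ab. ?Q z (fst ab) (snd ab)" by (intro exI[of _ "(a, b)"]) simp
    qed
    from bchoice[OF this] obtain f where f: "\<forall>c\<in>set p. ?Q c (fst (f c)) (snd (f c))" by blast
    have "set p \<subseteq> carrier L"
      using p(1) unfolding poly_carrier_iff by auto
    then have "frac p (map (\<lambda>c. fst (f c)) p) (map (\<lambda>c. snd (f c)) p)"
      using f unfolding frac_def by (simp add: subset_iff)
    moreover have "L.is_root p x" using p x by (simp add: L.is_root_def)
    ultimately show ?thesis using p(1) by blast
  qed
  then obtain P as bs where P: "\<And>x. x \<in> carrier L \<Longrightarrow> P x \<in> carrier (poly_ring L)"
    and root: "\<And>x. x \<in> carrier L \<Longrightarrow> L.is_root (P x) x"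
    and frac: "\<And>x. x \<in> carrier L \<Longrightarrow> frac (P x) (as x) (bs x)"
    by metis
  \<comment> \<open>The denominators are nonzero in the field, so cancelling them recovers each
    coefficient; the length of the polynomial is that of the lists.\<close>
  have uniq: "P x = P y" if x: "x \<in> carrier L" and y: "y \<in> carrier L"
    and eq: "as x = as y" "bs x = bs y" for x y
  proof (rule nth_equalityI)
    show l: "length (P x) = length (P y)" using frac[OF x] frac[OF y] eq by (simp add: frac_def)
    fix i assume i: "i < length (P x)"
    then have "P x ! i \<otimes>\<^bsub>L\<^esub> g (bs x ! i) = P y ! i \<otimes>\<^bsub>L\<^esub> g (bs x ! i)" "g (bs x ! i) \<noteq> \<zero>\<^bsub>L\<^esub>"
      "P x ! i \<in> carrier L" "P y ! i \<in> carrier L" "g (bs x ! i) \<in> carrier L"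
      using frac[OF x] frac[OF y] eq l g by (auto simp: frac_def)
    then show "P x ! i = P y ! i" using L.m_rcancel by blast
  qed
  have "\<exists>n :: 'l \<Rightarrow> nat. inj_on n {x. L.is_root p x}" if "p \<in> carrier (poly_ring L)" for p
    using finite_imp_inj_to_nat_seg[OF L.finite_number_of_roots[OF that]] by blast
  then obtain ix :: "'l list \<Rightarrow> 'l \<Rightarrow> nat" where
    ix: "\<And>p. p \<in> carrier (poly_ring L) \<Longrightarrow> inj_on (ix p) {x. L.is_root p x}" by metis
  \<comment> \<open>The number of the root is written in unary as a run of zeros, which the entry
    \<open>1\<close> ends; as \<open>1\<close> differs from \<open>0\<close> in \<open>R\<close>,
    the run and the remaining list can be read off.\<close>
  define e where "e x = replicate (ix (P x) x) \<zero>\<^bsub>R\<^esub> @ \<one>\<^bsub>R\<^esub> # (as x @ bs x)" for x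
  have rep: "n = m \<and> zs = ws"
    if "replicate n \<zero>\<^bsub>R\<^esub> @ \<one>\<^bsub>R\<^esub> # zs = replicate m \<zero>\<^bsub>R\<^esub> @ \<one>\<^bsub>R\<^esub> # ws" for n m zs ws
    using that
  proof (induction n arbitrary: m)
    case 0
    then show ?case using R by (cases m) auto
  next
    case (Suc n)
    then show ?case using R by (cases m) auto
  qed
  have "inj_on e (carrier L)"
  proof (rule inj_onI)
    fix x y assume x: "x \<in> carrier L" and y: "y \<in> carrier L" and "e x = e y"
    then have i: "ix (P x) x = ix (P y) y" and "as x @ bs x = as y @ bs y"
      using rep unfolding e_def by blast+
    \<comment> \<open>Both halves have the length of the polynomial, so the concatenated list splits
      in the middle.\<close>
    moreover have "length (as x) = length (bs x)" "length (as y) = length (bs y)"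
      using frac[OF x] frac[OF y] by (simp_all add: frac_def)
    ultimately have "as x = as y" "bs x = bs y"
      by (metis append_eq_append_conv length_append mult_2 nat_mult_eq_cancel_disj
        zero_neq_numeral)+
    then have Pxy: "P x = P y" by (rule uniq[OF x y])
    show "x = y" using inj_onD[OF ix[OF P[OF x]], of x y] i root[OF x] root[OF y] by (simp add: Pxy)
  qed
  with that show thesis .
qed

text \<open>Polynomials over the field split, so the number of roots with multiplicity is the
  degree.\<close>

lemma (in algebraically_closed) exists_root:
  assumes "p \<in> carrier (poly_ring L)" "degree p > 0"
  obtains x where "x \<in> carrier L" "eval p x = \<zero>"
proof -
  have "size (roots p) > 0" using roots_over_carrier[OF assms(1)] assms(2) by
    (simp add: splitted_def)
  then obtain x where "x \<in># roots p" by (metis multiset_nonemptyE nonempty_has_size)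
  then have "x \<in> carrier L \<and> eval p x = \<zero>"
    by (simp add: roots_mem_iff_is_root[OF assms(1)] is_root_def)
  with that show thesis by blast
qed

text \<open>A polynomial over the copy is decoded coefficient by coefficient, and a root of the
  decoded polynomial is encoded again. The scalars act through \<open>h\<close>, so the annihilator
  of \<open>1\<close> is the kernel of \<open>h\<close>.\<close>

lemma transport_algebraically_closed:
  fixes R :: "('r, 'x) ring_scheme" and L :: "('l, 'y) ring_scheme" and e :: "'l \<Rightarrow> 't"
  assumes R: "cring R" and L: "algebraically_closed L" and h: "h \<in> ring_hom R L"
    and e: "inj_on e (carrier L)"
  obtains K :: "('r, 't) module" where "algebra R K" "algebraically_closed K"
    "\<And>r. r \<in> carrier R \<Longrightarrow> r \<odot>\<^bsub>K\<^esub> \<one>\<^bsub>K\<^esub> = \<zero>\<^bsub>K\<^esub> \<longleftrightarrow> h r = \<zero>\<^bsub>L\<^esub>"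
proof -
  interpret R: cring R by (rule R)
  interpret L: algebraically_closed L by (rule L)
  let ?i = "inv_into (carrier L) e"
  have i: "?i (e x) = x" if "x \<in> carrier L" for x using e that by simp
  note hc = ring_hom_memE[OF h]
  define K :: "('r, 't) module" where "K = \<lparr>carrier = e ` carrier L,
    monoid.mult = (\<lambda>x y. e (?i x \<otimes>\<^bsub>L\<^esub> ?i y)), one = e \<one>\<^bsub>L\<^esub>,
    ring.zero = e \<zero>\<^bsub>L\<^esub>, ring.add = (\<lambda>x y. e (?i x \<oplus>\<^bsub>L\<^esub> ?i y)), smult = (\<lambda>r x. e (h r \<otimes>\<^bsub>L\<^esub> ?i x))\<rparr>"
  have algK: "algebra R K" if "cring K"
    by (rule algebraI[OF R that])
      (auto simp: K_def i hc L.l_distr L.r_distr L.m_assoc)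
  have K0: "r \<odot>\<^bsub>K\<^esub> \<one>\<^bsub>K\<^esub> = \<zero>\<^bsub>K\<^esub> \<longleftrightarrow> h r = \<zero>\<^bsub>L\<^esub>" if "r \<in> carrier R" for r
    using hc(1)[OF that] inj_on_eq_iff[OF e] by (simp add: K_def i)
  have "e \<in> ring_hom L K" by (rule ring_hom_memI) (simp_all add: K_def i)
  then have iso: "e \<in> ring_iso L K"
    using e by (auto simp: ring_iso_def bij_betw_def K_def)
  \<comment> \<open>\<open>ring_iso_imp_img_field\<close> speaks of the target with its zero
    replaced by the image of zero; here the two agree already.\<close>
  have "K\<lparr>zero := e \<zero>\<^bsub>L\<^esub>\<rparr> = K" by (simp add: K_def)
  moreover have cK: "carrier K = e ` carrier L" by (simp add: K_def)
  ultimately have fK: "field K" using L.ring_iso_imp_img_field[OF iso] by simp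
  interpret K: field K by (rule fK)
  interpret e: ring_hom_ring L K e
    by (rule ring_hom_ringI2[OF L.ring_axioms K.ring_axioms \<open>e \<in> ring_hom L K\<close>])
  have "algebraically_closed K"
  proof (rule K.algebraically_closedI)
    fix p assume p: "p \<in> carrier (poly_ring K)" "degree p > 1"
    then have pn: "p \<noteq> []" and pc: "set p \<subseteq> carrier K" and lead: "lead_coeff p \<noteq> \<zero>\<^bsub>K\<^esub>"
      unfolding poly_carrier_iff by auto
    have pc': "set p \<subseteq> e ` carrier L" using pc unfolding cK .
    let ?q = "map ?i p"
    have ei: "e (?i x) = x" if "x \<in> set p" for x
      by (rule f_inv_into_f) (use pc' that in blast)
    have ic: "?i x \<in> carrier L" if "x \<in> set p" for x
      by (rule inv_into_into) (use pc' that in blast)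
    have map: "map e ?q = p" using ei by (simp add: map_idI)
    have "lead_coeff ?q \<noteq> \<zero>\<^bsub>L\<^esub>"
    proof
      assume "lead_coeff ?q = \<zero>\<^bsub>L\<^esub>"
      then have "e (?i (lead_coeff p)) = e \<zero>\<^bsub>L\<^esub>" using pn by (simp add: hd_map)
      then show False using ei[of "lead_coeff p"] lead pn by simp
    qed
    moreover have qc: "set ?q \<subseteq> carrier L" using ic by (simp add: image_subset_iff)
    ultimately have "?q \<in> carrier (poly_ring L)"
      unfolding poly_carrier_iff by blast
    moreover have "degree ?q > 0" using p(2) by simp
    ultimately obtain x where x: "x \<in> carrier L" "L.eval ?q x = \<zero>\<^bsub>L\<^esub>"
      by (rule L.exists_root)
    have "K.eval p (e x) = e (L.eval ?q x)"
      using e.eval_hom'[OF x(1) qc] by (simp only: map)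
    then show "\<exists>x\<in>carrier K. K.eval p x = \<zero>\<^bsub>K\<^esub>" using x by (intro bexI[of _ "e x"]) simp_all
  qed
  then show thesis using algK[OF K.is_cring] K0 by (intro that)
qed

text \<open>The closure of \<open>F\<close> provided by \<open>exists_closure\<close> lives on a
  large function type. All its elements are algebraic over \<open>F\<close>, whose elements are
  quotients of elements of \<open>R\<close>, so \<open>algebraic_embedding\<close> brings it to the
  type over which the theorem quantifies its fields.\<close>

lemma exists_algebraically_closed_algebra:
  fixes R :: "('r, 'x) ring_scheme" and F :: "('f, 'y) ring_scheme"
  assumes R: "cring R" and F: "field F" and h: "h \<in> ring_hom R F"
    and frac: "\<And>x. x \<in> carrier F \<Longrightarrow>
      \<exists>a\<in>carrier R. \<exists>b\<in>carrier R. h b \<noteq> \<zero>\<^bsub>F\<^esub> \<and> x \<otimes>\<^bsub>F\<^esub> h b = h a"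
  obtains K :: "('r, 'r list set) module" where "algebra R K" "algebraically_closed K"
    "\<And>r. r \<in> carrier R \<Longrightarrow> r \<odot>\<^bsub>K\<^esub> \<one>\<^bsub>K\<^esub> = \<zero>\<^bsub>K\<^esub> \<longleftrightarrow> h r = \<zero>\<^bsub>F\<^esub>"
proof -
  interpret R: cring R by (rule R)
  interpret F: field F by (rule F)
  obtain L :: "((('f list \<times> nat) multiset) \<Rightarrow> 'f) ring"
    where "algebraic_closure L (F.indexed_const ` carrier F)" and c: "F.indexed_const \<in> ring_hom F
      L"
    by (rule F.exists_closure)
  then interpret L: algebraic_closure L "F.indexed_const ` carrier F" by simp
  let ?c = "F.indexed_const :: 'f \<Rightarrow> ('f list \<times> nat) multiset \<Rightarrow> 'f"
  interpret c: ring_hom_ring F L ?c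
    by (rule ring_hom_ringI2[OF F.ring_axioms L.ring_axioms c])
  interpret h: ring_hom_ring R F h
    by (rule ring_hom_ringI2[OF R.ring_axioms F.ring_axioms h])
  define g where "g r = ?c (h r)" for r
  have g: "g \<in> ring_hom R L" unfolding g_def
    by (rule ring_hom_memI) simp_all
  have c0: "?c x = \<zero>\<^bsub>L\<^esub> \<longleftrightarrow> x = \<zero>\<^bsub>F\<^esub>" if "x \<in> carrier F" for x
  proof -
    have "inj_on ?c (carrier F)" by (rule F.indexed_const_inj_on)
    from inj_on_eq_iff[OF this that F.zero_closed] show ?thesis by simp
  qed
  have sub: "subring (?c ` carrier F) L" by (rule subfieldE(1)[OF L.subfield_axioms])
  have ne: "\<one>\<^bsub>R\<^esub> \<noteq> \<zero>\<^bsub>R\<^esub>"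
  proof
    assume "\<one>\<^bsub>R\<^esub> = \<zero>\<^bsub>R\<^esub>"
    then have "h \<one>\<^bsub>R\<^esub> = h \<zero>\<^bsub>R\<^esub>" by simp
    then show False by simp
  qed
  obtain e :: "_ \<Rightarrow> 'r list" where e: "inj_on e (carrier L)"
  proof (rule algebraic_embedding[OF L.field_axioms ne])
    show "g \<in> carrier R \<rightarrow> carrier L" using ring_hom_memE(1)[OF g] by simp
    fix x assume x: "x \<in> carrier L"
    then obtain p where p: "p \<in> carrier ((?c ` carrier F)[X]\<^bsub>L\<^esub>)" "p \<noteq> []" "L.eval p x = \<zero>\<^bsub>L\<^esub>"
      using L.algebraicE[OF sub x] L.algebraic_extension[OF x] by (auto simp: over_def)
    then have sp: "set p \<subseteq> ?c ` carrier F" and l: "lead_coeff p \<noteq> \<zero>\<^bsub>L\<^esub>"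
      unfolding poly_carrier_iff by blast+
    have "?c ` carrier F \<subseteq> carrier L" by auto
    with sp l have "p \<in> carrier (poly_ring L)" unfolding poly_carrier_iff by blast
    moreover have "\<exists>a\<in>carrier R. \<exists>b\<in>carrier R. g b \<noteq> \<zero>\<^bsub>L\<^esub> \<and> z \<otimes>\<^bsub>L\<^esub> g b = g a" if z: "z \<in> set p" for z
    proof -
      obtain y where y: "y \<in> carrier F" "z = ?c y" using sp z by blast
      obtain a b where ab: "a \<in> carrier R" "b \<in> carrier R" "h b \<noteq> \<zero>\<^bsub>F\<^esub>" "y \<otimes>\<^bsub>F\<^esub> h b = h a"
        using frac[OF y(1)] by blast
      have "z \<otimes>\<^bsub>L\<^esub> g b = g a"
        using ab(1,2,4) y c.hom_mult[of y "h b"] by (simp add: g_def)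
      then show ?thesis using ab c0[of "h b"] by (auto simp: g_def)
    qed
    ultimately show "\<exists>p. p \<in> carrier (poly_ring L) \<and> p \<noteq> [] \<and> L.eval p x = \<zero>\<^bsub>L\<^esub> \<and>
        (\<forall>c\<in>set p. \<exists>a\<in>carrier R. \<exists>b\<in>carrier R. g b \<noteq> \<zero>\<^bsub>L\<^esub> \<and> c \<otimes>\<^bsub>L\<^esub> g b = g a)"
      using p(2,3) by blast
  qed
  \<comment> \<open>The singleton only turns codes of type \<open>'r list\<close> into codes of type
    \<open>'r list set\<close>.\<close>
  have "inj_on (\<lambda>x. {e x}) (carrier L)" using e by (auto simp: inj_on_def)
  then show thesis
    by (rule transport_algebraically_closed[OF R L.algebraically_closed_axioms g])
      (rule that, auto simp: g_def c0)
qed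

text \<open>For the zero ideal the fraction field comes with the definition of a Dedekind domain. A
  nonzero prime is maximal, so \<open>R/J\<close> is itself the residue field and has the encoding
  of a quotient ring.\<close>

lemma dedekind_residue_algebraically_closed:
  fixes R :: "('r, 'x) ring_scheme"
  assumes R: "dedekind_domain R" and J: "primeideal J R"
  obtains K :: "('r, 'r list set) module" where "algebra R K" "algebraically_closed K"
    "\<And>r. r \<in> carrier R \<Longrightarrow> r \<odot>\<^bsub>K\<^esub> \<one>\<^bsub>K\<^esub> = \<zero>\<^bsub>K\<^esub> \<longleftrightarrow> r \<in> J"
proof -
  interpret J: primeideal J R by (rule J)
  have R': "cring R" by (rule J.is_cring)
  show thesis
  proof (cases "J = {\<zero>\<^bsub>R\<^esub>}")
    case True
    obtain F :: "('r \<times> 'r) set ring" and h where fr: "fraction_field R F h"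
      using R unfolding dedekind_domain_def by blast
    then have F: "field F" and h: "h \<in> ring_hom R F" and inj: "inj_on h (carrier R)" and
      q: "\<And>x. x\<in>carrier F \<Longrightarrow> \<exists>a\<in>carrier R. \<exists>b\<in>carrier R - {\<zero>\<^bsub>R\<^esub>}. x = h a \<otimes>\<^bsub>F\<^esub> inv\<^bsub>F\<^esub> h b"
      unfolding fraction_field_def by blast+
    interpret F: field F by (rule F)
    interpret h: ring_hom_ring R F h by (rule ring_hom_ringI2[OF J.ring_axioms F.ring_axioms h])
    have h0: "h r = \<zero>\<^bsub>F\<^esub> \<longleftrightarrow> r = \<zero>\<^bsub>R\<^esub>" if "r \<in> carrier R" for r
      using inj_on_eq_iff[OF inj that J.zero_closed] by simp
    show thesis
    proof (rule exists_algebraically_closed_algebra[OF R' F h])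
      fix x assume "x \<in> carrier F"
      then obtain a b where ab: "a \<in> carrier R" "b \<in> carrier R" "b \<noteq> \<zero>\<^bsub>R\<^esub>" "x = h a \<otimes>\<^bsub>F\<^esub> inv\<^bsub>F\<^esub> h b"
        using q by blast
      have "h b \<in> Units F" using ab h0 by (simp add: F.field_Units)
      then have "x \<otimes>\<^bsub>F\<^esub> h b = h a" using ab by (simp add: F.m_assoc)
      then show "\<exists>a\<in>carrier R. \<exists>b\<in>carrier R. h b \<noteq> \<zero>\<^bsub>F\<^esub> \<and> x \<otimes>\<^bsub>F\<^esub> h b = h a"
        using ab h0 by blast
    next
      fix K :: "('r, 'r list set) module" assume "algebra R K" "algebraically_closed K"
        "\<And>r. r \<in> carrier R \<Longrightarrow> (r \<odot>\<^bsub>K\<^esub> \<one>\<^bsub>K\<^esub> = \<zero>\<^bsub>K\<^esub>) = (h r = \<zero>\<^bsub>F\<^esub>)"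
      then show thesis using that[of K] h0 by (simp add: True)
    qed
  next
    case False
    then interpret maximalideal J R using R J unfolding dedekind_domain_def by blast
    let ?F = "R Quot J" and ?h = "(+>\<^bsub>R\<^esub>) J"
    have F: "field ?F" by (rule quotient_is_field[OF R'])
    have cF: "\<exists>a\<in>carrier R. x = ?h a" if "x \<in> carrier ?F" for x
      using that by (auto simp: FactRing_def A_RCOSETS_def')
    have r0: "r \<ominus>\<^bsub>R\<^esub> \<zero>\<^bsub>R\<^esub> = r" if "r \<in> carrier R" for r
      using that by (simp add: a_minus_def)
    interpret F: field ?F by (rule F)
    interpret h: ring_hom_ring R ?F ?h by (rule J.rcos_ring_hom_ring)
    have h0: "?h r = \<zero>\<^bsub>?F\<^esub> \<longleftrightarrow> r \<in> J" if "r \<in> carrier R" for r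
      using J.quotient_eq_iff_same_a_r_cos[OF J.ideal_axioms that J.zero_closed]
      unfolding r0[OF that] h.hom_zero by blast
    show thesis
    proof (rule exists_algebraically_closed_algebra[OF R' F J.rcos_ring_hom])
      fix x assume x: "x \<in> carrier ?F"
      then obtain a where a: "a \<in> carrier R" "x = ?h a" using cF by blast
      \<comment> \<open>Elements of the quotient ring are classes of elements of \<open>R\<close>,
        so the denominator \<open>1\<close> suffices.\<close>
      have "?h \<one>\<^bsub>R\<^esub> \<noteq> \<zero>\<^bsub>?F\<^esub> \<and> x \<otimes>\<^bsub>?F\<^esub> ?h \<one>\<^bsub>R\<^esub> = ?h a"
        unfolding h.hom_one a(2)[symmetric] using F.one_not_zero F.r_one[OF x] by blast
      then show "\<exists>a\<in>carrier R. \<exists>b\<in>carrier R. ?h b \<noteq> \<zero>\<^bsub>?F\<^esub> \<and> x \<otimes>\<^bsub>?F\<^esub> ?h b = ?h a"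
        using a(1) J.one_closed by blast
    next
      fix K :: "('r, 'r list set) module" assume "algebra R K" "algebraically_closed K"
        "\<And>r. r \<in> carrier R \<Longrightarrow> (r \<odot>\<^bsub>K\<^esub> \<one>\<^bsub>K\<^esub> = \<zero>\<^bsub>K\<^esub>) = (?h r = \<zero>\<^bsub>?F\<^esub>)"
      then show thesis using h0 by (intro that[of K]) blast+
    qed
  qed
qed

section \<open>Reduction to residue fields\<close>

lemma submodule_Union_chain:
  assumes M: "module R M" and "C \<noteq> {}" and C: "subset.chain {H. submodule H R M \<and> P H} C"
  shows "submodule (\<Union>C) R M"
proof -
  have sub: "submodule H R M" if "H \<in> C" for H using C that by (auto simp: subset_chain_def)
  have "\<exists>H\<in>C. x \<in> H \<and> y \<in> H" if "x \<in> \<Union>C" "y \<in> \<Union>C" for x y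
    using C that unfolding subset_chain_def by blast
  note pair = this
  show ?thesis
  proof (rule submoduleI'[OF M])
    show "\<Union>C \<subseteq> carrier M" using submodule_subset[OF sub] by blast
    show "\<zero>\<^bsub>M\<^esub> \<in> \<Union>C" using \<open>C \<noteq> {}\<close> submodule_zero[OF sub] by blast
    show "x \<oplus>\<^bsub>M\<^esub> y \<in> \<Union>C" if "x \<in> \<Union>C" "y \<in> \<Union>C" for x y
      using pair[OF that] submodule_add[OF sub] by blast
    show "r \<odot>\<^bsub>M\<^esub> x \<in> \<Union>C" if "r \<in> carrier R" "x \<in> \<Union>C" for r x
      using that submodule_smult[OF sub] by blast
  qed
qed

text \<open>\<open>W\<close> is maximal among the submodules meeting \<open>Y\<close> trivially.\<close>

lemma essential_complement:
  assumes M: "module R M" and Y: "submodule Y R M"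
  obtains W where "submodule W R M" "W \<inter> Y = {\<zero>\<^bsub>M\<^esub>}"
    "\<And>k. k \<in> carrier M \<Longrightarrow> k \<notin> W \<Longrightarrow>
      \<exists>r\<in>carrier R. \<exists>w\<in>W. r \<odot>\<^bsub>M\<^esub> k \<oplus>\<^bsub>M\<^esub> w \<in> Y \<and> r \<odot>\<^bsub>M\<^esub> k \<oplus>\<^bsub>M\<^esub> w \<noteq> \<zero>\<^bsub>M\<^esub>"
proof -
  interpret M: module R M by (rule M)
  let ?S = "{W. submodule W R M \<and> W \<inter> Y = {\<zero>\<^bsub>M\<^esub>}}"
  have "\<exists>W\<in>?S. \<forall>V\<in>?S. W \<subseteq> V \<longrightarrow> V = W"
  proof (rule subset_Zorn_nonempty)
    show "?S \<noteq> {}" using submodule_trivial[OF M] submodule_zero[OF Y] by blast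
    fix C assume C: "C \<noteq> {}" "subset.chain ?S C"
    then have "\<And>W. W \<in> C \<Longrightarrow> W \<inter> Y = {\<zero>\<^bsub>M\<^esub>}" by (auto simp: subset_chain_def)
    then have "\<Union>C \<inter> Y = {\<zero>\<^bsub>M\<^esub>}" using C(1) by blast
    with submodule_Union_chain[OF M C] show "\<Union>C \<in> ?S" by simp
  qed
  then obtain W where W: "submodule W R M" "W \<inter> Y = {\<zero>\<^bsub>M\<^esub>}"
    and max: "\<And>V. submodule V R M \<Longrightarrow> V \<inter> Y = {\<zero>\<^bsub>M\<^esub>} \<Longrightarrow> W \<subseteq> V \<Longrightarrow> V = W" by auto
  have "\<exists>r\<in>carrier R. \<exists>w\<in>W. r \<odot>\<^bsub>M\<^esub> k \<oplus>\<^bsub>M\<^esub> w \<in> Y \<and> r \<odot>\<^bsub>M\<^esub> k \<oplus>\<^bsub>M\<^esub> w \<noteq> \<zero>\<^bsub>M\<^esub>"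
    if k: "k \<in> carrier M" "k \<notin> W" for k
  proof -
    let ?V = "{r \<odot>\<^bsub>M\<^esub> k \<oplus>\<^bsub>M\<^esub> h | r h. r \<in> carrier R \<and> h \<in> W}"
    have V: "submodule ?V R M" by (rule submodule_adjoin[OF M W(1) k(1)])
    have "?V \<inter> Y \<noteq> {\<zero>\<^bsub>M\<^esub>}"
      using max[OF V _ adjoin_incl(1)[OF M W(1) k(1)]] adjoin_incl(2)[OF M W(1) k(1)] k(2) by blast
    moreover have "\<zero>\<^bsub>M\<^esub> \<in> ?V \<inter> Y" using submodule_zero[OF V] submodule_zero[OF Y] by blast
    ultimately obtain v where v: "v \<in> ?V" "v \<in> Y" "v \<noteq> \<zero>\<^bsub>M\<^esub>" by blast
    from v(1) obtain r w where "r \<in> carrier R" "w \<in> W" "v = r \<odot>\<^bsub>M\<^esub> k \<oplus>\<^bsub>M\<^esub> w" by blast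
    with v(2,3) show ?thesis by blast
  qed
  with that W show thesis by blast
qed

text \<open>If \<open>W\<close> is a complement as above, \<open>\<rho> k\<close> is the component in \<open>M\<close> of \<open>r k \<in> \<iota> M \<oplus> W\<close>.\<close>

lemma finite_retraction:
  assumes M: "module R M" and K: "module R K" and J: "primeideal J R"
    and \<iota>: "\<iota> \<in> linear_maps R M K" "inj_on \<iota> (carrier M)"
    and JK: "\<And>r k. r \<in> J \<Longrightarrow> k \<in> carrier K \<Longrightarrow> r \<odot>\<^bsub>K\<^esub> k = \<zero>\<^bsub>K\<^esub>"
    and gs: "set gs \<subseteq> carrier K"
  obtains r H \<rho> where "r \<in> carrier R" "r \<notin> J" "submodule H R K" "set gs \<subseteq> H" "\<iota> ` carrier M \<subseteq> H"
    "\<rho> \<in> linear_maps R (K\<lparr>carrier := H\<rparr>) M" "\<And>m. m \<in> carrier M \<Longrightarrow> \<rho> (\<iota> m) = r \<odot>\<^bsub>M\<^esub> m"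
proof -
  interpret M: module R M by (rule M)
  interpret K: module R K by (rule K)
  interpret J: primeideal J R by (rule J)
  note \<iota>D = linear_mapsD[OF \<iota>(1)]
  have \<iota>0: "\<iota> \<zero>\<^bsub>M\<^esub> = \<zero>\<^bsub>K\<^esub>" by (rule linear_map_zero[OF M K \<iota>(1)])
  have Y: "submodule (\<iota> ` carrier M) R K" by (rule image_submodule[OF M K \<iota>(1)])
  obtain W where W: "submodule W R K" "W \<inter> \<iota> ` carrier M = {\<zero>\<^bsub>K\<^esub>}" and
    ess: "\<And>k. k \<in> carrier K \<Longrightarrow> k \<notin> W \<Longrightarrow> \<exists>r\<in>carrier R. \<exists>w\<in>W. r \<odot>\<^bsub>K\<^esub> k \<oplus>\<^bsub>K\<^esub> w \<in> \<iota> ` carrier M \<and>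
      r \<odot>\<^bsub>K\<^esub> k \<oplus>\<^bsub>K\<^esub> w \<noteq> \<zero>\<^bsub>K\<^esub>"
    using essential_complement[OF K Y] by metis
  have Wc: "w \<in> carrier K" if "w \<in> W" for w using submodule_subset[OF W(1)] that by blast
  define D where "D r k m \<longleftrightarrow> m \<in> carrier M \<and> (\<exists>w\<in>W. r \<odot>\<^bsub>K\<^esub> k = \<iota> m \<oplus>\<^bsub>K\<^esub> w)" for r k m
  \<comment> \<open>The domain of the retraction for the scalar \<open>r\<close>. It can only grow
    when \<open>r\<close> is replaced by a multiple, which is what allows finitely many scalars to
    be combined.\<close>
  define U where "U r = {k \<in> carrier K. \<exists>m. D r k m}" for r
  \<comment> \<open>The sum of the image of \<open>M\<close> and \<open>W\<close> is direct and
    \<open>\<iota>\<close> is injective, so the component is determined.\<close>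
  have uniq: "m = n" if "D r k m" "D r k n" for r k m n
  proof -
    from that obtain v w where *: "v \<in> W" "w \<in> W" "m \<in> carrier M" "n \<in> carrier M"
      "\<iota> m \<oplus>\<^bsub>K\<^esub> v = \<iota> n \<oplus>\<^bsub>K\<^esub> w" unfolding D_def by auto
    have c: "\<iota> m \<in> carrier K" "\<iota> n \<in> carrier K" "v \<in> carrier K" "w \<in> carrier K"
      using * \<iota>D(1) Wc by auto
    have u: "w \<oplus>\<^bsub>K\<^esub> \<ominus>\<^bsub>K\<^esub> v \<in> carrier K" using c by simp
    have "\<iota> m = \<iota> m \<oplus>\<^bsub>K\<^esub> v \<oplus>\<^bsub>K\<^esub> \<ominus>\<^bsub>K\<^esub> v" using c by (simp add: K.a_assoc K.r_neg)
    also have "\<dots> = (w \<oplus>\<^bsub>K\<^esub> \<ominus>\<^bsub>K\<^esub> v) \<oplus>\<^bsub>K\<^esub> \<iota> n" unfolding *(5) using c by (simp add: K.a_ac)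
    finally have e: "\<iota> m = (w \<oplus>\<^bsub>K\<^esub> \<ominus>\<^bsub>K\<^esub> v) \<oplus>\<^bsub>K\<^esub> \<iota> n" .
    have "\<iota> (m \<ominus>\<^bsub>M\<^esub> n) = \<iota> m \<oplus>\<^bsub>K\<^esub> \<ominus>\<^bsub>K\<^esub> \<iota> n"
      using linear_map_diff[OF M K \<iota>(1) *(3,4)] by (simp add: a_minus_def)
    also have "\<dots> = w \<oplus>\<^bsub>K\<^esub> \<ominus>\<^bsub>K\<^esub> v"
      unfolding e K.a_assoc[OF u c(2) K.a_inv_closed[OF c(2)]] K.r_neg[OF c(2)] using u by simp
    finally have "\<iota> (m \<ominus>\<^bsub>M\<^esub> n) \<in> W"
      using submodule_add[OF W(1) *(2) submodule_neg[OF K W(1) *(1)]] by simp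
    moreover have mn: "m \<ominus>\<^bsub>M\<^esub> n \<in> carrier M" using * by (simp add: a_minus_def)
    ultimately have "\<iota> (m \<ominus>\<^bsub>M\<^esub> n) \<in> W \<inter> \<iota> ` carrier M" by blast
    then have "\<iota> (m \<ominus>\<^bsub>M\<^esub> n) = \<iota> \<zero>\<^bsub>M\<^esub>" unfolding W(2) \<iota>0 by simp
    then have "m \<ominus>\<^bsub>M\<^esub> n = \<zero>\<^bsub>M\<^esub>" using inj_onD[OF \<iota>(2) _ mn M.zero_closed] by blast
    then have "m \<oplus>\<^bsub>M\<^esub> \<ominus>\<^bsub>M\<^esub> n = \<zero>\<^bsub>M\<^esub>" by (simp add: a_minus_def)
    then show ?thesis using *(3,4) M.minus_equality[of m "\<ominus>\<^bsub>M\<^esub> n"] by simp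
  qed
  have Dadd: "D r (k \<oplus>\<^bsub>K\<^esub> l) (m \<oplus>\<^bsub>M\<^esub> n)"
    if r: "r \<in> carrier R" and "k \<in> carrier K" "l \<in> carrier K" "D r k m" "D r l n" for r k l m n
  proof -
    from that obtain v w where *: "v \<in> W" "w \<in> W" "m \<in> carrier M" "n \<in> carrier M"
      "r \<odot>\<^bsub>K\<^esub> k = \<iota> m \<oplus>\<^bsub>K\<^esub> v" "r \<odot>\<^bsub>K\<^esub> l = \<iota> n \<oplus>\<^bsub>K\<^esub> w" unfolding D_def by auto
    then have "r \<odot>\<^bsub>K\<^esub> (k \<oplus>\<^bsub>K\<^esub> l) = \<iota> (m \<oplus>\<^bsub>M\<^esub> n) \<oplus>\<^bsub>K\<^esub> (v \<oplus>\<^bsub>K\<^esub> w)"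
      using that Wc \<iota>D(1,2) by (simp add: K.smult_r_distr K.a_ac)
    then show ?thesis unfolding D_def using * submodule_add[OF W(1) *(1,2)] by auto
  qed
  have Dsmult: "D r (s \<odot>\<^bsub>K\<^esub> k) (s \<odot>\<^bsub>M\<^esub> m)" "D (s \<otimes>\<^bsub>R\<^esub> r) k (s \<odot>\<^bsub>M\<^esub> m)"
    if r: "r \<in> carrier R" "s \<in> carrier R" and k: "k \<in> carrier K" and "D r k m" for r s k m
  proof -
    from that obtain v where *: "v \<in> W" "m \<in> carrier M" "r \<odot>\<^bsub>K\<^esub> k = \<iota> m \<oplus>\<^bsub>K\<^esub> v"
      unfolding D_def by auto
    have "s \<odot>\<^bsub>K\<^esub> (r \<odot>\<^bsub>K\<^esub> k) = \<iota> (s \<odot>\<^bsub>M\<^esub> m) \<oplus>\<^bsub>K\<^esub> s \<odot>\<^bsub>K\<^esub> v"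
      unfolding *(3) using * r Wc \<iota>D(1,3) by (simp add: K.smult_r_distr)
    moreover have "r \<odot>\<^bsub>K\<^esub> (s \<odot>\<^bsub>K\<^esub> k) = s \<odot>\<^bsub>K\<^esub> (r \<odot>\<^bsub>K\<^esub> k)" "(s \<otimes>\<^bsub>R\<^esub> r) \<odot>\<^bsub>K\<^esub> k = s \<odot>\<^bsub>K\<^esub> (r \<odot>\<^bsub>K\<^esub> k)"
      using r k by (simp_all add: K.smult_assoc1[symmetric] M.R.m_comm)
    ultimately show "D r (s \<odot>\<^bsub>K\<^esub> k) (s \<odot>\<^bsub>M\<^esub> m)" "D (s \<otimes>\<^bsub>R\<^esub> r) k (s \<odot>\<^bsub>M\<^esub> m)"
      unfolding D_def using * r submodule_smult[OF W(1) r(2) *(1)] by auto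
  qed
  have D\<iota>: "D r (\<iota> m) (r \<odot>\<^bsub>M\<^esub> m)" if "r \<in> carrier R" "m \<in> carrier M" for r m
    unfolding D_def using that \<iota>D(1,3) submodule_zero[OF W(1)] by (auto intro!: bexI[of _ "\<zero>\<^bsub>K\<^esub>"])
  have U: "submodule (U r) R K" if r: "r \<in> carrier R" for r
  proof (rule submoduleI'[OF K])
    show "\<zero>\<^bsub>K\<^esub> \<in> U r" using D\<iota>[OF r M.zero_closed] unfolding U_def \<iota>0 by blast
    show "x \<oplus>\<^bsub>K\<^esub> y \<in> U r" if "x \<in> U r" "y \<in> U r" for x y
      using that Dadd[OF r] unfolding U_def by blast
    show "s \<odot>\<^bsub>K\<^esub> x \<in> U r" if "s \<in> carrier R" "x \<in> U r" for s x
      using that Dsmult(1)[OF r] unfolding U_def by blast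
  qed (auto simp: U_def)
  have one: "\<one>\<^bsub>R\<^esub> \<notin> J" using J.I_notcarr J.one_imp_carrier by blast
  have ex1: "\<exists>r\<in>carrier R. r \<notin> J \<and> k \<in> U r" if k: "k \<in> carrier K" for k
  proof (cases "k \<in> W")
    case True
    then have "D \<one>\<^bsub>R\<^esub> k \<zero>\<^bsub>M\<^esub>" unfolding D_def \<iota>0 using k by (auto intro!: bexI[of _ k])
    then show ?thesis using one k by (intro bexI[of _ "\<one>\<^bsub>R\<^esub>"]) (auto simp: U_def)
  next
    case False
    then obtain r w m where r: "r \<in> carrier R" "w \<in> W" "m \<in> carrier M" "r \<odot>\<^bsub>K\<^esub> k \<oplus>\<^bsub>K\<^esub> w = \<iota> m"
      "r \<odot>\<^bsub>K\<^esub> k \<oplus>\<^bsub>K\<^esub> w \<noteq> \<zero>\<^bsub>K\<^esub>" using ess[OF k] by blast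
    \<comment> \<open>A scalar in \<open>J\<close> kills \<open>k\<close>, so that \<open>w\<close>
      alone would be a nonzero element of \<open>W\<close> in the image of \<open>M\<close>.\<close>
    have "r \<notin> J"
    proof
      assume "r \<in> J"
      then have "w = \<iota> m" using JK[OF _ k, of r] r(4) Wc[OF r(2)] by simp
      then have "w \<in> W \<inter> \<iota> ` carrier M" using r by blast
      then have "w = \<zero>\<^bsub>K\<^esub>" unfolding W(2) by simp
      then show False using r(5) JK[OF \<open>r \<in> J\<close> k] by simp
    qed
    moreover have "r \<odot>\<^bsub>K\<^esub> k = \<iota> m \<oplus>\<^bsub>K\<^esub> \<ominus>\<^bsub>K\<^esub> w"
      unfolding r(4)[symmetric] using r(1) k Wc[OF r(2)] by (simp add: K.a_assoc K.r_neg)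
    then have "D r k m" unfolding D_def using submodule_neg[OF K W(1) r(2)] r(3) by blast
    ultimately show ?thesis using r(1) k unfolding U_def by blast
  qed
  \<comment> \<open>The scalars of the single elements are multiplied; primality keeps the product
    outside \<open>J\<close>.\<close>
  have "\<exists>r\<in>carrier R. r \<notin> J \<and> set gs \<subseteq> U r" using gs
  proof (induction gs)
    case Nil
    show ?case using one by auto
  next
    case (Cons g gs)
    then obtain r s where r: "r \<in> carrier R" "r \<notin> J" "set gs \<subseteq> U r"
      and s: "s \<in> carrier R" "s \<notin> J" "g \<in> U s" using ex1[of g] by auto
    have "x \<in> U (s \<otimes>\<^bsub>R\<^esub> r)" if "x \<in> U r" for x using that Dsmult(2)[OF r(1) s(1)] unfolding U_def by
      blast
    moreover have "x \<in> U (r \<otimes>\<^bsub>R\<^esub> s)" if "x \<in> U s" for x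
      using that Dsmult(2)[OF s(1) r(1)] unfolding U_def by blast
    ultimately have "set (g # gs) \<subseteq> U (s \<otimes>\<^bsub>R\<^esub> r)" using r s by (auto simp: M.R.m_comm)
    moreover have "s \<otimes>\<^bsub>R\<^esub> r \<notin> J" using J.I_prime r s by blast
    ultimately show ?case using r s by blast
  qed
  then obtain r where r: "r \<in> carrier R" "r \<notin> J" "set gs \<subseteq> U r" by blast
  define \<rho> where "\<rho> k = (THE m. D r k m)" for k
  have \<rho>: "\<rho> k = m" if "D r k m" for k m unfolding \<rho>_def using that uniq by blast
  have \<rho>D: "D r k (\<rho> k)" if "k \<in> U r" for k using that \<rho> unfolding U_def by auto
  show thesis
  proof (rule that[OF r(1,2) U[OF r(1)] r(3)])
    show "\<iota> ` carrier M \<subseteq> U r" using D\<iota>[OF r(1)] \<iota>D(1) unfolding U_def by blast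
    show "\<rho> \<in> linear_maps R (K\<lparr>carrier := U r\<rparr>) M"
    proof (rule linear_mapsI, simp_all)
      fix x y assume "x \<in> U r" "y \<in> U r"
      then show "\<rho> (x \<oplus>\<^bsub>K\<^esub> y) = \<rho> x \<oplus>\<^bsub>M\<^esub> \<rho> y"
        using \<rho>D Dadd[OF r(1)] by (intro \<rho>) (auto simp: U_def)
    next
      fix x assume "x \<in> U r"
      then show "\<rho> x \<in> carrier M" using \<rho>D unfolding D_def by blast
    next
      fix s x assume "s \<in> carrier R" "x \<in> U r"
      then show "\<rho> (s \<odot>\<^bsub>K\<^esub> x) = s \<odot>\<^bsub>M\<^esub> \<rho> x"
        using \<rho>D Dsmult(1)[OF r(1)] by (intro \<rho>) (auto simp: U_def)
    qed
    show "\<rho> (\<iota> m) = r \<odot>\<^bsub>M\<^esub> m" if "m \<in> carrier M" for m by (rule \<rho>[OF D\<iota>[OF r(1) that]])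
  qed
qed

text \<open>The members of an infinite ascending sequence form a chain of ideals, whose union would
  be one of them, contradicting the strict inclusion of that member in the next.\<close>

lemma (in noetherian_ring) ideal_reverse_wf: "wf {(I, J). ideal I R \<and> ideal J R \<and> J \<subset> I}"
  unfolding wf_iff_no_infinite_down_chain
proof
  assume "\<exists>f. \<forall>i. (f (Suc i), f i) \<in> {(I, J). ideal I R \<and> ideal J R \<and> J \<subset> I}"
  then obtain f where f: "\<forall>i. (f (Suc i), f i) \<in> {(I, J). ideal I R \<and> ideal J R \<and> J \<subset> I}"
    by (rule exE)
  have ideal: "ideal (f i) R" and less: "f i \<subset> f (Suc i)" for i using f[rule_format, of i] by
    simp_all
  have "f i \<subseteq> f j" if "i \<le> j" for i j
    by (rule lift_Suc_mono_le[of f, OF psubset_imp_subset[OF less] that])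
  then have "f i \<subseteq> f j \<or> f j \<subseteq> f i" for i j using nat_le_linear[of i j] by blast
  then have "subset.chain {I. ideal I R} (range f)"
    unfolding subset_chain_def using ideal by blast
  then obtain n where "\<Union>(range f) = f n" using ideal_chain_is_trivial[of "range f"] by blast
  then show False using less[of n] by blast
qed

lemma tensor_map_comp_left:
  assumes "module R M" "module R N" "module R M'" "module R M''"
    and "f \<in> linear_maps R M M'" "f' \<in> linear_maps R M' M''"
    and "\<And>x. x \<in> carrier M \<Longrightarrow> f' (f x) = h x" and "u \<in> carrier (tensor R M N)"
  shows "tensor_map R M'' N f' id (tensor_map R M' N f id u) = tensor_map R M'' N h id u"
proof -
  note id = linear_maps_id(1)
  have "tensor_map R M'' N f' id (tensor_map R M' N f id u)
      = tensor_map R M'' N (\<lambda>x. f' (f x)) (\<lambda>x. id (id x)) u"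
    by (rule tensor_map_comp[OF assms(1,2,3,2,4,2,5) id assms(6) id assms(8)])
  also have "\<dots> = tensor_map R M'' N h id u"
    by (rule tensor_map_cong[OF assms(1,2,4,2) linear_maps_comp[OF assms(5,6)]
      linear_maps_comp[OF id id]
          _ _ assms(8)]) (simp_all add: assms(7))
  finally show ?thesis .
qed

section \<open>Cyclic modules, annihilators and ideals of \<open>A\<close>\<close>

lemma smult_commute:
  assumes "module R M" "r \<in> carrier R" "s \<in> carrier R" "m \<in> carrier M"
  shows "r \<odot>\<^bsub>M\<^esub> (s \<odot>\<^bsub>M\<^esub> m) = s \<odot>\<^bsub>M\<^esub> (r \<odot>\<^bsub>M\<^esub> m)"
proof -
  interpret M: module R M by fact
  show ?thesis using assms by (simp add: M.smult_assoc1[symmetric] M.R.m_comm)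
qed

definition annihilator where "annihilator R M g = {r \<in> carrier R. r \<odot>\<^bsub>M\<^esub> g = \<zero>\<^bsub>M\<^esub>}"

lemma annihilator_ideal:
  assumes M: "module R M" and g: "g \<in> carrier M"
  shows "ideal (annihilator R M g) R"
proof -
  interpret M: module R M by (rule M)
  have mult: "(a \<otimes>\<^bsub>R\<^esub> x) \<odot>\<^bsub>M\<^esub> g = \<zero>\<^bsub>M\<^esub>" "(x \<otimes>\<^bsub>R\<^esub> a) \<odot>\<^bsub>M\<^esub> g = \<zero>\<^bsub>M\<^esub>"
    if "a \<in> carrier R" "a \<odot>\<^bsub>M\<^esub> g = \<zero>\<^bsub>M\<^esub>" "x \<in> carrier R" for a x
    using that M.smult_assoc1[of x a g] g by (simp_all add: M.R.m_comm[of a x])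
  show ?thesis
  proof (rule idealI)
    show "ring R" by (rule M.R.ring_axioms)
    show "subgroup (annihilator R M g) (add_monoid R)"
    proof (rule group.subgroupI[OF M.R.a_group])
      show "annihilator R M g \<noteq> {}" using g unfolding annihilator_def by
        (auto intro!: exI[of _ "\<zero>\<^bsub>R\<^esub>"])
    qed (use g in \<open>auto simp: annihilator_def M.smult_l_distr M.smult_l_minus a_inv_def[symmetric]\<close>)
  qed (auto simp: annihilator_def mult)
qed

lemma cyclicD:
  assumes "cyclic R M g"
  shows "module R M" "g \<in> carrier M" "x \<in> carrier M \<Longrightarrow> \<exists>r\<in>carrier R. x = r \<odot>\<^bsub>M\<^esub> g"
  using assms by (auto simp: cyclic_def)

lemma cyclicI:
  assumes "module R M" "g \<in> carrier M" "\<And>x. x \<in> carrier M \<Longrightarrow> \<exists>r\<in>carrier R. x = r \<odot>\<^bsub>M\<^esub> g"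
  shows "cyclic R M g"
  using assms module.smult_closed[OF assms(1)] unfolding cyclic_def by blast

text \<open>The rule \<open>r g \<mapsto> r u\<close> is well defined and injective because two
  multiples of \<open>g\<close> agree exactly if the corresponding multiples of \<open>u\<close> do:
  their difference is governed by the common annihilator.\<close>

lemma cyclic_map:
  fixes R :: "('r, 'x) ring_scheme" and M :: "('r, 'm, 'y) module_scheme" and K :: "('r, 'k, 'w)
    module_scheme"
  assumes M: "cyclic R M g" and K: "module R K" "u \<in> carrier K"
    and ann: "annihilator R M g = annihilator R K u"
  obtains \<iota> where "\<iota> \<in> linear_maps R M K" "inj_on \<iota> (carrier M)"
proof -
  interpret M: module R M by (rule cyclicD(1)[OF M])
  interpret K: module R K by (rule K)
  have g: "g \<in> carrier M" by (rule cyclicD(2)[OF M])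
  have ann': "r \<odot>\<^bsub>M\<^esub> g = \<zero>\<^bsub>M\<^esub> \<longleftrightarrow> r \<odot>\<^bsub>K\<^esub> u = \<zero>\<^bsub>K\<^esub>" if "r \<in> carrier R" for r
    using ann that by (auto simp: annihilator_def)
  have diff: "r \<odot>\<^bsub>P\<^esub> x = s \<odot>\<^bsub>P\<^esub> x \<longleftrightarrow> (r \<oplus>\<^bsub>R\<^esub> \<ominus>\<^bsub>R\<^esub> s) \<odot>\<^bsub>P\<^esub> x = \<zero>\<^bsub>P\<^esub>"
    if "module R P" "x \<in> carrier P" "r \<in> carrier R" "s \<in> carrier R" for r s x and P ::
      "('r, 'p, 'z) module_scheme"
  proof -
    interpret P: module R P by (rule that)
    have "(r \<oplus>\<^bsub>R\<^esub> \<ominus>\<^bsub>R\<^esub> s) \<odot>\<^bsub>P\<^esub> x = r \<odot>\<^bsub>P\<^esub> x \<oplus>\<^bsub>P\<^esub> \<ominus>\<^bsub>P\<^esub> (s \<odot>\<^bsub>P\<^esub> x)"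
      using that by (simp add: P.smult_l_distr P.smult_l_minus)
    moreover have "a \<oplus>\<^bsub>P\<^esub> \<ominus>\<^bsub>P\<^esub> b = \<zero>\<^bsub>P\<^esub> \<longleftrightarrow> a = b" if "a \<in> carrier P" "b \<in> carrier P" for a b
      using that P.minus_equality[of a "\<ominus>\<^bsub>P\<^esub> b"] by (auto simp: P.r_neg)
    ultimately show ?thesis using that by simp
  qed
  have iff: "r \<odot>\<^bsub>M\<^esub> g = s \<odot>\<^bsub>M\<^esub> g \<longleftrightarrow> r \<odot>\<^bsub>K\<^esub> u = s \<odot>\<^bsub>K\<^esub> u" if "r \<in> carrier R" "s \<in> carrier R" for r s
    using diff[OF cyclicD(1)[OF M] g that] diff[OF K that] ann'[of "r \<oplus>\<^bsub>R\<^esub> \<ominus>\<^bsub>R\<^esub> s"] that by simp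
  define c where "c m = (SOME r. r \<in> carrier R \<and> m = r \<odot>\<^bsub>M\<^esub> g)" for m
  have c: "c m \<in> carrier R" "m = c m \<odot>\<^bsub>M\<^esub> g" if "m \<in> carrier M" for m
    unfolding c_def atomize_conj by (rule someI_ex) (use cyclicD(3)[OF M that] in blast)
  define \<iota> where "\<iota> m = c m \<odot>\<^bsub>K\<^esub> u" for m
  have \<iota>: "\<iota> (r \<odot>\<^bsub>M\<^esub> g) = r \<odot>\<^bsub>K\<^esub> u" if r: "r \<in> carrier R" for r
  proof -
    have rg: "r \<odot>\<^bsub>M\<^esub> g \<in> carrier M" using r g by simp
    show ?thesis unfolding \<iota>_def by (rule iff[OF c(1)[OF rg] r, THEN iffD1])
      (rule c(2)[OF rg, symmetric])
  qed
  have "\<iota> \<in> linear_maps R M K"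
  proof (rule linear_mapsI)
    fix x y assume xy: "x \<in> carrier M" "y \<in> carrier M"
    then obtain r s where rs: "r \<in> carrier R" "s \<in> carrier R" "x = r \<odot>\<^bsub>M\<^esub> g" "y = s \<odot>\<^bsub>M\<^esub> g"
      using cyclicD(3)[OF M] by metis
    then have "x \<oplus>\<^bsub>M\<^esub> y = (r \<oplus>\<^bsub>R\<^esub> s) \<odot>\<^bsub>M\<^esub> g" using g by (simp add: M.smult_l_distr)
    then show "\<iota> (x \<oplus>\<^bsub>M\<^esub> y) = \<iota> x \<oplus>\<^bsub>K\<^esub> \<iota> y" using rs K(2) by (simp add: \<iota> K.smult_l_distr)
  next
    fix r x assume r: "r \<in> carrier R" and x: "x \<in> carrier M"
    then obtain s where s: "s \<in> carrier R" "x = s \<odot>\<^bsub>M\<^esub> g" using cyclicD(3)[OF M] by metis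
    then have "r \<odot>\<^bsub>M\<^esub> x = (r \<otimes>\<^bsub>R\<^esub> s) \<odot>\<^bsub>M\<^esub> g" using g r by (simp add: M.smult_assoc1)
    then show "\<iota> (r \<odot>\<^bsub>M\<^esub> x) = r \<odot>\<^bsub>K\<^esub> \<iota> x" using r s K(2) by (simp add: \<iota> K.smult_assoc1)
  qed (use c(1) K(2) in \<open>simp add: \<iota>_def\<close>)
  moreover have "inj_on \<iota> (carrier M)"
  proof (rule inj_onI)
    fix x y assume xy: "x \<in> carrier M" "y \<in> carrier M" "\<iota> x = \<iota> y"
    then show "x = y" using iff[OF c(1)[OF xy(1)] c(1)[OF xy(2)]] c(2) unfolding \<iota>_def by metis
  qed
  ultimately show thesis by (rule that)
qed

text \<open>For \<open>M = R/J\<close> this is \<open>R/(J + x R)\<close>. Of its annihilator only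
  the two inclusions at the end are recorded; for \<open>x\<close> outside \<open>J\<close> they
  make it strictly larger than \<open>J\<close>.\<close>

lemma cyclic_quotient:
  fixes R :: "('r, 'x) ring_scheme" and M :: "('r, 'm) module"
  assumes M: "cyclic R M g" and x: "x \<in> carrier R"
  obtains Q :: "('r, 'm) module" and p where "cyclic R Q (p g)" "p \<in> linear_maps R M Q"
    "p ` carrier M = carrier Q" "\<And>m. m \<in> carrier M \<Longrightarrow> p m = \<zero>\<^bsub>Q\<^esub> \<longleftrightarrow> m \<in> (\<lambda>m. x \<odot>\<^bsub>M\<^esub> m) ` carrier M"
    "annihilator R M g \<subseteq> annihilator R Q (p g)" "x \<in> annihilator R Q (p g)"
proof -
  note mod = cyclicD(1)[OF M] and g = cyclicD(2)[OF M]
  interpret M: module R M by (rule mod)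
  have sub: "submodule ((\<lambda>m. x \<odot>\<^bsub>M\<^esub> m) ` carrier M) R M"
    by (rule image_submodule[OF mod mod module_smult_linear[OF mod x]])
  obtain Q :: "('r, 'm) module" and p where Q: "module R Q" and p: "p \<in> linear_maps R M Q"
    and surj: "p ` carrier M = carrier Q"
    and ker: "\<And>m. m \<in> carrier M \<Longrightarrow> p m = \<zero>\<^bsub>Q\<^esub> \<longleftrightarrow> m \<in> (\<lambda>m. x \<odot>\<^bsub>M\<^esub> m) ` carrier M"
    using quotient_module[OF mod sub] by metis
  have "cyclic R Q (p g)"
  proof (rule cyclicI[OF Q linear_mapsD(1)[OF p g]])
    fix y assume "y \<in> carrier Q"
    then obtain m where m: "m \<in> carrier M" "y = p m" unfolding surj[symmetric] by blast
    then obtain r where "r \<in> carrier R" "m = r \<odot>\<^bsub>M\<^esub> g" using cyclicD(3)[OF M] by blast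
    then show "\<exists>r\<in>carrier R. y = r \<odot>\<^bsub>Q\<^esub> p g" using linear_mapsD(3)[OF p _ g] m(2) by blast
  qed
  moreover have "annihilator R M g \<subseteq> annihilator R Q (p g)"
    using linear_map_zero[OF mod Q p] by (auto simp: annihilator_def
      linear_mapsD(3)[OF p _ g, symmetric])
  moreover have "x \<odot>\<^bsub>Q\<^esub> p g = \<zero>\<^bsub>Q\<^esub>"
    using linear_mapsD(3)[OF p x g] ker[of "x \<odot>\<^bsub>M\<^esub> g"] x g by auto
  then have "x \<in> annihilator R Q (p g)" using x by (simp add: annihilator_def)
  ultimately show thesis using that p surj ker by blast
qed

lemma assoc_algebra_mult_linear:
  assumes "assoc_algebra R A" "c \<in> carrier A"
  shows "(\<lambda>a. c \<otimes>\<^bsub>A\<^esub> a) \<in> linear_maps R A A" "(\<lambda>a. a \<otimes>\<^bsub>A\<^esub> c) \<in> linear_maps R A A"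
proof -
  interpret A: assoc_algebra R A by fact
  show "(\<lambda>a. c \<otimes>\<^bsub>A\<^esub> a) \<in> linear_maps R A A" "(\<lambda>a. a \<otimes>\<^bsub>A\<^esub> c) \<in> linear_maps R A A"
    using assms(2)
    by (auto intro!: linear_mapsI simp: A.smult_mult_left A.smult_mult_right A.l_distr A.r_distr)
qed

lemma assoc_algebra_module: "assoc_algebra R A \<Longrightarrow> module R A"
  by (simp add: assoc_algebra_def)

text \<open>Left and right multiplication by \<open>\<psi> c\<close> are \<open>R\<close>-linear on
  \<open>B\<close> and induce endomorphisms of the tensor product, which fix the factor
  \<open>m\<close> and preserve zero. It is applied both to \<open>\<phi>\<close> and to the
  identity of \<open>A\<close>.\<close>

lemma pure_tensor_zero_ideal:
  assumes M: "module R M" "m \<in> carrier M" and A: "assoc_algebra R A" and B: "assoc_algebra R B"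
    and \<psi>: "\<psi> \<in> linear_maps R A B"
      "\<And>a b. a \<in> carrier A \<Longrightarrow> b \<in> carrier A \<Longrightarrow> \<psi> (a \<otimes>\<^bsub>A\<^esub> b) = \<psi> a \<otimes>\<^bsub>B\<^esub> \<psi> b"
  shows "ideal {a \<in> carrier A. pure_tensor R M B m (\<psi> a) = \<zero>\<^bsub>tensor R M B\<^esub>} A" (is "ideal ?I A")
proof -
  interpret A: assoc_algebra R A by (rule A)
  note mA = assoc_algebra_module[OF A] and mB = assoc_algebra_module[OF B]
  interpret T: module R "tensor R M B" by (rule tensor_module[OF M(1) mB])
  interpret B: assoc_algebra R B by (rule B)
  note \<psi>D = linear_mapsD[OF \<psi>(1)]
  have sub: "submodule ?I R A"
  proof (rule submoduleI'[OF mA])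
    have "pure_tensor R M B m \<zero>\<^bsub>B\<^esub> = \<zero>\<^bsub>tensor R M B\<^esub>"
      by (rule additive_map_zero[OF module_abelian[OF mB] T.abelian_group_axioms
            balanced_mapD(6)[OF balanced_pure_tensor M(2)]])
    then show "\<zero>\<^bsub>A\<^esub> \<in> ?I" by (simp add: linear_map_zero[OF mA mB \<psi>(1)])
    show "x \<oplus>\<^bsub>A\<^esub> y \<in> ?I" if "x \<in> ?I" "y \<in> ?I" for x y
      using that by (simp add: \<psi>D(1,2) pure_tensor_add_right M(2))
    show "r \<odot>\<^bsub>A\<^esub> x \<in> ?I" if "r \<in> carrier R" "x \<in> ?I" for r x
      using that by (simp add: \<psi>D(1,3) pure_tensor_balanced[symmetric] M(2)
        pure_tensor_smult[OF M(1) mB, symmetric])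
  qed blast
  have lin: "pure_tensor R M B m (f b) = \<zero>\<^bsub>tensor R M B\<^esub>"
    if f: "f \<in> linear_maps R B B" and b: "b \<in> carrier B" "pure_tensor R M B m b = \<zero>\<^bsub>tensor R M B\<^esub>"
      for f b
  proof -
    have "pure_tensor R M B m (f b) = tensor_map R M B id f (pure_tensor R M B m b)"
      using tensor_map_pure[OF M(1) mB M(1) mB linear_maps_id(1) f M(2) b(1)] by simp
    also have "\<dots> = \<zero>\<^bsub>tensor R M B\<^esub>" unfolding b(2)
      by (rule linear_map_zero[OF T.module_axioms T.module_axioms
            tensor_map_linear[OF M(1) mB M(1) mB linear_maps_id(1) f]])
    finally show ?thesis .
  qed
  show ?thesis
  proof (rule idealI)
    show "ring A" by (rule A.ring_axioms)
    show "subgroup ?I (add_monoid A)" using sub by (simp add: submodule_def)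
    fix a c assume a: "a \<in> ?I" and c: "c \<in> carrier A"
    show "c \<otimes>\<^bsub>A\<^esub> a \<in> ?I"
      using lin[OF assoc_algebra_mult_linear(1)[OF B \<psi>D(1)[OF c]], of "\<psi> a"] a c by
        (simp add: \<psi>(2) \<psi>D(1))
    show "a \<otimes>\<^bsub>A\<^esub> c \<in> ?I"
      using lin[OF assoc_algebra_mult_linear(2)[OF B \<psi>D(1)[OF c]], of "\<psi> a"] a c by
        (simp add: \<psi>(2) \<psi>D(1))
  qed
qed

text \<open>Scalars move to the right factor, so a sum of terms \<open>r g \<otimes> n\<close>
  becomes \<open>g\<close> tensor a single element. Kernels in the tensor product can thus be
  studied through ideals of \<open>A\<close>.\<close>

lemma cyclic_tensor_pure:
  assumes M: "cyclic R M g" and N: "module R N" and x: "x \<in> carrier (tensor R M N)"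
  shows "\<exists>n\<in>carrier N. x = pure_tensor R M N g n"
  using x
proof (induction rule: tensor_induct)
  interpret N: module R N by (rule N)
  case zero
  have "pure_tensor R M N g \<zero>\<^bsub>N\<^esub> = \<zero>\<^bsub>tensor R M N\<^esub>"
    by (rule additive_map_zero[OF module_abelian[OF N] tensor_abelian[OF cyclicD(1)[OF M] N]
          balanced_mapD(6)[OF balanced_pure_tensor cyclicD(2)[OF M]]])
  then show ?case using N.zero_closed by metis
next
  interpret N: module R N by (rule N)
  case (pure m n)
  obtain r where r: "r \<in> carrier R" "m = r \<odot>\<^bsub>M\<^esub> g" using cyclicD(3)[OF M pure(1)] by blast
  show ?case unfolding r(2) pure_tensor_balanced[OF r(1) cyclicD(2)[OF M] pure(2)]
    using r(1) pure(2) by blast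
next
  interpret N: module R N by (rule N)
  case (add u v)
  then obtain m n where "m \<in> carrier N" "n \<in> carrier N" "u = pure_tensor R M N g m" "v =
    pure_tensor R M N g n" by blast
  then show ?case using pure_tensor_add_right[OF cyclicD(2)[OF M], of m N n R] N.a_closed by metis
qed

locale flat_algebra_complex = flat_complex R A B D \<phi> d
  for R :: "('r, 'x) ring_scheme" and A :: "('r, 'c, 'ya) module_scheme"
    and B :: "('r, 'b, 'yb) module_scheme" and D :: "('r, 'd, 'yd) module_scheme" and \<phi> d +
  assumes A_alg: "assoc_algebra R A" and B_alg: "assoc_algebra R B"
    and \<phi>_mult: "a \<in> carrier A \<Longrightarrow> b \<in> carrier A \<Longrightarrow> \<phi> (a \<otimes>\<^bsub>A\<^esub> b) = \<phi> a \<otimes>\<^bsub>B\<^esub> \<phi> b"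
    and R_noetherian: "noetherian_ring R" and A_noetherian: "noetherian_ring A"
begin

section \<open>Homology of a cyclic module with prime annihilator\<close>

context
  fixes M :: "('r, 'm) module" and K :: "('r, 'k) module" and g J \<iota>
  assumes cyc: "cyclic R M g" and J: "primeideal J R" and ann: "annihilator R M g = J"
    and K: "module R K" and exact_K: "exact K"
    and \<iota>: "\<iota> \<in> linear_maps R M K" "inj_on \<iota> (carrier M)"
    and JK: "\<And>r k. r \<in> J \<Longrightarrow> k \<in> carrier K \<Longrightarrow> r \<odot>\<^bsub>K\<^esub> k = \<zero>\<^bsub>K\<^esub>"
begin

lemma M: "module R M" by (rule cyclicD(1)[OF cyc])

text \<open>By naturality and exactness for \<open>K\<close>, the image of \<open>x\<close> over
  \<open>K\<close> is zero. This vanishing already happens over a submodule \<open>H\<close> on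
  which a retraction is defined; retracting turns the image of \<open>x\<close> back into
  \<open>r x\<close>.\<close>

lemma kernel_torsion:
  assumes x: "x \<in> carrier (tensor R M A)" "\<Phi> M x = \<zero>\<^bsub>tensor R M B\<^esub>"
  shows "\<exists>r\<in>carrier R. r \<notin> J \<and> r \<odot>\<^bsub>tensor R M A\<^esub> x = \<zero>\<^bsub>tensor R M A\<^esub>"
proof -
  note id = linear_maps_id(1)
  let ?X = "\<iota> ` carrier M" let ?K = "\<lambda>H. K\<lparr>carrier := H\<rparr>"
  have X: "submodule ?X R K" by (rule image_submodule[OF M K \<iota>(1)])
  note KX = restrict_module[OF K X]
  have \<iota>X: "\<iota> \<in> linear_maps R M (?K H)" if "?X \<subseteq> H" for H
    using linear_mapsD[OF \<iota>(1)] that by (intro linear_mapsI) auto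
  \<comment> \<open>The finiteness argument concerns submodules of \<open>K\<close>, so
    \<open>x\<close> is first moved to the copy \<open>?X\<close> of \<open>M\<close> inside
    \<open>K\<close>.\<close>
  let ?u = "tensor_map R (?K ?X) A \<iota> id x"
  have u: "?u \<in> carrier (tensor R (?K ?X) A)"
    by (rule linear_mapsD(1)[OF tensor_map_linear[OF M A KX A \<iota>X[OF subset_refl] id] x(1)])
  have "tensor_map R K A id id ?u = tensor_map R K A \<iota> id x"
    by (rule tensor_map_comp_left[OF M A KX K \<iota>X[OF subset_refl]
      restrict_inclusion'[OF submodule_subset[OF X]] _ x(1)]) simp
  also have "\<dots> = \<zero>\<^bsub>tensor R K A\<^esub>"
  proof (rule exactD(1)[OF exact_K linear_mapsD(1)[OF tensor_map_linear[OF M A K A \<iota>(1) id] x(1)]])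
    show "\<Phi> K (tensor_map R K A \<iota> id x) = \<zero>\<^bsub>tensor R K B\<^esub>"
      unfolding \<Phi>_natural[OF M K \<iota>(1) x(1)] x(2)
      by (rule linear_map_zero[OF tensor_module[OF M B] tensor_module[OF K B]
            tensor_map_linear[OF M B K B \<iota>(1) id]])
  qed
  finally obtain gs where gs: "set gs \<subseteq> carrier K" and zero: "\<And>H. submodule H R K \<Longrightarrow> set gs \<subseteq> H \<Longrightarrow> ?X
    \<subseteq> H \<Longrightarrow>
      tensor_map R (?K H) A id id ?u = \<zero>\<^bsub>tensor R (?K H) A\<^esub>"
    using tensor_finite_zero[OF K A X u] by metis
  obtain r H \<rho> where r: "r \<in> carrier R" "r \<notin> J" and H: "submodule H R K" "set gs \<subseteq> H" "?X \<subseteq> H"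
    and \<rho>: "\<rho> \<in> linear_maps R (?K H) M" "\<And>m. m \<in> carrier M \<Longrightarrow> \<rho> (\<iota> m) = r \<odot>\<^bsub>M\<^esub> m"
    using finite_retraction[OF M K J \<iota> JK gs] by metis
  note KH = restrict_module[OF K H(1)]
  have "r \<odot>\<^bsub>tensor R M A\<^esub> x = tensor_map R M A (\<lambda>m. r \<odot>\<^bsub>M\<^esub> m) id x"
    by (rule tensor_map_smult_left[OF M A r(1) x(1), symmetric])
  also have "\<dots> = tensor_map R M A \<rho> id (tensor_map R (?K H) A \<iota> id x)"
    by (rule tensor_map_comp_left[OF M A KH M \<iota>X[OF H(3)] \<rho>(1) \<rho>(2) x(1), symmetric])
  also have "tensor_map R (?K H) A \<iota> id x = tensor_map R (?K H) A id id ?u"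
    by (rule tensor_map_comp_left[OF M A KX KH \<iota>X[OF subset_refl] restrict_inclusion[OF H(3)] _
      x(1), symmetric]) simp
  also have "\<dots> = \<zero>\<^bsub>tensor R (?K H) A\<^esub>" by (rule zero[OF H])
  also have "tensor_map R M A \<rho> id \<zero>\<^bsub>tensor R (?K H) A\<^esub> = \<zero>\<^bsub>tensor R M A\<^esub>"
    by (rule linear_map_zero[OF tensor_module[OF KH A] tensor_module[OF M A]
          tensor_map_linear[OF KH A M A \<rho>(1) id]])
  finally show ?thesis using r by blast
qed

text \<open>Over \<open>K\<close> the image of \<open>x\<close> has a preimage, which lives over
  some \<open>H\<close> with a retraction. Applying the retraction to \<open>x\<close> and to the
  preimage yields a preimage of \<open>r x\<close>.\<close>

lemma cokernel_torsion:
  assumes x: "x \<in> carrier (tensor R M B)" "\<Delta> M x = \<zero>\<^bsub>tensor R M D\<^esub>"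
  shows "\<exists>r\<in>carrier R. r \<notin> J \<and> r \<odot>\<^bsub>tensor R M B\<^esub> x \<in> \<Phi> M ` carrier (tensor R M A)"
proof -
  note id = linear_maps_id(1)
  let ?X = "\<iota> ` carrier M" let ?K = "\<lambda>H. K\<lparr>carrier := H\<rparr>"
  have \<iota>X: "\<iota> \<in> linear_maps R M (?K H)" if "?X \<subseteq> H" for H
    using linear_mapsD[OF \<iota>(1)] that by (intro linear_mapsI) auto
  have "\<Delta> K (tensor_map R K B \<iota> id x) = \<zero>\<^bsub>tensor R K D\<^esub>"
    unfolding \<Delta>_natural[OF M K \<iota>(1) x(1)] x(2)
    by (rule linear_map_zero[OF tensor_module[OF M D] tensor_module[OF K D]
          tensor_map_linear[OF M D K D \<iota>(1) id]])
  then obtain z where z: "z \<in> carrier (tensor R K A)" "tensor_map R K B \<iota> id x = \<Phi> K z"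
    using exactD(2)[OF exact_K linear_mapsD(1)[OF tensor_map_linear[OF M B K B \<iota>(1) id] x(1)]] by
      blast
  obtain gs where gs: "set gs \<subseteq> carrier K" and rep: "\<And>H. submodule H R K \<Longrightarrow> set gs \<subseteq> H \<Longrightarrow>
      \<exists>v\<in>carrier (tensor R (?K H) A). z = tensor_map R K A id id v"
    using tensor_finite_rep[OF K A z(1)] by metis
  obtain r H \<rho> where r: "r \<in> carrier R" "r \<notin> J" and H: "submodule H R K" "set gs \<subseteq> H" "?X \<subseteq> H"
    and \<rho>: "\<rho> \<in> linear_maps R (?K H) M" "\<And>m. m \<in> carrier M \<Longrightarrow> \<rho> (\<iota> m) = r \<odot>\<^bsub>M\<^esub> m"
    using finite_retraction[OF M K J \<iota> JK gs] by metis
  note KH = restrict_module[OF K H(1)]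
  have inc: "id \<in> linear_maps R (?K H) K" by (rule restrict_inclusion'[OF
    submodule_subset[OF H(1)]])
  obtain v where v: "v \<in> carrier (tensor R (?K H) A)" "z = tensor_map R K A id id v"
    using rep[OF H(1,2)] by blast
  let ?u = "tensor_map R (?K H) B \<iota> id x"
  have u: "?u \<in> carrier (tensor R (?K H) B)"
    by (rule linear_mapsD(1)[OF tensor_map_linear[OF M B KH B \<iota>X[OF H(3)] id] x(1)])
  have \<Phi>v: "\<Phi> (?K H) v \<in> carrier (tensor R (?K H) B)"
    by (rule linear_mapsD(1)[OF \<Phi>_linear[OF KH] v(1)])
  \<comment> \<open>Flatness of \<open>B\<close> is what brings the equation between
    \<open>x\<close> and the image of the preimage from \<open>K\<close> down to
    \<open>H\<close>.\<close>
  have "inj_on (tensor_map R K B id id) (carrier (tensor R (?K H) B))"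
    by (rule linear_map_inj_on[OF tensor_module[OF KH B] tensor_module[OF K B]
      tensor_map_linear[OF KH B K B inc id]])
      (rule flat_injective[OF flat_B KH K inc inj_on_id])
  moreover have "tensor_map R K B id id ?u = tensor_map R K B id id (\<Phi> (?K H) v)"
  proof -
    have "tensor_map R K B id id ?u = tensor_map R K B \<iota> id x"
      by (rule tensor_map_comp_left[OF M B KH K \<iota>X[OF H(3)] inc _ x(1)]) simp
    also have "\<dots> = \<Phi> K (tensor_map R K A id id v)" unfolding z(2) v(2) ..
    also have "\<dots> = tensor_map R K B id id (\<Phi> (?K H) v)" by (rule \<Phi>_natural[OF KH K inc v(1)])
    finally show ?thesis .
  qed
  ultimately have uv: "?u = \<Phi> (?K H) v" using u \<Phi>v by (rule inj_onD)
  have "r \<odot>\<^bsub>tensor R M B\<^esub> x = tensor_map R M B (\<lambda>m. r \<odot>\<^bsub>M\<^esub> m) id x"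
    by (rule tensor_map_smult_left[OF M B r(1) x(1), symmetric])
  also have "\<dots> = tensor_map R M B \<rho> id ?u"
    by (rule tensor_map_comp_left[OF M B KH M \<iota>X[OF H(3)] \<rho>(1) \<rho>(2) x(1), symmetric])
  also have "\<dots> = \<Phi> M (tensor_map R M A \<rho> id v)"
    unfolding uv by (rule \<Phi>_natural[OF KH M \<rho>(1) v(1), symmetric])
  finally show ?thesis
    using r linear_mapsD(1)[OF tensor_map_linear[OF KH A M A \<rho>(1) id] v(1)] by blast
qed

text \<open>The elements \<open>a\<close> with \<open>g \<otimes> a\<close> in the kernel form an ideal of the noetherian ring \<open>A\<close>, so
  finitely many of the elements of \<open>kernel_torsion\<close> suffice.\<close>

lemma kernel_uniform_torsion:
  obtains r where "r \<in> carrier R" "r \<notin> J"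
    "\<And>x. x \<in> carrier (tensor R M A) \<Longrightarrow> \<Phi> M x = \<zero>\<^bsub>tensor R M B\<^esub> \<Longrightarrow> r \<odot>\<^bsub>tensor R M A\<^esub> x = \<zero>\<^bsub>tensor R M A\<^esub>"
proof -
  note id = linear_maps_id(1)
  interpret NA: noetherian_ring A by (rule A_noetherian)
  interpret MA: module R "tensor R M A" by (rule tensor_module[OF M A])
  interpret J: primeideal J R by (rule J)
  interpret M: module R M by (rule M)
  have g: "g \<in> carrier M" by (rule cyclicD(2)[OF cyc])
  let ?p = "pure_tensor R M A g"
  have p: "?p a \<in> carrier (tensor R M A)" if "a \<in> carrier A" for a by
    (rule pure_tensor_closed[OF g that])
  have \<Phi>p: "\<Phi> M (?p a) = pure_tensor R M B g (\<phi> a)" if "a \<in> carrier A" for a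
    using tensor_map_pure[OF M A M B id \<phi> g that] by simp
  define I where "I = {a \<in> carrier A. pure_tensor R M B g (\<phi> a) = \<zero>\<^bsub>tensor R M B\<^esub>}"
  have "ideal I A" unfolding I_def by (rule pure_tensor_zero_ideal[OF M g A_alg B_alg \<phi> \<phi>_mult])
  from NA.finetely_gen[OF this] obtain S where S: "S \<subseteq> carrier A" "finite S" "I = genideal A S"
    by (elim exE conjE)
  have SI: "S \<subseteq> I" unfolding S(3) by (rule NA.genideal_self[OF S(1)])
  have I: "\<Phi> M (?p a) = \<zero>\<^bsub>tensor R M B\<^esub> \<longleftrightarrow> a \<in> I" if "a \<in> carrier A" for a
    unfolding \<Phi>p[OF that] I_def using that by simp
  define kills where "kills r a \<longleftrightarrow> r \<odot>\<^bsub>tensor R M A\<^esub> ?p a = \<zero>\<^bsub>tensor R M A\<^esub>" for r a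
  have mono: "kills (s \<otimes>\<^bsub>R\<^esub> r) a" if "kills r a" "r \<in> carrier R" "s \<in> carrier R" "a \<in> carrier A" for
    r s a
    using that p by (simp add: kills_def MA.smult_assoc1)
  have ex: "\<exists>r\<in>carrier R. r \<notin> J \<and> kills r a" if "a \<in> S" for a
    using kernel_torsion[OF p[of a]] I[of a] that SI S(1) unfolding kills_def by blast
  have "\<exists>r\<in>carrier R. r \<notin> J \<and> (\<forall>a\<in>S. kills r a)"
    using S(2,1) ex
  proof (induction S rule: finite_induct)
    case empty
    have "\<one>\<^bsub>R\<^esub> \<notin> J" using J.I_notcarr J.one_imp_carrier by blast
    then show ?case by blast
  next
    case (insert a S)
    have "\<exists>r\<in>carrier R. r \<notin> J \<and> (\<forall>a\<in>S. kills r a)" using insert.IH insert.prems by simp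
    moreover have "\<exists>s\<in>carrier R. s \<notin> J \<and> kills s a" using insert.prems(2) by simp
    ultimately obtain r s where r: "r \<in> carrier R" "r \<notin> J" "\<forall>a\<in>S. kills r a"
      and s: "s \<in> carrier R" "s \<notin> J" "kills s a" by blast
    have aA: "a \<in> carrier A" "\<And>b. b \<in> S \<Longrightarrow> b \<in> carrier A" using insert.prems(1) by auto
    have "\<forall>b\<in>S. kills (s \<otimes>\<^bsub>R\<^esub> r) b" using mono[OF _ r(1) s(1)] r(3) aA(2) by simp
    moreover have "kills (s \<otimes>\<^bsub>R\<^esub> r) a"
      unfolding MA.R.m_comm[OF s(1) r(1)] by (rule mono[OF s(3) s(1) r(1) aA(1)])
    moreover have "s \<otimes>\<^bsub>R\<^esub> r \<notin> J" using J.I_prime[OF s(1) r(1)] r(2) s(2) by blast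
    ultimately show ?case using MA.R.m_closed[OF s(1) r(1)] by blast
  qed
  then obtain r where r: "r \<in> carrier R" "r \<notin> J" "\<And>a. a \<in> S \<Longrightarrow> kills r a" by blast
  \<comment> \<open>The elements \<open>a\<close> with \<open>g \<otimes> a\<close> killed by
    \<open>r\<close> also form an ideal, so containing the generators \<open>S\<close> it contains
    all of \<open>I\<close>.\<close>
  let ?T = "{a \<in> carrier A. pure_tensor R M A (r \<odot>\<^bsub>M\<^esub> g) (id a) = \<zero>\<^bsub>tensor R M A\<^esub>}"
  have kT: "kills r a \<longleftrightarrow> a \<in> ?T" if "a \<in> carrier A" for a
    using that unfolding kills_def pure_tensor_smult[OF M A r(1) g that] by simp
  have "ideal ?T A"
    by (rule pure_tensor_zero_ideal[OF M _ A_alg A_alg id]) (use r g in simp_all)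
  moreover have "S \<subseteq> ?T" using kT r(3) S(1) by blast
  ultimately have IT: "I \<subseteq> ?T" unfolding S(3) by (rule NA.genideal_minimal)
  show thesis
  proof (rule that[OF r(1,2)])
    fix x assume x: "x \<in> carrier (tensor R M A)" "\<Phi> M x = \<zero>\<^bsub>tensor R M B\<^esub>"
    obtain a where a: "a \<in> carrier A" "x = ?p a" using cyclic_tensor_pure[OF cyc A x(1)] by blast
    have "a \<in> I" using x(2) I[OF a(1)] unfolding a(2) by (rule iffD1[rotated])
    then have "kills r a" using kT[OF a(1)] IT by blast
    then show "r \<odot>\<^bsub>tensor R M A\<^esub> x = \<zero>\<^bsub>tensor R M A\<^esub>" unfolding kills_def a(2) .
  qed
qed

text \<open>The interplay of two facts about scalars \<open>s\<close> outside \<open>J\<close>: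
  \<open>cancel\<close> removes \<open>s\<close> on the side of \<open>B\<close>, where flatness is
  available, and \<open>divide\<close> brings divisibility by \<open>s\<close> from the side of
  \<open>B\<close> back to that of \<open>A\<close>, by exactness for \<open>M/sM\<close>.\<close>

lemma exact_prime:
  assumes IH: "\<And>(Q :: ('r, 'm) module) q. cyclic R Q q \<Longrightarrow> J \<subset> annihilator R Q q \<Longrightarrow> exact Q"
  shows "exact M"
proof (rule exactI)
  note id = linear_maps_id(1)
  interpret J: primeideal J R by (rule J)
  interpret M: module R M by (rule M)
  interpret MA: module R "tensor R M A" by (rule tensor_module[OF M A])
  interpret MB: module R "tensor R M B" by (rule tensor_module[OF M B])
  have g: "g \<in> carrier M" by (rule cyclicD(2)[OF cyc])
  obtain r0 where r0: "r0 \<in> carrier R" "r0 \<notin> J" and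
    kill: "\<And>x. x \<in> carrier (tensor R M A) \<Longrightarrow> \<Phi> M x = \<zero>\<^bsub>tensor R M B\<^esub>
      \<Longrightarrow> r0 \<odot>\<^bsub>tensor R M A\<^esub> x = \<zero>\<^bsub>tensor R M A\<^esub>"
    by (rule kernel_uniform_torsion) blast
  \<comment> \<open>\<open>M\<close> is a copy of \<open>R/J\<close> with \<open>J\<close> prime, so
    \<open>s\<close> acts on it without kernel.\<close>
  have inj: "inj_on (\<lambda>m. s \<odot>\<^bsub>M\<^esub> m) (carrier M)" if s: "s \<in> carrier R" "s \<notin> J" for s
  proof (rule linear_map_inj_on[OF M M module_smult_linear[OF M s(1)]])
    fix m assume m: "m \<in> carrier M" "s \<odot>\<^bsub>M\<^esub> m = \<zero>\<^bsub>M\<^esub>"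
    obtain r where r: "r \<in> carrier R" "m = r \<odot>\<^bsub>M\<^esub> g" using cyclicD(3)[OF cyc m(1)] by blast
    then have "s \<otimes>\<^bsub>R\<^esub> r \<in> J" using m(2) s g unfolding ann[symmetric] annihilator_def by
      (simp add: M.smult_assoc1)
    then have "r \<in> J" using J.I_prime[OF s(1) r(1)] s(2) by blast
    then show "m = \<zero>\<^bsub>M\<^esub>" unfolding ann[symmetric] r(2) annihilator_def by simp
  qed
  have cancel: "u = \<zero>\<^bsub>tensor R M B\<^esub>"
    if s: "s \<in> carrier R" "s \<notin> J" and u: "u \<in> carrier (tensor R M B)" "s \<odot>\<^bsub>tensor R M B\<^esub> u = \<zero>\<^bsub>tensor
      R M B\<^esub>" for s u
    by (rule flat_injective[OF flat_B M M module_smult_linear[OF M s(1)] inj[OF s] u(1)])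
      (simp only: tensor_map_smult_left[OF M B s(1) u(1)] u(2))
  \<comment> \<open>Modulo \<open>s\<close> the image of \<open>x\<close> vanishes, so injectivity
    for \<open>Q = M/sM\<close> makes \<open>x\<close> vanish in the tensor product of
    \<open>Q\<close> and \<open>A\<close>. Right exactness for multiplication by \<open>s\<close>
    followed by \<open>p\<close> then gives the quotient \<open>y\<close>.\<close>
  have divide: "\<exists>y\<in>carrier (tensor R M A). x = s \<odot>\<^bsub>tensor R M A\<^esub> y"
    if s: "s \<in> carrier R" "s \<notin> J" and x: "x \<in> carrier (tensor R M A)"
      and z: "z \<in> carrier (tensor R M B)" "\<Phi> M x = s \<odot>\<^bsub>tensor R M B\<^esub> z" for s x z
  proof -
    obtain Q :: "('r, 'm) module" and p where cQ: "cyclic R Q (p g)" and p: "p \<in> linear_maps R M Q"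
      and surj: "p ` carrier M = carrier Q"
      and ker: "\<And>m. m \<in> carrier M \<Longrightarrow> p m = \<zero>\<^bsub>Q\<^esub> \<longleftrightarrow> m \<in> (\<lambda>m. s \<odot>\<^bsub>M\<^esub> m) ` carrier M"
      and annQ: "annihilator R M g \<subseteq> annihilator R Q (p g)" "s \<in> annihilator R Q (p g)"
      by (rule cyclic_quotient[OF cyc s(1)]) (rule that; assumption)
    have "exact Q" by (rule IH[OF cQ]) (use annQ ann s in blast)
    note Q = cyclicD(1)[OF cQ]
    note sl = module_smult_linear[OF M s(1)]
    have ps: "(\<lambda>m. p (s \<odot>\<^bsub>M\<^esub> m)) \<in> linear_maps R M Q" by (rule linear_maps_comp[OF sl p])
    have "\<Phi> Q (tensor_map R Q A p id x) = tensor_map R Q B p id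
      (tensor_map R M B (\<lambda>m. s \<odot>\<^bsub>M\<^esub> m) id z)"
      unfolding \<Phi>_natural[OF M Q p x] z(2) tensor_map_smult_left[OF M B s(1) z(1)] ..
    also have "\<dots> = tensor_map R Q B (\<lambda>m. p (s \<odot>\<^bsub>M\<^esub> m)) id z"
      by (rule tensor_map_comp_left[OF M B M Q sl p _ z(1)]) simp
    also have "\<dots> = \<zero>\<^bsub>tensor R Q B\<^esub>"
      by (rule tensor_map_zero[OF M B Q B ps id _ z(1)]) (use ker s(1) in simp)
    finally have "tensor_map R Q A p id x = \<zero>\<^bsub>tensor R Q A\<^esub>"
      by (rule exactD(1)[OF \<open>exact Q\<close> linear_mapsD(1)[OF tensor_map_linear[OF M A Q A p id] x]])
    note px = this
    obtain y where y: "y \<in> carrier (tensor R M A)" "x = tensor_map R M A (\<lambda>m. s \<odot>\<^bsub>M\<^esub> m) id y"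
      by (rule tensor_right_exact[OF M M Q A sl p surj _ x px]) (use ker in blast)+
    then show ?thesis unfolding y(2) tensor_map_smult_left[OF M A s(1) y(1)] by blast
  qed
  {
    fix x assume x: "x \<in> carrier (tensor R M A)" "\<Phi> M x = \<zero>\<^bsub>tensor R M B\<^esub>"
    \<comment> \<open>Here zero serves as the multiple of \<open>r0\<close>. The quotient
      \<open>y\<close> will again be in the kernel, hence is killed by \<open>r0\<close>, and
      \<open>x\<close> is precisely \<open>r0 y\<close>.\<close>
    obtain y where y: "y \<in> carrier (tensor R M A)" "x = r0 \<odot>\<^bsub>tensor R M A\<^esub> y"
      using divide[OF r0 x(1) MB.zero_closed] x(2) r0 by auto
    have "r0 \<odot>\<^bsub>tensor R M B\<^esub> \<Phi> M y = \<zero>\<^bsub>tensor R M B\<^esub>"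
      using x(2) linear_mapsD(3)[OF \<Phi>_linear[OF M] r0(1) y(1)] unfolding y(2) by simp
    then have "\<Phi> M y = \<zero>\<^bsub>tensor R M B\<^esub>"
      by (rule cancel[OF r0 linear_mapsD(1)[OF \<Phi>_linear[OF M] y(1)]])
    then show "x = \<zero>\<^bsub>tensor R M A\<^esub>" unfolding y(2) by (rule kill[OF y(1)])
  next
    fix x assume x: "x \<in> carrier (tensor R M B)" "\<Delta> M x = \<zero>\<^bsub>tensor R M D\<^esub>"
    \<comment> \<open>The scalar may depend on \<open>x\<close>, as it is divided out of
      \<open>y\<close> and cancelled right away.\<close>
    obtain s y where s: "s \<in> carrier R" "s \<notin> J" and y: "y \<in> carrier (tensor R M A)"
      "s \<odot>\<^bsub>tensor R M B\<^esub> x = \<Phi> M y" using cokernel_torsion[OF x] by blast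
    obtain y' where y': "y' \<in> carrier (tensor R M A)" "y = s \<odot>\<^bsub>tensor R M A\<^esub> y'"
      using divide[OF s y(1) x(1)] y(2) by auto
    have \<Phi>y: "\<Phi> M y' \<in> carrier (tensor R M B)" by (rule linear_mapsD(1)[OF \<Phi>_linear[OF M] y'(1)])
    have "s \<odot>\<^bsub>tensor R M B\<^esub> (x \<oplus>\<^bsub>tensor R M B\<^esub> \<ominus>\<^bsub>tensor R M B\<^esub> \<Phi> M y') = \<zero>\<^bsub>tensor R M B\<^esub>"
      using linear_mapsD(3)[OF \<Phi>_linear[OF M] s(1) y'(1)] y(2) x(1) s(1) \<Phi>y
      unfolding y'(2) by (simp add: MB.smult_r_distr MB.smult_r_minus MB.r_neg)
    then have "x \<oplus>\<^bsub>tensor R M B\<^esub> \<ominus>\<^bsub>tensor R M B\<^esub> \<Phi> M y' = \<zero>\<^bsub>tensor R M B\<^esub>"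
      by (rule cancel[OF s, rotated]) (use x(1) \<Phi>y in simp)
    then have "x = \<Phi> M y'" using MB.minus_equality[of x "\<ominus>\<^bsub>tensor R M B\<^esub> \<Phi> M y'"] x(1) \<Phi>y by simp
    then show "\<exists>y\<in>carrier (tensor R M A). x = \<Phi> M y" using y'(1) by blast
  }
qed

end

text \<open>The induction is on the annihilator and speaks of all cyclic modules on the type
  \<open>'m\<close> at once, so that it covers the submodules and quotients of \<open>M\<close> met
  on the way. The residue fields may live on another type \<open>'k\<close>.\<close>

lemma exact_cyclic:
  fixes M :: "('r, 'm) module"
  assumes residue: "\<And>J. primeideal J R \<Longrightarrow> \<exists>(K :: ('r, 'k) module) u. module R K \<and> exact K \<and> u \<in>
    carrier K
      \<and> annihilator R K u = J \<and> (\<forall>r\<in>J. \<forall>k\<in>carrier K. r \<odot>\<^bsub>K\<^esub> k = \<zero>\<^bsub>K\<^esub>)"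
    and "cyclic R M g"
  shows "exact M"
proof -
  interpret NR: noetherian_ring R by (rule R_noetherian)
  have "\<forall>(M :: ('r, 'm) module) g. cyclic R M g \<longrightarrow> annihilator R M g = J \<longrightarrow> exact M" for J
  proof (induction J rule: wf_induct[OF NR.ideal_reverse_wf])
    case (1 J)
    show ?case
    proof (intro allI impI)
      fix M :: "('r, 'm) module" and g
      assume cyc: "cyclic R M g" and ann: "annihilator R M g = J"
      note M = cyclicD(1)[OF cyc] and g = cyclicD(2)[OF cyc]
      interpret M: module R M by (rule M)
      have J: "ideal J R" unfolding ann[symmetric] by (rule annihilator_ideal[OF M g])
      have IH: "exact Q" if "cyclic R Q q" "J \<subset> annihilator R Q q" for Q :: "('r, 'm) module" and q
        using 1[rule_format, of "annihilator R Q q" Q q] that J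
          annihilator_ideal[OF cyclicD(1,2)[OF that(1)]] by simp
      consider "J = carrier R" | "primeideal J R" |
        x y where "x \<in> carrier R" "y \<in> carrier R" "x \<otimes>\<^bsub>R\<^esub> y \<in> J" "x \<notin> J" "y \<notin> J"
        using primeidealI[OF J M.R.cring_axioms] by metis
      then show "exact M"
      proof cases
        case 1
        then have "\<one>\<^bsub>R\<^esub> \<odot>\<^bsub>M\<^esub> g = \<zero>\<^bsub>M\<^esub>" using ann by (auto simp: annihilator_def)
        then have "g = \<zero>\<^bsub>M\<^esub>" using g by simp
        then have "carrier M \<subseteq> {\<zero>\<^bsub>M\<^esub>}" using cyclicD(3)[OF cyc] by auto
        then show ?thesis by (rule exact_trivial[OF M])
      next
        case 2
        obtain K :: "('r, 'k) module" and u where K: "module R K" "exact K" "u \<in> carrier K"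
          "annihilator R K u = J" "\<And>r k. r \<in> J \<Longrightarrow> k \<in> carrier K \<Longrightarrow> r \<odot>\<^bsub>K\<^esub> k = \<zero>\<^bsub>K\<^esub>"
          using residue[OF 2] by blast
        obtain \<iota> where \<iota>: "\<iota> \<in> linear_maps R M K" "inj_on \<iota> (carrier M)"
          by (rule cyclic_map[OF cyc K(1,3)]) (simp add: ann K(4))
        show ?thesis by (rule exact_prime[OF cyc 2 ann K(1,2) \<iota> K(5) IH])
      next
        case 3
        \<comment> \<open>The extension is \<open>xM\<close> by \<open>M/xM\<close>. The annihilator
          of the former gains \<open>y\<close>, that of the latter gains \<open>x\<close>, so both
          exceed \<open>J\<close>.\<close>
        let ?H = "(\<lambda>m. x \<odot>\<^bsub>M\<^esub> m) ` carrier M" let ?M = "M\<lparr>carrier := ?H\<rparr>"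
        have sub: "submodule ?H R M"
          by (rule image_submodule[OF M M module_smult_linear[OF M 3(1)]])
        note mod = restrict_module[OF M sub]
        have "cyclic R ?M (x \<odot>\<^bsub>M\<^esub> g)"
        proof (rule cyclicI[OF mod])
          show "x \<odot>\<^bsub>M\<^esub> g \<in> carrier ?M" using g by simp
          fix z assume "z \<in> carrier ?M"
          then obtain r where r: "r \<in> carrier R" "z = x \<odot>\<^bsub>M\<^esub> (r \<odot>\<^bsub>M\<^esub> g)" using cyclicD(3)[OF cyc] by
            auto
          then have "z = r \<odot>\<^bsub>M\<^esub> (x \<odot>\<^bsub>M\<^esub> g)" using smult_commute[OF M r(1) 3(1) g] by simp
          then show "\<exists>r\<in>carrier R. z = r \<odot>\<^bsub>?M\<^esub> (x \<odot>\<^bsub>M\<^esub> g)" using r(1) by auto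
        qed
        moreover have "J \<subset> annihilator R ?M (x \<odot>\<^bsub>M\<^esub> g)"
        proof
          show "J \<subseteq> annihilator R ?M (x \<odot>\<^bsub>M\<^esub> g)"
          proof
            fix r assume "r \<in> J"
            then have r: "r \<in> carrier R" "r \<odot>\<^bsub>M\<^esub> g = \<zero>\<^bsub>M\<^esub>" using ann by (auto simp: annihilator_def)
            then have "r \<odot>\<^bsub>M\<^esub> (x \<odot>\<^bsub>M\<^esub> g) = \<zero>\<^bsub>M\<^esub>"
              unfolding smult_commute[OF M r(1) 3(1) g] using 3(1) by simp
            then show "r \<in> annihilator R ?M (x \<odot>\<^bsub>M\<^esub> g)" using r(1) by (simp add: annihilator_def)
          qed
          have "(x \<otimes>\<^bsub>R\<^esub> y) \<odot>\<^bsub>M\<^esub> g = \<zero>\<^bsub>M\<^esub>" using 3(3) ann by (auto simp: annihilator_def)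
          then have "y \<odot>\<^bsub>M\<^esub> (x \<odot>\<^bsub>M\<^esub> g) = \<zero>\<^bsub>M\<^esub>"
            unfolding smult_commute[OF M 3(2,1) g] M.smult_assoc1[OF 3(1,2) g] .
          then show "J \<noteq> annihilator R ?M (x \<odot>\<^bsub>M\<^esub> g)" using 3(2,5) by (auto simp: annihilator_def)
        qed
        ultimately have ex1: "exact ?M" by (rule IH)
        obtain Q :: "('r, 'm) module" and p where cQ: "cyclic R Q (p g)" and p: "p \<in> linear_maps R
          M Q"
          "p ` carrier M = carrier Q" "\<And>m. m \<in> carrier M \<Longrightarrow> p m = \<zero>\<^bsub>Q\<^esub> \<longleftrightarrow> m \<in> ?H"
          "annihilator R M g \<subseteq> annihilator R Q (p g)" "x \<in> annihilator R Q (p g)"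
          by (rule cyclic_quotient[OF cyc 3(1)]) (rule that; assumption)
        have ex2: "exact Q" by (rule IH[OF cQ]) (use p(4,5) ann 3(4) in blast)
        have "p m = \<zero>\<^bsub>Q\<^esub> \<longleftrightarrow> m \<in> id ` carrier ?M" if "m \<in> carrier M" for m using p(3)[OF that] by simp
        then show ?thesis
          by (rule exact_extension[OF mod M cyclicD(1)[OF cQ]
            restrict_inclusion'[OF submodule_subset[OF sub]]
                inj_on_id p(1,2) _ ex1 ex2])
      qed
    qed
  qed
  with assms(2) show ?thesis by blast
qed

lemma exact_all:
  fixes M :: "('r, 'm) module"
  assumes "\<And>J. primeideal J R \<Longrightarrow> \<exists>(K :: ('r, 'k) module) u. module R K \<and> exact K \<and> u \<in> carrier K
      \<and> annihilator R K u = J \<and> (\<forall>r\<in>J. \<forall>k\<in>carrier K. r \<odot>\<^bsub>K\<^esub> k = \<zero>\<^bsub>K\<^esub>)"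
    and "module R M"
  shows "exact M"
  by (rule exact_of_cyclic[OF assms(2) exact_cyclic[OF assms(1)]])

end

section \<open>Tensor products of algebras and base change\<close>

lemma additive_map_add:
  assumes "abelian_group Q" "additive_map P Q f" "additive_map P Q g"
  shows "additive_map P Q (\<lambda>x. f x \<oplus>\<^bsub>Q\<^esub> g x)"
proof -
  interpret Q: abelian_group Q by fact
  show ?thesis using assms(2,3) by (auto simp: additive_map_def Pi_def Q.a_ac)
qed

lemma additive_map_neg:
  assumes "abelian_group Q" "additive_map P Q f"
  shows "additive_map P Q (\<lambda>x. \<ominus>\<^bsub>Q\<^esub> f x)"
proof -
  interpret Q: abelian_group Q by fact
  show ?thesis using assms(2) by (auto simp: additive_map_def Pi_def Q.minus_add)
qed

lemma tensor_ext_right: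
  assumes M: "module R M" and N: "module R N" and L: "module R L" and P: "abelian_group P"
    and f: "additive_map (tensor R L (tensor R M N)) P f"
    and g: "additive_map (tensor R L (tensor R M N)) P g"
    and eq: "\<And>l m n. l \<in> carrier L \<Longrightarrow> m \<in> carrier M \<Longrightarrow> n \<in> carrier N \<Longrightarrow>
      f (pure_tensor R L (tensor R M N) l (pure_tensor R M N m n))
        = g (pure_tensor R L (tensor R M N) l (pure_tensor R M N m n))"
    and u: "u \<in> carrier (tensor R L (tensor R M N))"
  shows "f u = g u"
proof (rule tensor_ext[OF L tensor_module[OF M N] P f g _ u])
  fix l y assume l: "l \<in> carrier L" and y: "y \<in> carrier (tensor R M N)"
  note add = balanced_mapD(6)[OF balanced_pure_tensor l, of "tensor R M N" R]
  show "f (pure_tensor R L (tensor R M N) l y) = g (pure_tensor R L (tensor R M N) l y)"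
    by (rule tensor_ext[OF M N P additive_map_comp[OF add f] additive_map_comp[OF add g] eq[OF l]
      y])
qed

text \<open>\<open>bal\<close> lets scalars pass between \<open>M\<close> and \<open>N\<close>,
  \<open>sm\<close> between \<open>L\<close> and \<open>M\<close>. Together they let scalars pass
  between \<open>L\<close> and the inner tensor product, as is seen on pure tensors.\<close>

lemma trilinear_balanced_right:
  assumes M: "module R M" and N: "module R N" and L: "module R L" and P: "abelian_group P"
    and bal: "\<And>l. l \<in> carrier L \<Longrightarrow> balanced_map R M N P (f l)"
    and add: "\<And>m n. m \<in> carrier M \<Longrightarrow> n \<in> carrier N \<Longrightarrow> additive_map L P (\<lambda>l. f l m n)"
    and sm: "\<And>r l m n. r \<in> carrier R \<Longrightarrow> l \<in> carrier L \<Longrightarrow> m \<in> carrier M \<Longrightarrow> n \<in> carrier N \<Longrightarrow>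
      f (r \<odot>\<^bsub>L\<^esub> l) m n = f l (r \<odot>\<^bsub>M\<^esub> m) n"
  shows "balanced_map R L (tensor R M N) P (\<lambda>l. tensor_lift P (f l))"
proof (rule balanced_mapI)
  interpret L: module R L by (rule L)
  interpret M: module R M by (rule M)
  note lift = tensor_lift_additive[OF M N P bal]
  note pure = tensor_lift_pure[OF M N P bal]
  show "tensor_lift P (f l) y \<in> carrier P" if "l \<in> carrier L" "y \<in> carrier (tensor R M N)" for l y
    by (rule additive_mapD(1)[OF lift[OF that(1)] that(2)])
  show "tensor_lift P (f l) (y \<oplus>\<^bsub>tensor R M N\<^esub> y') = tensor_lift P (f l) y \<oplus>\<^bsub>P\<^esub> tensor_lift P (f l) y'"
    if "l \<in> carrier L" "y \<in> carrier (tensor R M N)" "y' \<in> carrier (tensor R M N)" for l y y'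
    by (rule additive_mapD(2)[OF lift[OF that(1)] that(2,3)])
  show "tensor_lift P (f (l \<oplus>\<^bsub>L\<^esub> l')) y = tensor_lift P (f l) y \<oplus>\<^bsub>P\<^esub> tensor_lift P (f l') y"
    if l: "l \<in> carrier L" "l' \<in> carrier L" and y: "y \<in> carrier (tensor R M N)" for l l' y
  proof (rule tensor_ext[OF M N P _ _ _ y])
    show "additive_map (tensor R M N) P (tensor_lift P (f (l \<oplus>\<^bsub>L\<^esub> l')))" by (rule lift)
      (use l in simp)
    show "additive_map (tensor R M N) P (\<lambda>y. tensor_lift P (f l) y \<oplus>\<^bsub>P\<^esub> tensor_lift P (f l') y)"
      by (rule additive_map_add[OF P lift[OF l(1)] lift[OF l(2)]])
    show "tensor_lift P (f (l \<oplus>\<^bsub>L\<^esub> l')) (pure_tensor R M N m n)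
        = tensor_lift P (f l) (pure_tensor R M N m n) \<oplus>\<^bsub>P\<^esub> tensor_lift P (f l')
          (pure_tensor R M N m n)"
      if "m \<in> carrier M" "n \<in> carrier N" for m n
      using l that by (simp add: pure additive_mapD(2)[OF add[OF that]])
  qed
  show "tensor_lift P (f (r \<odot>\<^bsub>L\<^esub> l)) y = tensor_lift P (f l) (r \<odot>\<^bsub>tensor R M N\<^esub> y)"
    if r: "r \<in> carrier R" and l: "l \<in> carrier L" and y: "y \<in> carrier (tensor R M N)" for r l y
  proof (rule tensor_ext[OF M N P _ _ _ y])
    show "additive_map (tensor R M N) P (tensor_lift P (f (r \<odot>\<^bsub>L\<^esub> l)))" by (rule lift)
      (use l r in simp)
    show "additive_map (tensor R M N) P (\<lambda>y. tensor_lift P (f l) (r \<odot>\<^bsub>tensor R M N\<^esub> y))"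
      by (rule additive_map_comp[OF linear_mapsD(4)[OF module_smult_linear[OF tensor_module[OF M N]
        r]] lift[OF l]])
    show "tensor_lift P (f (r \<odot>\<^bsub>L\<^esub> l)) (pure_tensor R M N m n)
        = tensor_lift P (f l) (r \<odot>\<^bsub>tensor R M N\<^esub> pure_tensor R M N m n)"
      if "m \<in> carrier M" "n \<in> carrier N" for m n
      using l r that by (simp add: pure sm pure_tensor_smult[OF M N])
  qed
qed

context
  fixes R :: "('r, 'x) ring_scheme" and L :: "('r, 'l, 'y) module_scheme"
    and M :: "('r, 'm, 'z) module_scheme" and N :: "('r, 'n, 'w) module_scheme"
  assumes L: "module R L" and M: "module R M" and N: "module R N"
begin

text \<open>The direction opposite to \<open>tensor_assoc\<close>. It regroups
  \<open>N \<otimes> (B \<otimes> C)\<close> so that the flatness of \<open>B\<close> and then that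
  of \<open>C\<close> can be applied.\<close>

definition tensor_unassoc where
  "tensor_unassoc = (let P = tensor R (tensor R L M) N in
     tensor_lift P (\<lambda>l. tensor_lift P (\<lambda>m n. pure_tensor R (tensor R L M) N (pure_tensor R L M l m)
       n)))"

lemma tensor_unassoc:
  shows "additive_map (tensor R L (tensor R M N)) (tensor R (tensor R L M) N) tensor_unassoc"
    and "l \<in> carrier L \<Longrightarrow> m \<in> carrier M \<Longrightarrow> n \<in> carrier N \<Longrightarrow>
      tensor_unassoc (pure_tensor R L (tensor R M N) l (pure_tensor R M N m n))
        = pure_tensor R (tensor R L M) N (pure_tensor R L M l m) n"
proof -
  let ?P = "tensor R (tensor R L M) N"
  let ?f = "\<lambda>l m n. pure_tensor R (tensor R L M) N (pure_tensor R L M l m) n"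
  note LM = tensor_module[OF L M]
  note P = tensor_abelian[OF LM N]
  interpret M: module R M by (rule M)
  have bal: "balanced_map R M N ?P (?f l)" if "l \<in> carrier L" for l
    by (rule balanced_mapI)
      (use that in \<open>simp_all add: pure_tensor_closed pure_tensor_add_left pure_tensor_add_right
        pure_tensor_balanced[symmetric] pure_tensor_smult[OF L M, symmetric]\<close>)
  have bal': "balanced_map R L (tensor R M N) ?P (\<lambda>l. tensor_lift ?P (?f l))"
    by (rule trilinear_balanced_right[OF M N L P bal])
      (simp_all add: additive_map_def pure_tensor_closed pure_tensor_add_left pure_tensor_balanced)
  show "additive_map (tensor R L (tensor R M N)) (tensor R (tensor R L M) N) tensor_unassoc"
    unfolding tensor_unassoc_def Let_def
    by (rule tensor_lift_additive[OF L tensor_module[OF M N] P bal'])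
  show "tensor_unassoc (pure_tensor R L (tensor R M N) l (pure_tensor R M N m n))
        = pure_tensor R (tensor R L M) N (pure_tensor R L M l m) n"
    if "l \<in> carrier L" "m \<in> carrier M" "n \<in> carrier N"
    unfolding tensor_unassoc_def Let_def
    by (simp add: that tensor_lift_pure[OF L tensor_module[OF M N] P bal'] pure_tensor_closed
      tensor_lift_pure[OF M N P bal])
qed

text \<open>A left inverse is induced by \<open>k\<close>, which sends \<open>y\<close> and
  \<open>n\<close> to the image of \<open>y\<close> under
  \<open>l \<otimes> m \<mapsto> l \<otimes> (m \<otimes> n)\<close>.\<close>

lemma tensor_unassoc_inj:
  assumes u: "u \<in> carrier (tensor R L (tensor R M N))"
    and zero: "tensor_unassoc u = \<zero>\<^bsub>tensor R (tensor R L M) N\<^esub>"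
  shows "u = \<zero>\<^bsub>tensor R L (tensor R M N)\<^esub>"
proof -
  let ?P = "tensor R L (tensor R M N)"
  note LM = tensor_module[OF L M] and MN = tensor_module[OF M N] and id = linear_maps_id(1)
  note P = tensor_abelian[OF L MN]
  interpret N: module R N by (rule N)
  define k where "k y n = tensor_map R L (tensor R M N) id (\<lambda>m. pure_tensor R M N m n) y" for y n
  have lin: "(\<lambda>y. k y n) \<in> linear_maps R (tensor R L M) ?P" if "n \<in> carrier N" for n
    unfolding k_def by (rule tensor_map_linear[OF L M L MN id pure_tensor_linear(2)[OF M N that]])
  have pure: "k (pure_tensor R L M l m) n = pure_tensor R L (tensor R M N) l
    (pure_tensor R M N m n)"
    if "l \<in> carrier L" "m \<in> carrier M" "n \<in> carrier N" for l m n
    unfolding k_def using tensor_map_pure[OF L M L MN id pure_tensor_linear(2)[OF M N that(3)]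
      that(1,2)] by simp
  have bal: "balanced_map R (tensor R L M) N ?P k"
  proof (rule balanced_mapI)
    fix y n assume y: "y \<in> carrier (tensor R L M)" and n: "n \<in> carrier N"
    show "k y n \<in> carrier ?P" by (rule linear_mapsD(1)[OF lin[OF n] y])
    show "k (y \<oplus>\<^bsub>tensor R L M\<^esub> y') n = k y n \<oplus>\<^bsub>?P\<^esub> k y' n" if "y' \<in> carrier (tensor R L M)" for y'
      by (rule linear_mapsD(2)[OF lin[OF n] y that])
    show "k y (n \<oplus>\<^bsub>N\<^esub> n') = k y n \<oplus>\<^bsub>?P\<^esub> k y n'" if n': "n' \<in> carrier N" for n'
      by (rule tensor_ext[OF L M P linear_mapsD(4)[OF lin[OF N.a_closed[OF n n']]]
            additive_map_add[OF P linear_mapsD(4)[OF lin[OF n]] linear_mapsD(4)[OF lin[OF n']]] _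
              y])
        (simp add: pure n n' pure_tensor_add_right pure_tensor_closed)
    show "k (r \<odot>\<^bsub>tensor R L M\<^esub> y) n = k y (r \<odot>\<^bsub>N\<^esub> n)" if r: "r \<in> carrier R" for r
      unfolding linear_mapsD(3)[OF lin[OF n] r y]
    proof (rule tensor_ext[OF L M P additive_map_comp[OF linear_mapsD(4)[OF lin[OF n]]
            linear_mapsD(4)[OF module_smult_linear[OF tensor_module[OF L MN] r]]]
          linear_mapsD(4)[OF lin[OF N.smult_closed[OF r n]]] _ y])
      fix l m assume l: "l \<in> carrier L" and m: "m \<in> carrier M"
      show "r \<odot>\<^bsub>?P\<^esub> k (pure_tensor R L M l m) n = k (pure_tensor R L M l m) (r \<odot>\<^bsub>N\<^esub> n)"
        unfolding pure[OF l m n] pure[OF l m N.smult_closed[OF r n]]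
          pure_tensor_smult[OF L MN r l pure_tensor_closed[OF m n]]
          pure_tensor_balanced[OF r l pure_tensor_closed[OF m n]]
          pure_tensor_smult[OF M N r m n] pure_tensor_balanced[OF r m n] ..
    qed
  qed
  note \<kappa> = tensor_lift_additive[OF LM N P bal]
  have "tensor_lift ?P k (tensor_unassoc u) = u"
    by (rule tensor_ext_right[OF M N L P additive_map_comp[OF tensor_unassoc(1) \<kappa>]
          linear_mapsD(4)[OF linear_maps_id(2)] _ u])
      (simp add: tensor_unassoc(2) tensor_lift_pure[OF LM N P bal] pure pure_tensor_closed)
  then show ?thesis
    unfolding zero using additive_map_zero[OF tensor_abelian[OF LM N] P \<kappa>] by simp
qed

end

text \<open>After regrouping, the map is \<open>f\<close> tensored first with \<open>B\<close> and
  then with \<open>C\<close>. The second step concerns modules such as \<open>N \<otimes> B\<close>,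
  which are not on the type of the test modules, hence \<open>flat_injective\<close>.\<close>

lemma flat_tensor:
  fixes R :: "('r, 'x) ring_scheme" and B :: "('r, 'b, 'y) module_scheme" and C :: "('r, 'c, 'z)
    module_scheme"
  assumes B: "flat R B" and C: "flat R C"
  shows "flat R (tensor R B C)"
  unfolding flat_def
proof (intro conjI allI impI)
  have mB: "module R B" and mC: "module R C" using B C by (simp_all add: flat_def)
  note id = linear_maps_id(1)
  show mD: "module R (tensor R B C)" by (rule tensor_module[OF mB mC])
  fix N N' :: "('r, 'r list set) module" and f
  assume N: "module R N" and N': "module R N'" and f: "f \<in> linear_maps R N N'" "inj_on f
    (carrier N)"
  let ?D = "tensor R B C" and ?f = "tensor_map R N' B f id"
  note NB = tensor_module[OF N mB] and NB' = tensor_module[OF N' mB]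
  have fl: "?f \<in> linear_maps R (tensor R N B) (tensor R N' B)"
    by (rule tensor_map_linear[OF N mB N' mB f(1) id])
  have finj: "inj_on ?f (carrier (tensor R N B))"
    by (rule linear_map_inj_on[OF NB NB' fl]) (rule flat_injective[OF B N N' f])
  have fD: "tensor_map R N' ?D f id \<in> linear_maps R (tensor R N ?D) (tensor R N' ?D)"
    by (rule tensor_map_linear[OF N mD N' mD f(1) id])
  have fC: "tensor_map R (tensor R N' B) C ?f id \<in> linear_maps R (tensor R (tensor R N B) C)
    (tensor R (tensor R N' B) C)"
    by (rule tensor_map_linear[OF NB mC NB' mC fl id])
  show "inj_on (tensor_map R N' ?D f id) (carrier (tensor R N ?D))"
  proof (rule linear_map_inj_on[OF tensor_module[OF N mD] tensor_module[OF N' mD] fD])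
    fix u assume u: "u \<in> carrier (tensor R N ?D)" "tensor_map R N' ?D f id u = \<zero>\<^bsub>tensor R N' ?D\<^esub>"
    let ?\<theta> = "tensor_unassoc R N B C" and ?\<theta>' = "tensor_unassoc R N' B C"
    have "tensor_map R (tensor R N' B) C ?f id (?\<theta> u) = ?\<theta>' (tensor_map R N' ?D f id u)"
    proof (rule tensor_ext_right[OF mB mC N tensor_abelian[OF NB' mC] _ _ _ u(1)])
      show "additive_map (tensor R N ?D) (tensor R (tensor R N' B) C)
        (\<lambda>u. tensor_map R (tensor R N' B) C ?f id (?\<theta> u))"
        by (rule additive_map_comp[OF tensor_unassoc(1)[OF N mB mC] linear_mapsD(4)[OF fC]])
      show "additive_map (tensor R N ?D) (tensor R (tensor R N' B) C)
        (\<lambda>u. ?\<theta>' (tensor_map R N' ?D f id u))"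
        by (rule additive_map_comp[OF linear_mapsD(4)[OF fD] tensor_unassoc(1)[OF N' mB mC]])
      fix n b c assume nbc: "n \<in> carrier N" "b \<in> carrier B" "c \<in> carrier C"
      show "tensor_map R (tensor R N' B) C ?f id (?\<theta> (pure_tensor R N ?D n (pure_tensor R B C b c)))
        = ?\<theta>' (tensor_map R N' ?D f id (pure_tensor R N ?D n (pure_tensor R B C b c)))"
        unfolding tensor_unassoc(2)[OF N mB mC nbc] tensor_map_pure[OF NB mC NB' mC fl id
          pure_tensor_closed[OF nbc(1,2)] nbc(3)]
          tensor_map_pure[OF N mB N' mB f(1) id nbc(1,2)] id_apply
          tensor_map_pure[OF N mD N' mD f(1) id nbc(1) pure_tensor_closed[OF nbc(2,3)]]
          tensor_unassoc(2)[OF N' mB mC linear_mapsD(1)[OF f(1) nbc(1)] nbc(2,3)] ..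
    qed
    also have "\<dots> = \<zero>\<^bsub>tensor R (tensor R N' B) C\<^esub>" unfolding u(2)
      by (rule additive_map_zero[OF tensor_abelian[OF N' mD] tensor_abelian[OF NB' mC]
        tensor_unassoc(1)[OF N' mB mC]])
    finally have "?\<theta> u = \<zero>\<^bsub>tensor R (tensor R N B) C\<^esub>"
      by (rule flat_injective[OF C NB NB' fl finj additive_mapD(1)[OF tensor_unassoc(1)[OF N mB mC]
        u(1)]])
    then show "u = \<zero>\<^bsub>tensor R N ?D\<^esub>" by (rule tensor_unassoc_inj[OF N mB mC u(1)])
  qed
qed

section \<open>Pairings of tensor products\<close>

lemma tensor_map_family_balanced:
  assumes M: "module R M" and N: "module R N" and S: "module R S" and T: "module R T"
    and S': "module R S'" and T': "module R T'"
    and f: "\<And>m. m \<in> carrier M \<Longrightarrow> f m \<in> linear_maps R S S'"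
      "\<And>s. s \<in> carrier S \<Longrightarrow> (\<lambda>m. f m s) \<in> linear_maps R M S'"
    and g: "\<And>n. n \<in> carrier N \<Longrightarrow> g n \<in> linear_maps R T T'"
      "\<And>t. t \<in> carrier T \<Longrightarrow> (\<lambda>n. g n t) \<in> linear_maps R N T'"
    and v: "v \<in> carrier (tensor R S T)"
  shows "balanced_map R M N (tensor R S' T') (\<lambda>m n. tensor_map R S' T' (f m) (g n) v)"
proof (rule balanced_mapI)
  interpret M: module R M by (rule M)
  interpret N: module R N by (rule N)
  note P = tensor_abelian[OF S' T']
  note lin = tensor_map_linear[OF S T S' T' f(1) g(1)]
  note pure = tensor_map_pure[OF S T S' T' f(1) g(1)]
  note ext = tensor_ext[OF S T P _ _ _ v]
  note [simp] = linear_mapsD(1)[OF f(1)] linear_mapsD(1)[OF g(1)] linear_mapsD(2,3)[OF f(2)]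
    linear_mapsD(2,3)[OF g(2)]
  show "tensor_map R S' T' (f m) (g n) v \<in> carrier (tensor R S' T')" if "m \<in> carrier M" "n \<in>
    carrier N" for m n
    by (rule linear_mapsD(1)[OF lin[OF that] v])
  show "tensor_map R S' T' (f (m \<oplus>\<^bsub>M\<^esub> m')) (g n) v
      = tensor_map R S' T' (f m) (g n) v \<oplus>\<^bsub>tensor R S' T'\<^esub> tensor_map R S' T' (f m') (g n) v"
    if m: "m \<in> carrier M" "m' \<in> carrier M" and n: "n \<in> carrier N" for m m' n
    by (rule ext) (use m n in \<open>simp_all add: pure pure_tensor_add_left linear_mapsD(4)[OF lin]
      additive_map_add[OF P linear_mapsD(4)[OF lin] linear_mapsD(4)[OF lin]]\<close>)
  show "tensor_map R S' T' (f m) (g (n \<oplus>\<^bsub>N\<^esub> n')) v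
      = tensor_map R S' T' (f m) (g n) v \<oplus>\<^bsub>tensor R S' T'\<^esub> tensor_map R S' T' (f m) (g n') v"
    if m: "m \<in> carrier M" and n: "n \<in> carrier N" "n' \<in> carrier N" for m n n'
    by (rule ext) (use m n in \<open>simp_all add: pure pure_tensor_add_right linear_mapsD(4)[OF lin]
      additive_map_add[OF P linear_mapsD(4)[OF lin] linear_mapsD(4)[OF lin]]\<close>)
  show "tensor_map R S' T' (f (r \<odot>\<^bsub>M\<^esub> m)) (g n) v = tensor_map R S' T' (f m) (g (r \<odot>\<^bsub>N\<^esub> n)) v"
    if r: "r \<in> carrier R" and m: "m \<in> carrier M" and n: "n \<in> carrier N" for r m n
    by (rule ext) (use r m n in \<open>simp_all add: pure pure_tensor_balanced linear_mapsD(4)[OF lin]\<close>)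
qed

text \<open>The pairing \<open>(m \<otimes> n, s \<otimes> t) \<mapsto> f m s \<otimes> g n t\<close>, which gives both the product of a tensor
  product of
  algebras and the inverse of \<open>base_change_split\<close>.\<close>

definition tensor_pairing where
  "tensor_pairing R S' T' f g u v =
     tensor_lift (tensor R S' T') (\<lambda>m n. tensor_map R S' T' (f m) (g n) v) u"

context
  fixes R :: "('r, 'x) ring_scheme" and M :: "('r, 'm, 'x1) module_scheme" and N :: "('r, 'n, 'x2)
    module_scheme"
    and S :: "('r, 's, 'x3) module_scheme" and T :: "('r, 't, 'x4) module_scheme"
    and S' :: "('r, 's1, 'x5) module_scheme" and T' :: "('r, 't1, 'x6) module_scheme" and f g
  assumes M: "module R M" and N: "module R N" and S: "module R S" and T: "module R T"
    and S': "module R S'" and T': "module R T'"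
    and f: "\<And>m. m \<in> carrier M \<Longrightarrow> f m \<in> linear_maps R S S'"
      "\<And>s. s \<in> carrier S \<Longrightarrow> (\<lambda>m. f m s) \<in> linear_maps R M S'"
    and g: "\<And>n. n \<in> carrier N \<Longrightarrow> g n \<in> linear_maps R T T'"
      "\<And>t. t \<in> carrier T \<Longrightarrow> (\<lambda>n. g n t) \<in> linear_maps R N T'"
begin

abbreviation "pairing \<equiv> tensor_pairing R S' T' f g"

lemma tensor_pairing_additive_left:
  "v \<in> carrier (tensor R S T) \<Longrightarrow> additive_map (tensor R M N) (tensor R S' T') (\<lambda>u. pairing u v)"
  unfolding tensor_pairing_def
  by (rule tensor_lift_additive[OF M N tensor_abelian[OF S' T']
        tensor_map_family_balanced[OF M N S T S' T' f g]])

lemma tensor_pairing_pure_left: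
  "v \<in> carrier (tensor R S T) \<Longrightarrow> m \<in> carrier M \<Longrightarrow> n \<in> carrier N \<Longrightarrow>
    pairing (pure_tensor R M N m n) v = tensor_map R S' T' (f m) (g n) v"
  unfolding tensor_pairing_def
  by (rule tensor_lift_pure[OF M N tensor_abelian[OF S' T']
        tensor_map_family_balanced[OF M N S T S' T' f g]])

lemma tensor_pairing_pure:
  assumes "s \<in> carrier S" "t \<in> carrier T" "m \<in> carrier M" "n \<in> carrier N"
  shows "pairing (pure_tensor R M N m n) (pure_tensor R S T s t) = pure_tensor R S' T' (f m s)
    (g n t)"
  unfolding tensor_pairing_pure_left[OF pure_tensor_closed[OF assms(1,2)] assms(3,4)]
  by (rule tensor_map_pure[OF S T S' T' f(1)[OF assms(3)] g(1)[OF assms(4)] assms(1,2)])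

lemma tensor_pairing_additive_right:
  assumes u: "u \<in> carrier (tensor R M N)"
  shows "additive_map (tensor R S T) (tensor R S' T') (pairing u)"
  using u
proof (induction rule: tensor_induct)
  interpret ST: module R "tensor R S T" by (rule tensor_module[OF S T])
  interpret P: module R "tensor R S' T'" by (rule tensor_module[OF S' T'])
  note z0 = additive_map_zero[OF tensor_abelian[OF M N] P.abelian_group_axioms
    tensor_pairing_additive_left]
  {
    case zero
    show ?case by (simp add: additive_map_def Pi_def z0)
  next
    case (pure m n)
    then show ?case
      using linear_mapsD(1,2)[OF tensor_map_linear[OF S T S' T' f(1)[OF pure(1)] g(1)[OF pure(2)]]]
      by (simp add: additive_map_def Pi_def tensor_pairing_pure_left)
  next
    case (add u w)
    note a = additive_mapD(2)[OF tensor_pairing_additive_left add(1,2)]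
    from additive_map_add[OF P.abelian_group_axioms add(3,4)] show ?case
      by (simp add: additive_map_def Pi_def a)
  }
qed

lemma tensor_pairing_eqI:
  assumes u: "u \<in> carrier (tensor R M N)" and v: "v \<in> carrier (tensor R S T)" and Q: "abelian_group
    Q"
    and h: "additive_map (tensor R S' T') Q h"
    and k: "\<And>v. v \<in> carrier (tensor R S T) \<Longrightarrow> additive_map (tensor R M N) Q (\<lambda>u. k u v)"
      "\<And>u. u \<in> carrier (tensor R M N) \<Longrightarrow> additive_map (tensor R S T) Q (k u)"
    and eq: "\<And>m n s t. m \<in> carrier M \<Longrightarrow> n \<in> carrier N \<Longrightarrow> s \<in> carrier S \<Longrightarrow> t \<in> carrier T \<Longrightarrow>
      h (pure_tensor R S' T' (f m s) (g n t)) = k (pure_tensor R M N m n) (pure_tensor R S T s t)"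
  shows "h (pairing u v) = k u v"
proof (rule tensor_ext[OF M N Q additive_map_comp[OF tensor_pairing_additive_left[OF v] h]
  k(1)[OF v] _ u])
  fix m n assume mn: "m \<in> carrier M" "n \<in> carrier N"
  note p = pure_tensor_closed[OF mn]
  show "h (pairing (pure_tensor R M N m n) v) = k (pure_tensor R M N m n) v"
    by (rule tensor_ext[OF S T Q additive_map_comp[OF tensor_pairing_additive_right[OF p] h]
      k(2)[OF p] _ v])
      (simp add: tensor_pairing_pure mn eq)
qed

end

lemma algebra_assoc_algebra: "algebra R S \<Longrightarrow> assoc_algebra R S"
proof -
  assume S: "algebra R S"
  interpret S: algebra R S by (rule S)
  have "x \<otimes>\<^bsub>S\<^esub> (r \<odot>\<^bsub>S\<^esub> y) = r \<odot>\<^bsub>S\<^esub> (x \<otimes>\<^bsub>S\<^esub> y)" if "r \<in> carrier R" "x \<in> carrier S" "y \<in> carrier S" for r x y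
    using S.smult_assoc2[OF that(1,3,2)] that by (simp add: S.m_comm)
  then show ?thesis
    by (intro assoc_algebra.intro assoc_algebra_axioms.intro S.module S.ring_axioms S.smult_assoc2)
qed

text \<open>The double comprehension is evaluated row by row: a term \<open>(m, n)\<close> of
  \<open>u\<close> contributes the image of \<open>v\<close> under left multiplication by
  \<open>m\<close> and \<open>n\<close>, which no longer depends on the representative of
  \<open>v\<close>.\<close>

lemma tensor_mult_pairing:
  assumes A: "assoc_algebra R A" and B: "assoc_algebra R B"
    and u: "u \<in> carrier (tensor R A B)" and v: "v \<in> carrier (tensor R A B)"
  shows "u \<otimes>\<^bsub>tensor R A B\<^esub> v = tensor_pairing R A B (\<otimes>\<^bsub>A\<^esub>) (\<otimes>\<^bsub>B\<^esub>) u v"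
proof -
  note mA = assoc_algebra_module[OF A] and mB = assoc_algebra_module[OF B]
  let ?prod = "\<lambda>xs ys. [(m \<otimes>\<^bsub>A\<^esub> m', n \<otimes>\<^bsub>B\<^esub> n'). (m, n) \<leftarrow> xs, (m', n') \<leftarrow> ys]"
  let ?C = "carrier A \<times> carrier B"
  have v': "set (tensor_rep v) \<subseteq> ?C" "tensor_class R A B (tensor_rep v) = v"
    by (rule tensor_rep[OF mA mB v])+
  have "tensor_class R A B (?prod xs (tensor_rep v))
      = list_value (tensor R A B) (\<lambda>m n. tensor_map R A B (\<lambda>m'. m \<otimes>\<^bsub>A\<^esub> m') (\<lambda>n'. n \<otimes>\<^bsub>B\<^esub> n') v) xs \<and> set
        (?prod xs (tensor_rep v)) \<subseteq> ?C"
    if "set xs \<subseteq> ?C" for xs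
    using that
  proof (induction xs)
    case Nil
    show ?case by (simp add: tensor_zero_class)
  next
    case (Cons x xs)
    obtain m n where x: "x = (m, n)" by (cases x)
    with Cons.prems have mn: "m \<in> carrier A" "n \<in> carrier B" and xs: "set xs \<subseteq> ?C" by auto
    note l = assoc_algebra_mult_linear(1)[OF A mn(1)] assoc_algebra_mult_linear(1)[OF B mn(2)]
    let ?ys = "map (map_prod (\<lambda>m'. m \<otimes>\<^bsub>A\<^esub> m') (\<lambda>n'. n \<otimes>\<^bsub>B\<^esub> n')) (tensor_rep v)"
    have ys: "set ?ys \<subseteq> ?C" using v'(1) linear_mapsD(1)[OF l(1)] linear_mapsD(1)[OF l(2)] by auto
    have e: "?prod (x # xs) (tensor_rep v) = ?ys @ ?prod xs (tensor_rep v)"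
      by (simp add: x map_prod_def case_prod_unfold)
    note IH = Cons.IH[OF xs]
    have "tensor_class R A B (?ys @ ?prod xs (tensor_rep v))
      = tensor_class R A B ?ys \<oplus>\<^bsub>tensor R A B\<^esub> tensor_class R A B (?prod xs (tensor_rep v))"
      using tensor_add_class[OF ys, of "?prod xs (tensor_rep v)" R] IH by simp
    also have "tensor_class R A B ?ys = tensor_map R A B (\<lambda>m'. m \<otimes>\<^bsub>A\<^esub> m') (\<lambda>n'. n \<otimes>\<^bsub>B\<^esub> n') v"
      using tensor_map_class[OF mA mB mA mB l v'(1)] v'(2) by simp
    finally show ?case unfolding e using IH ys by (simp add: x)
  qed
  from this[OF tensor_rep(1)[OF mA mB u]] show ?thesis
    by (simp add: tensor_pairing_def tensor_lift_list_value) (simp add: tensor_def)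
qed

lemma base_change_simps [simp]:
  "carrier (base_change R S M) = carrier (tensor R S M)"
  "(\<otimes>\<^bsub>base_change R S M\<^esub>) = (\<otimes>\<^bsub>tensor R S M\<^esub>)"
  "\<one>\<^bsub>base_change R S M\<^esub> = \<one>\<^bsub>tensor R S M\<^esub>"
  "\<zero>\<^bsub>base_change R S M\<^esub> = \<zero>\<^bsub>tensor R S M\<^esub>"
  "(\<oplus>\<^bsub>base_change R S M\<^esub>) = (\<oplus>\<^bsub>tensor R S M\<^esub>)"
  by (simp_all add: base_change_def)

lemma additive_map_base_change [simp]:
  "additive_map (base_change R S M) P f = additive_map (tensor R S M) P f"
  by (simp add: additive_map_def)

lemma tensor_one: "\<one>\<^bsub>tensor R A B\<^esub> = pure_tensor R A B \<one>\<^bsub>A\<^esub> \<one>\<^bsub>B\<^esub>"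
  by (simp add: tensor_def)

section \<open>Base change of modules and of the coaction\<close>

locale algebra_base_change = S: algebra R S for R :: "('r, 'x) ring_scheme" and S :: "('r, 's, 'y)
  module_scheme"
begin

lemma S_assoc: "assoc_algebra R S" by (rule algebra_assoc_algebra[OF S.algebra_axioms])

lemma mS: "module R S" by (rule S.module)

lemma mult_S: "s \<in> carrier S \<Longrightarrow> (\<lambda>t. s \<otimes>\<^bsub>S\<^esub> t) \<in> linear_maps R S S"
  by (rule assoc_algebra_mult_linear(1)[OF S_assoc])

text \<open>It replaces the operation on representatives by a functorial map, from which additivity
  and the action on pure tensors follow.\<close>

lemma base_change_smult:
  assumes M: "module R M" and s: "s \<in> carrier S" and u: "u \<in> carrier (tensor R S M)"
  shows "s \<odot>\<^bsub>base_change R S M\<^esub> u = tensor_map R S M (\<lambda>t. s \<otimes>\<^bsub>S\<^esub> t) id u"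
proof -
  have "s \<odot>\<^bsub>base_change R S M\<^esub> u = tensor_class R S M (map (map_prod (\<lambda>t. s \<otimes>\<^bsub>S\<^esub> t) id) (tensor_rep u))"
    by (simp add: base_change_def map_prod_def case_prod_unfold id_def)
  also have "\<dots> = tensor_map R S M (\<lambda>t. s \<otimes>\<^bsub>S\<^esub> t) id (tensor_class R S M (tensor_rep u))"
    by (rule tensor_map_class[OF mS M mS M mult_S[OF s] linear_maps_id(1) tensor_rep(1)[OF mS M u],
      symmetric])
  finally show ?thesis unfolding tensor_rep(2)[OF mS M u] .
qed

lemma base_change_smult_pure:
  assumes M: "module R M" and "s \<in> carrier S" "t \<in> carrier S" "m \<in> carrier M"
  shows "s \<odot>\<^bsub>base_change R S M\<^esub> pure_tensor R S M t m = pure_tensor R S M (s \<otimes>\<^bsub>S\<^esub> t) m"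
  using assms by (simp add: base_change_smult pure_tensor_closed
      tensor_map_pure[OF mS M mS M mult_S linear_maps_id(1)])

lemma base_change_smult_linear:
  assumes M: "module R M" and s: "s \<in> carrier S"
  shows "(\<lambda>u. s \<odot>\<^bsub>base_change R S M\<^esub> u) \<in> linear_maps R (tensor R S M) (tensor R S M)"
  by (rule linear_maps_cong[OF tensor_module[OF mS M] tensor_map_linear[OF mS M mS M mult_S[OF s]
    linear_maps_id(1)]])
    (simp add: base_change_smult[OF M s])

lemma base_change_module:
  assumes M: "module R M"
  shows "module S (base_change R S M)"
proof -
  let ?T = "tensor R S M" and ?bc = "base_change R S M"
  interpret T: module R ?T by (rule tensor_module[OF mS M])
  note sl = base_change_smult_linear[OF M]
  note pure = base_change_smult_pure[OF M]
  note ext = tensor_ext[OF mS M T.abelian_group_axioms]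
  note add = linear_mapsD(4)[OF sl]
  show ?thesis
  proof (rule moduleI)
    show "cring S" by (rule S.M_cring)
    show "abelian_group ?bc"
    proof (rule abelian_groupI)
      fix x assume "x \<in> carrier ?bc"
      then show "\<exists>y\<in>carrier ?bc. y \<oplus>\<^bsub>?bc\<^esub> x = \<zero>\<^bsub>?bc\<^esub>"
        by (intro bexI[of _ "\<ominus>\<^bsub>?T\<^esub> x"]) (simp_all add: T.l_neg)
    qed (simp_all add: T.a_ac)
    show "s \<odot>\<^bsub>?bc\<^esub> x \<in> carrier ?bc" if "s \<in> carrier S" "x \<in> carrier ?bc" for s x
      using linear_mapsD(1)[OF sl[OF that(1)]] that(2) by simp
    show "s \<odot>\<^bsub>?bc\<^esub> (x \<oplus>\<^bsub>?bc\<^esub> y) = s \<odot>\<^bsub>?bc\<^esub> x \<oplus>\<^bsub>?bc\<^esub> s \<odot>\<^bsub>?bc\<^esub> y"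
      if "s \<in> carrier S" "x \<in> carrier ?bc" "y \<in> carrier ?bc" for s x y
      using linear_mapsD(2)[OF sl[OF that(1)]] that(2,3) by simp
    show "(s \<oplus>\<^bsub>S\<^esub> t) \<odot>\<^bsub>?bc\<^esub> x = s \<odot>\<^bsub>?bc\<^esub> x \<oplus>\<^bsub>?bc\<^esub> t \<odot>\<^bsub>?bc\<^esub> x"
      if st: "s \<in> carrier S" "t \<in> carrier S" and x: "x \<in> carrier ?bc" for s t x
      unfolding base_change_simps(5)
    proof (rule ext[OF add additive_map_add[OF T.abelian_group_axioms add[OF st(1)] add[OF st(2)]]])
      show "(s \<oplus>\<^bsub>S\<^esub> t) \<odot>\<^bsub>?bc\<^esub> pure_tensor R S M u m
          = s \<odot>\<^bsub>?bc\<^esub> pure_tensor R S M u m \<oplus>\<^bsub>?T\<^esub> t \<odot>\<^bsub>?bc\<^esub> pure_tensor R S M u m"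
        if "u \<in> carrier S" "m \<in> carrier M" for u m
        using st that by (simp add: pure S.l_distr pure_tensor_add_left)
    qed (use st x in simp_all)
    show "(s \<otimes>\<^bsub>S\<^esub> t) \<odot>\<^bsub>?bc\<^esub> x = s \<odot>\<^bsub>?bc\<^esub> (t \<odot>\<^bsub>?bc\<^esub> x)"
      if st: "s \<in> carrier S" "t \<in> carrier S" and x: "x \<in> carrier ?bc" for s t x
    proof (rule ext[OF add additive_map_comp[OF add[OF st(2)] add[OF st(1)]]])
      show "(s \<otimes>\<^bsub>S\<^esub> t) \<odot>\<^bsub>?bc\<^esub> pure_tensor R S M u m = s \<odot>\<^bsub>?bc\<^esub> (t \<odot>\<^bsub>?bc\<^esub> pure_tensor R S M u m)"
        if "u \<in> carrier S" "m \<in> carrier M" for u m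
        using st that by (simp add: pure S.m_assoc)
    qed (use st x in simp_all)
    show "\<one>\<^bsub>S\<^esub> \<odot>\<^bsub>?bc\<^esub> x = x" if x: "x \<in> carrier ?bc" for x
    proof (rule ext[OF add linear_mapsD(4)[OF linear_maps_id(2)]])
      show "\<one>\<^bsub>S\<^esub> \<odot>\<^bsub>?bc\<^esub> pure_tensor R S M u m = pure_tensor R S M u m"
        if "u \<in> carrier S" "m \<in> carrier M" for u m
        using that by (simp add: pure)
    qed (use x in simp_all)
  qed
qed

context
  fixes B :: "('r, 'b, 'z) module_scheme" and C :: "('r, 'c, 'w) module_scheme"
  assumes B: "module R B" and C: "module R C"
begin

abbreviation "BS \<equiv> base_change R S B"
abbreviation "CS \<equiv> base_change R S C"
abbreviation "BC \<equiv> tensor R B C"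

lemma BC: "module R BC" by (rule tensor_module[OF B C])

lemma base_change_split:
  shows "additive_map (tensor R S BC) (tensor S BS CS) (base_change_split R S C B)"
    and "s \<in> carrier S \<Longrightarrow> b \<in> carrier B \<Longrightarrow> c \<in> carrier C \<Longrightarrow>
      base_change_split R S C B (pure_tensor R S BC s (pure_tensor R B C b c))
        = pure_tensor S BS CS (pure_tensor R S B s b) (pure_tensor R S C \<one>\<^bsub>S\<^esub> c)"
proof -
  let ?P = "tensor S BS CS"
  let ?f = "\<lambda>s b c. pure_tensor S BS CS (pure_tensor R S B s b) (pure_tensor R S C \<one>\<^bsub>S\<^esub> c)"
  note BS = base_change_module[OF B] and CS = base_change_module[OF C]
  note P = tensor_abelian[OF BS CS]
  note add_B = pure_tensor_add_left[of _ BS _ _ CS S, simplified]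
    pure_tensor_add_right[of _ BS _ CS _ S, simplified]
  have r1: "(r \<odot>\<^bsub>S\<^esub> \<one>\<^bsub>S\<^esub>) \<otimes>\<^bsub>S\<^esub> s = r \<odot>\<^bsub>S\<^esub> s" if "r \<in> carrier R" "s \<in> carrier S" for r s
    using that by (simp add: S.smult_assoc2)
  \<comment> \<open>A scalar \<open>r\<close> of \<open>R\<close> acts on both base changes as the
    scalar \<open>r 1\<close> of \<open>S\<close>, and as such it crosses the tensor product over
    \<open>S\<close>.\<close>
  have bal_BC: "?f s (r \<odot>\<^bsub>B\<^esub> b) c = ?f s b (r \<odot>\<^bsub>C\<^esub> c)"
    if "r \<in> carrier R" "s \<in> carrier S" "b \<in> carrier B" "c \<in> carrier C" for r s b c
  proof -
    have 1: "pure_tensor R S B s (r \<odot>\<^bsub>B\<^esub> b) = (r \<odot>\<^bsub>S\<^esub> \<one>\<^bsub>S\<^esub>) \<odot>\<^bsub>BS\<^esub> pure_tensor R S B s b"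
      using that by (simp add: base_change_smult_pure[OF B] r1 pure_tensor_balanced)
    have 2: "pure_tensor R S C \<one>\<^bsub>S\<^esub> (r \<odot>\<^bsub>C\<^esub> c) = (r \<odot>\<^bsub>S\<^esub> \<one>\<^bsub>S\<^esub>) \<odot>\<^bsub>CS\<^esub> pure_tensor R S C \<one>\<^bsub>S\<^esub> c"
      using that by (simp add: base_change_smult_pure[OF C] r1 pure_tensor_balanced)
    show ?thesis unfolding 1 2
      by (rule pure_tensor_balanced) (use that in \<open>simp_all add: pure_tensor_closed\<close>)
  qed
  interpret B: module R B by (rule B)
  interpret C: module R C by (rule C)
  have bal: "balanced_map R B C ?P (?f s)" if "s \<in> carrier S" for s
    by (rule balanced_mapI)
      (use that in \<open>simp_all add: bal_BC pure_tensor_closed pure_tensor_add_right add_B\<close>)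
  have bal': "balanced_map R S BC ?P (\<lambda>s. tensor_lift ?P (?f s))"
    by (rule trilinear_balanced_right[OF B C mS P bal])
      (simp_all add: additive_map_def Pi_def pure_tensor_closed pure_tensor_add_left add_B
        pure_tensor_balanced)
  show "additive_map (tensor R S BC) (tensor S BS CS) (base_change_split R S C B)"
    unfolding base_change_split_def Let_def
    by (rule tensor_lift_additive[OF mS BC P bal'])
  show "base_change_split R S C B (pure_tensor R S BC s (pure_tensor R B C b c))
      = pure_tensor S BS CS (pure_tensor R S B s b) (pure_tensor R S C \<one>\<^bsub>S\<^esub> c)"
    if "s \<in> carrier S" "b \<in> carrier B" "c \<in> carrier C"
    unfolding base_change_split_def Let_def
    by (simp add: that tensor_lift_pure[OF mS BC P bal'] pure_tensor_closed
      tensor_lift_pure[OF B C P bal])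
qed

text \<open>The left inverse is induced by the pairing \<mu>, which sends
  \<open>s \<otimes> b\<close> and \<open>t \<otimes> c\<close> to
  \<open>s t \<otimes> (b \<otimes> c)\<close>.\<close>

lemma base_change_split_inj:
  assumes u: "u \<in> carrier (tensor R S BC)" "base_change_split R S C B u = \<zero>\<^bsub>tensor S BS CS\<^esub>"
  shows "u = \<zero>\<^bsub>tensor R S BC\<^esub>"
proof -
  let ?P = "tensor R S BC"
  define \<mu> where "\<mu> = tensor_pairing R S BC (\<otimes>\<^bsub>S\<^esub>) (pure_tensor R B C)"
  note BS = base_change_module[OF B] and CS = base_change_module[OF C]
  note P = tensor_abelian[OF mS BC]
  note mult = assoc_algebra_mult_linear[OF S_assoc]
  note hyps = mS B mS C mS BC mult pure_tensor_linear[OF B C]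
  have left: "additive_map (tensor R S B) ?P (\<lambda>u. \<mu> u v)" if "v \<in> carrier (tensor R S C)" for v
    unfolding \<mu>_def by (rule tensor_pairing_additive_left[OF hyps that])
  have right: "additive_map (tensor R S C) ?P (\<mu> u)" if "u \<in> carrier (tensor R S B)" for u
    unfolding \<mu>_def by (rule tensor_pairing_additive_right[OF hyps that])
  have pure_left: "\<mu> (pure_tensor R S B s b) v = tensor_map R S BC (\<lambda>t. s \<otimes>\<^bsub>S\<^esub> t)
    (pure_tensor R B C b) v"
    if "v \<in> carrier (tensor R S C)" "s \<in> carrier S" "b \<in> carrier B" for v s b
    unfolding \<mu>_def by (rule tensor_pairing_pure_left[OF hyps that])
  have pure: "\<mu> (pure_tensor R S B s b) (pure_tensor R S C t c)
      = pure_tensor R S BC (s \<otimes>\<^bsub>S\<^esub> t) (pure_tensor R B C b c)"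
    if "t \<in> carrier S" "c \<in> carrier C" "s \<in> carrier S" "b \<in> carrier B" for s b t c
    unfolding \<mu>_def by (rule tensor_pairing_pure[OF hyps that])
  have bal: "balanced_map S BS CS ?P \<mu>"
    unfolding balanced_map_def
  proof (intro conjI ballI)
    show "additive_map BS ?P (\<lambda>m. \<mu> m n)" if "n \<in> carrier CS" for n using left that by simp
    show "additive_map CS ?P (\<mu> m)" if "m \<in> carrier BS" for m using right that by simp
    fix s x v assume s: "s \<in> carrier S" and x: "x \<in> carrier BS" and v: "v \<in> carrier CS"
    have v': "v \<in> carrier (tensor R S C)" using v by simp
    have sv: "s \<odot>\<^bsub>CS\<^esub> v \<in> carrier (tensor R S C)"
      using linear_mapsD(1)[OF base_change_smult_linear[OF C s] v'] .
    \<comment> \<open>Balancedness over \<open>S\<close> comes down to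
      \<open>(s t) x = t (s x)\<close>, that is, to commutativity of \<open>S\<close>.\<close>
    show "\<mu> (s \<odot>\<^bsub>BS\<^esub> x) v = \<mu> x (s \<odot>\<^bsub>CS\<^esub> v)"
    proof (rule tensor_ext[OF mS B P])
      show "additive_map (tensor R S B) ?P (\<lambda>x. \<mu> (s \<odot>\<^bsub>BS\<^esub> x) v)"
        by (rule additive_map_comp[OF linear_mapsD(4)[OF base_change_smult_linear[OF B s]]
          left[OF v']])
      show "additive_map (tensor R S B) ?P (\<lambda>x. \<mu> x (s \<odot>\<^bsub>CS\<^esub> v))" by (rule left[OF sv])
      show "x \<in> carrier (tensor R S B)" using x by simp
      fix t b assume t: "t \<in> carrier S" and b: "b \<in> carrier B"
      have "\<mu> (s \<odot>\<^bsub>BS\<^esub> pure_tensor R S B t b) v = tensor_map R S BC (\<lambda>x. (s \<otimes>\<^bsub>S\<^esub> t) \<otimes>\<^bsub>S\<^esub> x)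
        (pure_tensor R B C b) v"
        unfolding base_change_smult_pure[OF B s t b] by (rule pure_left[OF v' _ b])
          (use s t in simp)
      also have "\<dots> = tensor_map R S BC (\<lambda>x. t \<otimes>\<^bsub>S\<^esub> (s \<otimes>\<^bsub>S\<^esub> x)) (\<lambda>x. pure_tensor R B C b (id x)) v"
        by (rule tensor_map_cong[OF mS C mS BC mult(1) pure_tensor_linear(1)[OF B C b] _ _ v'])
          (use s t in \<open>simp_all add: S.m_ac\<close>)
      also have "\<dots> = tensor_map R S BC (\<lambda>x. t \<otimes>\<^bsub>S\<^esub> x) (pure_tensor R B C b) (s \<odot>\<^bsub>CS\<^esub> v)"
        unfolding base_change_smult[OF C s v']
        by (rule tensor_map_comp[OF mS C mS C mS BC mult(1)[OF s] linear_maps_id(1) mult(1)[OF t]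
          pure_tensor_linear(1)[OF B C b] v', symmetric])
      also have "\<dots> = \<mu> (pure_tensor R S B t b) (s \<odot>\<^bsub>CS\<^esub> v)"
        by (rule pure_left[OF sv t b, symmetric])
      finally show "\<mu> (s \<odot>\<^bsub>BS\<^esub> pure_tensor R S B t b) v = \<mu> (pure_tensor R S B t b) (s \<odot>\<^bsub>CS\<^esub> v)" .
    qed
  qed
  note \<beta> = tensor_lift_additive[OF BS CS P bal]
  have "tensor_lift ?P \<mu> (base_change_split R S C B u) = u"
  proof (rule tensor_ext_right[OF B C mS P additive_map_comp[OF base_change_split(1) \<beta>]
    linear_mapsD(4)[OF linear_maps_id(2)] _ u(1)])
    fix s b c assume sbc: "s \<in> carrier S" "b \<in> carrier B" "c \<in> carrier C"
    show "tensor_lift ?P \<mu> (base_change_split R S C B (pure_tensor R S BC s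
      (pure_tensor R B C b c)))
        = pure_tensor R S BC s (pure_tensor R B C b c)"
      using sbc by (simp add: base_change_split(2) tensor_lift_pure[OF BS CS P bal]
        pure_tensor_closed pure)
  qed
  then show ?thesis unfolding u(2)
    using additive_map_zero[OF tensor_abelian[OF BS CS] P \<beta>] by simp
qed

text \<open>Both sides of the invariance condition are values of the injective map
  \<open>base_change_split\<close>: at the image of \<open>m\<close> under \<open>\<omega>\<close>,
  and at its image under \<open>b \<mapsto> b \<otimes> 1\<close>. So invariance means that these
  two images agree before splitting.\<close>

lemma base_change_invariant_iff:
  assumes one: "\<one>\<^bsub>C\<^esub> \<in> carrier C" and \<omega>: "\<omega> \<in> linear_maps R B BC" and m: "m \<in> carrier (tensor R S B)"
  shows "base_change_coaction R S C B \<omega> m = pure_tensor S BS CS m \<one>\<^bsub>CS\<^esub>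
    \<longleftrightarrow> tensor_map R S BC id (\<lambda>b. \<omega> b \<ominus>\<^bsub>BC\<^esub> pure_tensor R B C b \<one>\<^bsub>C\<^esub>) m = \<zero>\<^bsub>tensor R S BC\<^esub>"
proof -
  note BS = base_change_module[OF B] and CS = base_change_module[OF C]
  note P = tensor_abelian[OF mS BC] and Q = tensor_abelian[OF BS CS]
  interpret P: abelian_group "tensor R S BC" by (rule P)
  interpret Q: abelian_group "tensor S BS CS" by (rule Q)
  interpret BC: module R BC by (rule BC)
  interpret B: module R B by (rule B)
  let ?\<alpha> = "base_change_split R S C B"
  let ?\<eta> = "\<lambda>b. pure_tensor R B C b \<one>\<^bsub>C\<^esub>" and ?d = "\<lambda>b. \<omega> b \<ominus>\<^bsub>BC\<^esub> pure_tensor R B C b \<one>\<^bsub>C\<^esub>"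
  note id = linear_maps_id(1)
  note \<eta> = pure_tensor_linear(2)[OF B C one]
  have d: "?d \<in> linear_maps R B BC"
    by (rule linear_mapsI)
      (simp_all add: a_minus_def linear_mapsD[OF \<omega>] linear_mapsD[OF \<eta>] BC.minus_add BC.a_ac
        BC.smult_r_distr BC.smult_r_minus)
  note L\<omega> = tensor_map_linear[OF mS B mS BC id \<omega>] and L\<eta> = tensor_map_linear[OF mS B mS BC id \<eta>]
    and Ld = tensor_map_linear[OF mS B mS BC id d]
  let ?w = "tensor_map R S BC id \<omega> m" and ?e = "tensor_map R S BC id ?\<eta> m"
  have we: "?w \<in> carrier (tensor R S BC)" "?e \<in> carrier (tensor R S BC)"
    by (rule linear_mapsD(1)[OF L\<omega> m] linear_mapsD(1)[OF L\<eta> m])+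
  have dm: "tensor_map R S BC id ?d m = ?w \<oplus>\<^bsub>tensor R S BC\<^esub> \<ominus>\<^bsub>tensor R S BC\<^esub> ?e"
  proof (rule tensor_ext[OF mS B P linear_mapsD(4)[OF Ld]
        additive_map_add[OF P linear_mapsD(4)[OF L\<omega>] additive_map_neg[OF P linear_mapsD(4)[OF L\<eta>]]]
          _ m])
    fix s b assume s: "s \<in> carrier S" and b: "b \<in> carrier B"
    note add = balanced_mapD(6)[OF balanced_pure_tensor s, of BC R]
    show "tensor_map R S BC id ?d (pure_tensor R S B s b) = tensor_map R S BC id \<omega>
      (pure_tensor R S B s b)
        \<oplus>\<^bsub>tensor R S BC\<^esub> \<ominus>\<^bsub>tensor R S BC\<^esub> tensor_map R S BC id ?\<eta> (pure_tensor R S B s b)"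
      unfolding tensor_map_pure[OF mS B mS BC id d s b] tensor_map_pure[OF mS B mS BC id \<omega> s b]
        tensor_map_pure[OF mS B mS BC id \<eta> s b] id_apply
        additive_map_diff[OF module_abelian[OF BC] P add linear_mapsD(1)[OF \<omega> b]
          linear_mapsD(1)[OF \<eta> b]]
      by (simp add: a_minus_def)
  qed
  have \<alpha>e: "pure_tensor S BS CS m \<one>\<^bsub>CS\<^esub> = ?\<alpha> ?e"
  proof (rule tensor_ext[OF mS B Q _ additive_map_comp[OF linear_mapsD(4)[OF L\<eta>]
    base_change_split(1)] _ m])
    have "\<one>\<^bsub>CS\<^esub> \<in> carrier CS" using one by (simp add: tensor_one pure_tensor_closed)
    from balanced_mapD(5)[OF balanced_pure_tensor this, of BS S]
    show "additive_map (tensor R S B) (tensor S BS CS) (\<lambda>m. pure_tensor S BS CS m \<one>\<^bsub>CS\<^esub>)" by simp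
    fix s b assume s: "s \<in> carrier S" and b: "b \<in> carrier B"
    show "pure_tensor S BS CS (pure_tensor R S B s b) \<one>\<^bsub>CS\<^esub> = ?\<alpha>
      (tensor_map R S BC id ?\<eta> (pure_tensor R S B s b))"
      unfolding tensor_map_pure[OF mS B mS BC id \<eta> s b] id_apply base_change_split(2)[OF s b one]
      by (simp add: tensor_one)
  qed
  have "base_change_coaction R S C B \<omega> m = pure_tensor S BS CS m \<one>\<^bsub>CS\<^esub> \<longleftrightarrow> ?\<alpha> ?w = ?\<alpha> ?e"
    unfolding \<alpha>e by (simp add: base_change_coaction_def)
  also have "inj_on ?\<alpha> (carrier (tensor R S BC))"
    by (rule additive_map_inj_on[OF P Q base_change_split(1)]) (rule base_change_split_inj)
  then have "?\<alpha> ?w = ?\<alpha> ?e \<longleftrightarrow> ?w = ?e" using we by (rule inj_on_eq_iff)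
  also have "?w = ?e \<longleftrightarrow> tensor_map R S BC id ?d m = \<zero>\<^bsub>tensor R S BC\<^esub>"
    unfolding dm using we P.minus_equality[of ?w "\<ominus>\<^bsub>tensor R S BC\<^esub> ?e"] by (auto simp: P.r_neg)
  finally show ?thesis .
qed

end

section \<open>The induced map as an isomorphism of algebras\<close>

context
  fixes A :: "('r, 'a, 'z) module_scheme" and B :: "('r, 'b, 'w) module_scheme" and \<phi>
  assumes A: "assoc_algebra R A" and B: "assoc_algebra R B" and \<phi>: "\<phi> \<in> algebra_hom R A B"
begin

lemma \<phi>_hom: "\<phi> \<in> linear_maps R A B" "\<phi> \<one>\<^bsub>A\<^esub> = \<one>\<^bsub>B\<^esub>"
  "a \<in> carrier A \<Longrightarrow> b \<in> carrier A \<Longrightarrow> \<phi> (a \<otimes>\<^bsub>A\<^esub> b) = \<phi> a \<otimes>\<^bsub>B\<^esub> \<phi> b"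
  using \<phi> by (auto simp: algebra_hom_def dest: ring_hom_memE)

lemma induced_map_hom: "induced_map R S B \<phi> \<in> algebra_hom S (base_change R S A) (base_change R S B)"
proof -
  note mA = assoc_algebra_module[OF A] and mB = assoc_algebra_module[OF B]
  note id = linear_maps_id(1)
  interpret A: assoc_algebra R A by (rule A)
  interpret B: assoc_algebra R B by (rule B)
  let ?\<Phi> = "tensor_map R S B id \<phi>"
  note lin = tensor_map_linear[OF mS mA mS mB id \<phi>_hom(1)]
  note pure = tensor_map_pure[OF mS mA mS mB id \<phi>_hom(1)]
  note mulS = assoc_algebra_mult_linear[OF S_assoc]
    and mulA = assoc_algebra_mult_linear[OF A] and mulB = assoc_algebra_mult_linear[OF B]
  note hA = mS mA mS mA mS mA mulS mulA and hB = mS mB mS mB mS mB mulS mulB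
  have "?\<Phi> (u \<otimes>\<^bsub>tensor R S A\<^esub> v) = ?\<Phi> u \<otimes>\<^bsub>tensor R S B\<^esub> ?\<Phi> v"
    if u: "u \<in> carrier (tensor R S A)" and v: "v \<in> carrier (tensor R S A)" for u v
  proof -
    have "?\<Phi> (tensor_pairing R S A (\<otimes>\<^bsub>S\<^esub>) (\<otimes>\<^bsub>A\<^esub>) u v) = tensor_pairing R S B (\<otimes>\<^bsub>S\<^esub>) (\<otimes>\<^bsub>B\<^esub>) (?\<Phi> u) (?\<Phi> v)"
    proof (rule tensor_pairing_eqI[OF hA u v tensor_abelian[OF mS mB] linear_mapsD(4)[OF lin],
          where k = "\<lambda>u v. tensor_pairing R S B (\<otimes>\<^bsub>S\<^esub>) (\<otimes>\<^bsub>B\<^esub>) (?\<Phi> u) (?\<Phi> v)"])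
      show "additive_map (tensor R S A) (tensor R S B) (\<lambda>u. tensor_pairing R S B (\<otimes>\<^bsub>S\<^esub>) (\<otimes>\<^bsub>B\<^esub>) (?\<Phi> u)
        (?\<Phi> v))"
        if "v \<in> carrier (tensor R S A)" for v
        by (rule additive_map_comp[OF linear_mapsD(4)[OF lin]
              tensor_pairing_additive_left[OF hB linear_mapsD(1)[OF lin that]]])
      show "additive_map (tensor R S A) (tensor R S B) (\<lambda>v. tensor_pairing R S B (\<otimes>\<^bsub>S\<^esub>) (\<otimes>\<^bsub>B\<^esub>) (?\<Phi> u)
        (?\<Phi> v))"
        if "u \<in> carrier (tensor R S A)" for u
        by (rule additive_map_comp[OF linear_mapsD(4)[OF lin]
              tensor_pairing_additive_right[OF hB linear_mapsD(1)[OF lin that]]])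
      fix s a t b assume *: "s \<in> carrier S" "a \<in> carrier A" "t \<in> carrier S" "b \<in> carrier A"
      show "?\<Phi> (pure_tensor R S A (s \<otimes>\<^bsub>S\<^esub> t) (a \<otimes>\<^bsub>A\<^esub> b))
          = tensor_pairing R S B (\<otimes>\<^bsub>S\<^esub>) (\<otimes>\<^bsub>B\<^esub>) (?\<Phi> (pure_tensor R S A s a))
            (?\<Phi> (pure_tensor R S A t b))"
        using * by (simp add: pure tensor_pairing_pure[OF hB] linear_mapsD(1)[OF \<phi>_hom(1)] \<phi>_hom(3))
    qed
    then show ?thesis
      unfolding tensor_mult_pairing[OF S_assoc A u v]
        tensor_mult_pairing[OF S_assoc B linear_mapsD(1)[OF lin u] linear_mapsD(1)[OF lin v]] .
  qed
  moreover have "?\<Phi> \<one>\<^bsub>tensor R S A\<^esub> = \<one>\<^bsub>tensor R S B\<^esub>"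
    by (simp add: tensor_one pure \<phi>_hom(2))
  ultimately have "?\<Phi> \<in> ring_hom (base_change R S A) (base_change R S B)"
    by (intro ring_hom_memI) (simp_all add: linear_mapsD[OF lin])
  moreover have "?\<Phi> \<in> linear_maps S (base_change R S A) (base_change R S B)"
  proof (rule linear_mapsI)
    fix s u assume s: "s \<in> carrier S" and "u \<in> carrier (base_change R S A)"
    then have u: "u \<in> carrier (tensor R S A)" by simp
    show "?\<Phi> (s \<odot>\<^bsub>base_change R S A\<^esub> u) = s \<odot>\<^bsub>base_change R S B\<^esub> ?\<Phi> u"
      unfolding base_change_smult[OF mA s u] base_change_smult[OF mB s linear_mapsD(1)[OF lin u]]
      by (rule tensor_map_commute[OF mS mS mA mB mult_S[OF s] \<phi>_hom(1) u])
  qed (simp_all add: linear_mapsD[OF lin])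
  ultimately show ?thesis by (simp add: algebra_hom_def induced_map_def)
qed

end

text \<open>The induced map is a homomorphism into the invariants in any case, so being an
  isomorphism means bijectivity onto the kernel \<open>?Z\<close> of the base change of
  \<open>d\<close>. Injectivity and surjectivity are the two clauses of \<open>tensor_exact\<close>,
  which depends on \<open>S\<close> as a module only.\<close>

lemma induced_map_iso_iff:
  fixes A :: "('r, 'a, 'z) module_scheme" and B :: "('r, 'b, 'w) module_scheme"
    and C :: "('r, 'c, 'v) module_scheme" and \<phi> \<omega>
  defines "d \<equiv> \<lambda>b. \<omega> b \<ominus>\<^bsub>tensor R B C\<^esub> pure_tensor R B C b \<one>\<^bsub>C\<^esub>"
  assumes A: "assoc_algebra R A" and B: "assoc_algebra R B" and \<phi>: "\<phi> \<in> algebra_hom R A B"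
    and C: "module R C" "\<one>\<^bsub>C\<^esub> \<in> carrier C" and \<omega>: "\<omega> \<in> linear_maps R B (tensor R B C)"
    and d: "d \<in> linear_maps R B (tensor R B C)" "\<And>a. a \<in> carrier A \<Longrightarrow> d (\<phi> a) = \<zero>\<^bsub>tensor R B C\<^esub>"
  shows "induced_map R S B \<phi> \<in> algebra_iso S (base_change R S A) (base_change_invariants R S C B \<omega>)
    \<longleftrightarrow> tensor_exact R A B (tensor R B C) \<phi> d S"
proof -
  note mA = assoc_algebra_module[OF A] and mB = assoc_algebra_module[OF B]
  note mD = tensor_module[OF mB C(1)]
  note id = linear_maps_id(1)
  let ?\<Phi> = "tensor_map R S B id \<phi>" and ?\<Delta> = "tensor_map R S (tensor R B C) id d"
  note lin = tensor_map_linear[OF mS mA mS mB id \<phi>_hom(1)[OF A B \<phi>]]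
  let ?Z = "{m \<in> carrier (tensor R S B). ?\<Delta> m = \<zero>\<^bsub>tensor R S (tensor R B C)\<^esub>}"
  have inv: "base_change_invariants R S C B \<omega> = (base_change R S B)\<lparr>carrier := ?Z\<rparr>"
    using base_change_invariant_iff[OF mB C \<omega>]
    by (simp add: base_change_invariants_def comodule_invariants_def d_def cong: conj_cong)
  have \<Phi>Z: "?\<Phi> x \<in> ?Z" if x: "x \<in> carrier (tensor R S A)" for x
  proof -
    have "?\<Delta> (?\<Phi> x) = tensor_map R S (tensor R B C) (\<lambda>x. id (id x)) (\<lambda>a. d (\<phi> a)) x"
      by (rule tensor_map_comp[OF mS mA mS mB mS mD id \<phi>_hom(1)[OF A B \<phi>] id d(1) x])
    also have "\<dots> = \<zero>\<^bsub>tensor R S (tensor R B C)\<^esub>"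
      by (rule tensor_map_zero[OF mS mA mS mD linear_maps_comp[OF id id]
        linear_maps_comp[OF \<phi>_hom(1)[OF A B \<phi>] d(1)] _ x])
        (simp add: d(2))
    finally show ?thesis using linear_mapsD(1)[OF lin x] by simp
  qed
  have "induced_map R S B \<phi> \<in> algebra_hom S (base_change R S A) (base_change_invariants R S C B \<omega>)"
    using induced_map_hom[OF A B \<phi>] \<Phi>Z
    by (auto simp: inv algebra_hom_def linear_maps_def induced_map_def ring_hom_def)
  then have "induced_map R S B \<phi> \<in> algebra_iso S (base_change R S A)
    (base_change_invariants R S C B \<omega>)
    \<longleftrightarrow> bij_betw ?\<Phi> (carrier (tensor R S A)) ?Z"
    by (simp add: algebra_iso_def inv induced_map_def)
  also have "\<dots> \<longleftrightarrow> tensor_exact R A B (tensor R B C) \<phi> d S"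
  proof
    assume bij: "bij_betw ?\<Phi> (carrier (tensor R S A)) ?Z"
    interpret SA: module R "tensor R S A" by (rule tensor_module[OF mS mA])
    have "x = \<zero>\<^bsub>tensor R S A\<^esub>" if "x \<in> carrier (tensor R S A)" "?\<Phi> x = \<zero>\<^bsub>tensor R S B\<^esub>" for x
      using inj_onD[OF bij_betw_imp_inj_on[OF bij] _ that(1) SA.zero_closed] that(2)
        linear_map_zero[OF tensor_module[OF mS mA] tensor_module[OF mS mB] lin] by (simp only:)
    moreover have "?\<Phi> ` carrier (tensor R S A) = ?Z" using bij by (rule bij_betw_imp_surj_on)
    ultimately show "tensor_exact R A B (tensor R B C) \<phi> d S" unfolding tensor_exact_def by blast
  next
    assume ex: "tensor_exact R A B (tensor R B C) \<phi> d S"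
    have "inj_on ?\<Phi> (carrier (tensor R S A))"
      by (rule linear_map_inj_on[OF tensor_module[OF mS mA] tensor_module[OF mS mB] lin])
        (use ex in \<open>simp add: tensor_exact_def\<close>)
    moreover have "?\<Phi> ` carrier (tensor R S A) = ?Z"
      using \<Phi>Z ex unfolding tensor_exact_def by blast
    ultimately show "bij_betw ?\<Phi> (carrier (tensor R S A)) ?Z" by (simp add: bij_betw_def)
  qed
  finally show ?thesis .
qed

end

theorem corollary2:
  fixes R :: "'r ring"
    and C :: "('r, 'c) module"
    and comult :: "'c \<Rightarrow> ('c \<times> 'c) list set"
    and counit :: "'c \<Rightarrow> 'r"
    and antipode :: "'c \<Rightarrow> 'c"
    and B :: "('r, 'b) module"
    and \<omega> :: "'b \<Rightarrow> ('b \<times> 'c) list set"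
    and A :: "('r, 'a) module"
    and \<phi> :: "'a \<Rightarrow> 'b"
    and S :: "('r, 's) module"
  assumes "dedekind_domain R"
    and "commutative_hopf_algebra R C comult counit antipode"
    and "flat R C"
    and "acts_on_algebra R C comult counit B \<omega>"
    and "flat R B"
    and "assoc_algebra R A"
    and "noetherian_ring A"
    and "\<phi> \<in> algebra_hom R A (comodule_invariants R C B \<omega>)"
    and "\<And>K :: ('r, 'r list set) module. algebra R K \<Longrightarrow> algebraically_closed K \<Longrightarrow>
           induced_map R K B \<phi>
             \<in> algebra_iso K (base_change R K A) (base_change_invariants R K C B \<omega>)"
    and "algebra R S"
  shows "induced_map R S B \<phi>
           \<in> algebra_iso S (base_change R S A) (base_change_invariants R S C B \<omega>)"
proof -
  let ?D = "tensor R B C"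
  define d where "d = (\<lambda>b. \<omega> b \<ominus>\<^bsub>?D\<^esub> pure_tensor R B C b \<one>\<^bsub>C\<^esub>)"
  interpret C: commutative_hopf_algebra R C comult counit antipode by (rule assms(2))
  have C: "module R C" "\<one>\<^bsub>C\<^esub> \<in> carrier C" by (rule C.module, simp)
  have B: "assoc_algebra R B" and \<omega>: "\<omega> \<in> linear_maps R B ?D"
    using assms(4) by (simp_all add: acts_on_algebra_def algebra_hom_def)
  note mB = assoc_algebra_module[OF B]
  note mD = tensor_module[OF mB C(1)]
  interpret D: module R ?D by (rule mD)
  have \<eta>: "(\<lambda>b. pure_tensor R B C b \<one>\<^bsub>C\<^esub>) \<in> linear_maps R B ?D"
    by (rule pure_tensor_linear(2)[OF mB C])
  have d: "d \<in> linear_maps R B ?D" unfolding d_def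
    by (rule linear_mapsI)
      (simp_all add: a_minus_def linear_mapsD[OF \<omega>] linear_mapsD[OF \<eta>] D.minus_add D.a_ac
        D.smult_r_distr D.smult_r_minus)
  have \<phi>: "\<phi> \<in> algebra_hom R A B" and inv: "\<And>a. a \<in> carrier A \<Longrightarrow> \<omega> (\<phi> a) = pure_tensor R B C (\<phi> a)
    \<one>\<^bsub>C\<^esub>"
    using assms(8) by (auto simp: algebra_hom_def linear_maps_def ring_hom_def
      comodule_invariants_def)
  have d0: "d (\<phi> a) = \<zero>\<^bsub>?D\<^esub>" if "a \<in> carrier A" for a
  proof -
    have "\<phi> a \<in> carrier B" using \<phi> that by (auto simp: algebra_hom_def linear_maps_def)
    from linear_mapsD(1)[OF \<eta> this] show ?thesis
      unfolding d_def inv[OF that] a_minus_def by (rule D.r_neg)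
  qed
  \<comment> \<open>The type of \<open>T\<close> is free here: the equivalence is used for the
    fields \<open>K\<close> of the hypothesis and for \<open>S\<close>.\<close>
  have iso: "induced_map R T B \<phi> \<in> algebra_iso T (base_change R T A)
    (base_change_invariants R T C B \<omega>)
      \<longleftrightarrow> tensor_exact R A B ?D \<phi> d T" if "algebra R T" for T :: "('r, 't) module"
    unfolding d_def
    by (rule algebra_base_change.induced_map_iso_iff[OF algebra_base_change.intro[OF that] assms(6)
      B \<phi> C \<omega>
          d[unfolded d_def] d0[unfolded d_def]])
  have "noetherian_domain R" using assms(1) by (simp add: dedekind_domain_def)
  then have R: "noetherian_ring R" by (simp add: noetherian_domain_def)
  interpret flat_algebra_complex R A B ?D \<phi> d
  proof (intro flat_algebra_complex.intro flat_complex.intro flat_algebra_complex_axioms.intro)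
    show "flat R ?D" by (rule flat_tensor[OF assms(5,3)])
    show "\<phi> \<in> linear_maps R A B" using \<phi> by (simp add: algebra_hom_def)
    show "\<phi> (a \<otimes>\<^bsub>A\<^esub> b) = \<phi> a \<otimes>\<^bsub>B\<^esub> \<phi> b" if "a \<in> carrier A" "b \<in> carrier A" for a b
      using \<phi> that by (auto simp: algebra_hom_def ring_hom_def)
  qed (use assms R B d d0 assoc_algebra_module in blast)+
  have "exact S"
  proof (rule exact_all)
    fix J assume J: "primeideal J R"
    interpret J: primeideal J R by (rule J)
    obtain K :: "('r, 'r list set) module" where K: "algebra R K" "algebraically_closed K"
      and ann: "\<And>r. r \<in> carrier R \<Longrightarrow> r \<odot>\<^bsub>K\<^esub> \<one>\<^bsub>K\<^esub> = \<zero>\<^bsub>K\<^esub> \<longleftrightarrow> r \<in> J"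
      using dedekind_residue_algebraically_closed[OF assms(1) J] by metis
    interpret K: algebra R K by (rule K)
    have "exact K" using iso[OF K(1)] assms(9)[OF K] by blast
    \<comment> \<open>The unit of \<open>K\<close> plays the part of the generator of
      \<open>R/J\<close> inside \<open>K\<close>.\<close>
    moreover have "annihilator R K \<one>\<^bsub>K\<^esub> = J"
      using ann J.a_subset by (auto simp: annihilator_def)
    moreover have "r \<odot>\<^bsub>K\<^esub> k = \<zero>\<^bsub>K\<^esub>" if "r \<in> J" "k \<in> carrier K" for r k
    proof -
      have r: "r \<in> carrier R" using that(1) J.a_subset by blast
      have "r \<odot>\<^bsub>K\<^esub> k = (r \<odot>\<^bsub>K\<^esub> \<one>\<^bsub>K\<^esub>) \<otimes>\<^bsub>K\<^esub> k" using K.smult_assoc2[OF r _ that(2), of "\<one>\<^bsub>K\<^esub>"] that(2) by simp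
      then show ?thesis using ann[OF r] that by simp
    qed
    ultimately show "\<exists>(K :: ('r, 'r list set) module) u. module R K \<and> exact K \<and> u \<in> carrier K
      \<and> annihilator R K u = J \<and> (\<forall>r\<in>J. \<forall>k\<in>carrier K. r \<odot>\<^bsub>K\<^esub> k = \<zero>\<^bsub>K\<^esub>)"
      using K.module K.one_closed by blast
  next
    show "module R S" by (rule algebra.module[OF assms(10)])
  qed
  then show ?thesis using iso[OF assms(10)] by blast
qed

end
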